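(* Let $\mathsf{M}$ be any of the following symmetric monoidal categories: sets; (graded) vector spaces with degree $0$ linear maps; chain complexes. Let $\iota:\mathcal{A}\mathit{ss}\to\mathcal{QO}$ be the canonical inclusion of the cyclic operad $\mathcal{A}\mathit{ss}$ as the $G=0$ part of the modular operad $\mathcal{QO}$. For any modular operad $\mathcal{P}$ in $\mathsf{M}$ and any morphism of cyclic operads $f:\mathcal{A}\mathit{ss}\to\mathcal{P}$ (i.e. to the cyclic operad underlying $\mathcal{P}$), there is a unique morphism of modular operads $\tilde f:\mathcal{QO}\to\mathcal{P}$ such that $\tilde f\circ\iota=f$. Consequently, $\mathcal{QO}$ is isomorphic, as a modular operad, to the modular envelope $\mathbf{Mod}(\mathcal{A}\mathit{ss})$.
   Context: **Modular operads.** A modular operad $\mathcal{P}$ in a symmetric monoidal category $\mathsf{M}$ consists of objects $\mathcal{P}(C,G)$ for every finite set $C$ and $G\in\mathbb{N}_0$, together with morphisms - $\mathcal{P}(\rho):\mathcal{P}(C,G)\to\mathcal{P}(D,G)$ for each bijection $\rho:C\to D$; - ${}_a\circ_b:\mathcal{P}(C_1\sqcup\{a\},G_1)\otimes\mathcal{P}(C_2\sqcup\{b\},G_2)\to\mathcal{P}(C_1\sqcup C_2,G_1+G_2)$; - $\xi_{ab}=\xi_{ba}:\mathcal{P}(C\sqcup\{a,b\},G)\to\mathcal{P}(C,G+1)$; such that, whenever the expressions make sense: 1. ${}_a\circ_b={}_b\circ_a\,\tau$, with $\tau$ the monoidal symmetry; 2. $\mathcal{P}(\mathrm{id}_C)=\mathrm{id}$,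 $\mathcal{P}(\rho\sigma)=\mathcal{P}(\rho)\mathcal{P}(\sigma)$; 3. $\mathcal{P}(\rho|_{C_1}\sqcup\sigma|_{C_2})\;{}_a\circ_b={}_{\rho(a)}\circ_{\sigma(b)}\,(\mathcal{P}(\rho)\otimes\mathcal{P}(\sigma))$; 4. $\mathcal{P}(\rho|_C)\,\xi_{ab}=\xi_{\rho(a)\rho(b)}\,\mathcal{P}(\rho)$; 5. $\xi_{ab}\xi_{cd}=\xi_{cd}\xi_{ab}$; 6. $\xi_{ab}\;{}_c\circ_d=\xi_{cd}\;{}_a\circ_b$; 7. ${}_a\circ_b\,(\xi_{cd}\otimes\mathrm{id})=\xi_{cd}\;{}_a\circ_b$; 8. ${}_a\circ_b\,(\mathrm{id}\otimes{}_c\circ_d)={}_c\circ_d\,({}_a\circ_b\otimes\mathrm{id})$. A morphism of modular operads is a family of morphisms of $\mathsf{M}$, one for each $(C,G)$, commuting with all $\mathcal{P}(\rho)$, ${}_a\circ_b$, $\xi_{ab}$. No stability condition and no units are imposed. **Cyclic operads.** A cyclic operad has objects $\mathcal{C}(C)$, bijection actions and operations ${}_a\circ_b$ satisfying axioms 1, 2, 3, 8 (ignoring $G$); morphisms commute with these. The forgetful functor from modular to cyclic operads sends $\mathcal{P}$ to its $G=0$ part $\mathcal{P}(-,0)$ with its bijection actions and operations ${}_a\circ_b$. The modular envelope $\mathbf{Mod}$ is the left adjoint of this forgetful functor. **The operad $\mathcal{QO}$.** A cycle $((x_1\cdots x_n))$, $n\ge 0$, is the equivalence class of a tuple of pairwise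 distinct elements $(x_1,\dots,x_n)$ under cyclic permutations (the empty cycle $(())$ is allowed). Juxtaposition $((aAbB))$ denotes concatenation, where $A,B$ are (possibly empty) tuples and $a,b$ single elements. The basis elements of $\mathcal{QO}(C,G)$ are the symbols $\{\mathbf{c}_1,\dots,\mathbf{c}_b\}^g$ with $b\ge 1$, $g\ge0$, $2g+b-1=G$, where $\{\mathbf{c}_1,\dots,\mathbf{c}_b\}$ is an unordered collection (multiset, since several empty cycles are allowed) of cycles whose underlying sets are disjoint with union $C$. If $\mathsf{M}$ is sets, $\mathcal{QO}(C,G)$ is the set of these symbols; in the linear cases it is their linear span (in degree $0$, with zero differential) and operations are extended linearly. Bijections act by relabelling. The operations are $$\{((aA)),\mathbf{c}_2,\dots,\mathbf{c}_b\}^g\;{}_a\circ_{a'}\;\{((a'A')),\mathbf{c}'_2,\dots,\mathbf{c}'_{b'}\}^{g'}=\{((AA')),\mathbf{c}_2,\dots,\mathbf{c}_b,\mathbf{c}'_2,\dots,\mathbf{c}'_{b'}\}^{g+g'},$$ $$\xi_{ad}\{((aAdB)),\mathbf{c}_2,\dots,\mathbf{c}_b\}^g=\{((A)),((B)),\mathbf{c}_2,\dots,\mathbf{c}_b\}^g,$$ $$\xi_{ad}\{((aA)),((dB)),\mathbf{c}_3,\dots,\mathbf{c}_b\}^g=\{((AB)),\mathbf{c}_3,\dots,\mathbf{c}_b\}^{g+1}.$$ (These symbols encode homeomorphism classes of compact oriented surfaces of genus $g$ with $b$ boundary components and marked points on the boundary.) **The operad $\mathcal{A}\mathit{ss}$.**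 The cyclic operad $\mathcal{A}\mathit{ss}$ is the $G=0$ part of $\mathcal{QO}$; its basis elements $\{((x_1\cdots x_n))\}^0$ are written simply $((x_1\cdots x_n))$. *)

theory Defs
  imports "HOL-Algebra.Module" "HOL-Library.Multiset"
begin

section \<open>The base categories\<close>

text \<open>
  The linear base categories are treated as a chain of full symmetric monoidal subcategories:
  a graded vector space is a chain complex with zero differential, a vector space is a graded
  vector space concentrated in degree 0.  Elements of complexes are always homogeneous, and every
  map carries the degrees of its arguments as extra integer arguments.  A set sits in degree 0;
  for sets only the values in degree 0 matter, and the field K is a dummy.
\<close>

datatype base = Sets | Vect | GrVect | Chain

datatype ('k, 'v) obj =
    Set_obj "'v set"
  | Cx_obj "int \<Rightarrow> ('k, 'v) module" "int \<Rightarrow> 'v \<Rightarrow> 'v"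

definition K_linear ::
    "'k ring \<Rightarrow> ('k, 'v) module \<Rightarrow> ('k, 'w) module \<Rightarrow> ('v \<Rightarrow> 'w) \<Rightarrow> bool" where
  "K_linear K V W f \<longleftrightarrow>
     f \<in> carrier V \<rightarrow> carrier W \<and>
     (\<forall>x\<in>carrier V. \<forall>y\<in>carrier V. f (x \<oplus>\<^bsub>V\<^esub> y) = f x \<oplus>\<^bsub>W\<^esub> f y) \<and>
     (\<forall>r\<in>carrier K. \<forall>x\<in>carrier V. f (r \<odot>\<^bsub>V\<^esub> x) = r \<odot>\<^bsub>W\<^esub> f x)"

definition K_bilinear ::
    "'k ring \<Rightarrow> ('k, 'u) module \<Rightarrow> ('k, 'v) module \<Rightarrow> ('k, 'w) module \<Rightarrow>
     ('u \<Rightarrow> 'v \<Rightarrow> 'w) \<Rightarrow> bool" where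
  "K_bilinear K U V W f \<longleftrightarrow>
     (\<forall>x\<in>carrier U. K_linear K V W (f x)) \<and>
     (\<forall>y\<in>carrier V. K_linear K U W (\<lambda>x. f x y))"

definition chain_complex ::
    "'k ring \<Rightarrow> (int \<Rightarrow> ('k, 'v) module) \<Rightarrow> (int \<Rightarrow> 'v \<Rightarrow> 'v) \<Rightarrow> bool" where
  "chain_complex K V d \<longleftrightarrow>
     (\<forall>i. module K (V i) \<and> K_linear K (V i) (V (i - 1)) (d i) \<and>
          (\<forall>x\<in>carrier (V i). d (i - 1) (d i x) = \<zero>\<^bsub>V (i - 1 - 1)\<^esub>))"

definition zero_differential :: "(int \<Rightarrow> ('k, 'v) module) \<Rightarrow> (int \<Rightarrow> 'v \<Rightarrow> 'v) \<Rightarrow> bool" where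
  "zero_differential V d \<longleftrightarrow> (\<forall>i. \<forall>x\<in>carrier (V i). d i x = \<zero>\<^bsub>V (i - 1)\<^esub>)"

fun is_obj :: "base \<Rightarrow> 'k ring \<Rightarrow> ('k, 'v) obj \<Rightarrow> bool" where
  "is_obj Sets K (Set_obj A) \<longleftrightarrow> True"
| "is_obj Chain K (Cx_obj V d) \<longleftrightarrow> chain_complex K V d"
| "is_obj GrVect K (Cx_obj V d) \<longleftrightarrow> chain_complex K V d \<and> zero_differential V d"
| "is_obj Vect K (Cx_obj V d) \<longleftrightarrow>
     chain_complex K V d \<and> zero_differential V d \<and> (\<forall>i. i \<noteq> 0 \<longrightarrow> carrier (V i) = {\<zero>\<^bsub>V i\<^esub>})"
| "is_obj _ _ _ \<longleftrightarrow> False"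

fun elems :: "('k, 'v) obj \<Rightarrow> int \<Rightarrow> 'v set" where
  "elems (Set_obj A) i = (if i = 0 then A else {})"
| "elems (Cx_obj V d) i = carrier (V i)"

fun base_hom :: "'k ring \<Rightarrow> ('k, 'v) obj \<Rightarrow> ('k, 'w) obj \<Rightarrow> (int \<Rightarrow> 'v \<Rightarrow> 'w) \<Rightarrow> bool" where
  "base_hom K (Set_obj A) (Set_obj B) f \<longleftrightarrow> f 0 \<in> A \<rightarrow> B"
| "base_hom K (Cx_obj V d) (Cx_obj W e) f \<longleftrightarrow>
     (\<forall>i. K_linear K (V i) (W i) (f i) \<and>
          (\<forall>x\<in>carrier (V i). f (i - 1) (d i x) = e i (f i x)))"
| "base_hom _ _ _ _ \<longleftrightarrow> False"

text \<open>
  Morphisms from the monoidal product of A and B to C.  For sets these are functions of two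
  variables; for complexes they are given, through the universal property of the tensor product,
  by bilinear maps taking degrees i, j to degree i + j and satisfying the Leibniz rule
  d (x y) = (d x) y + (-1)^i x (d y).
\<close>

fun base_bihom ::
    "'k ring \<Rightarrow> ('k, 'u) obj \<Rightarrow> ('k, 'v) obj \<Rightarrow> ('k, 'w) obj \<Rightarrow>
     (int \<Rightarrow> int \<Rightarrow> 'u \<Rightarrow> 'v \<Rightarrow> 'w) \<Rightarrow> bool" where
  "base_bihom K (Set_obj A) (Set_obj B) (Set_obj C) f \<longleftrightarrow> (\<forall>x\<in>A. \<forall>y\<in>B. f 0 0 x y \<in> C)"
| "base_bihom K (Cx_obj U c) (Cx_obj V d) (Cx_obj W e) f \<longleftrightarrow>
     (\<forall>i j. K_bilinear K (U i) (V j) (W (i + j)) (f i j) \<and>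
       (\<forall>x\<in>carrier (U i). \<forall>y\<in>carrier (V j).
          e (i + j) (f i j x y) =
            f (i - 1) j (c i x) y \<oplus>\<^bsub>W (i + j - 1)\<^esub>
            (if even i then f i (j - 1) x (d j y)
             else \<ominus>\<^bsub>W (i + j - 1)\<^esub> f i (j - 1) x (d j y))))"
| "base_bihom _ _ _ _ _ \<longleftrightarrow> False"

text \<open>
  The Koszul sign of the symmetry: if f is a morphism from B \<otimes> A to C, then the composite of f
  with the symmetry of A \<otimes> B sends x of degree i and y of degree j to
  \<^term>\<open>koszul C i j (f j i y x)\<close>.
\<close>

fun koszul :: "('k, 'v) obj \<Rightarrow> int \<Rightarrow> int \<Rightarrow> 'v \<Rightarrow> 'v" where
  "koszul (Set_obj A) i j z = z"
| "koszul (Cx_obj V d) i j z = (if odd i \<and> odd j then \<ominus>\<^bsub>V (i + j)\<^esub> z else z)"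


section \<open>Modular and cyclic operads\<close>

text \<open>
  Finite sets are the finite subsets of an (infinite) type \<^typ>\<open>'c\<close> of labels, and the disjoint
  union is the union of disjoint sets.  A bijection out of C is a total function injective on C,
  its target being the image; that only its values on C matter is \<open>act_cong\<close>.
  The arguments C1, C2, C of the structure maps are the sets without the labels being joined:
  \<open>mcomp P a b C1 G1 C2 G2\<close> is a morphism out of
  \<open>P(C1 \<squnion> {a}, G1) \<otimes> P(C2 \<squnion> {b}, G2)\<close> and \<open>mcontr P a b C G\<close> one out of \<open>P(C \<squnion> {a,b}, G)\<close>.
\<close>

record ('c, 'k, 'v) modop =
  mob :: "'c set \<Rightarrow> nat \<Rightarrow> ('k, 'v) obj"
  mact :: "'c set \<Rightarrow> nat \<Rightarrow> ('c \<Rightarrow> 'c) \<Rightarrow> int \<Rightarrow> 'v \<Rightarrow> 'v"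
  mcomp :: "'c \<Rightarrow> 'c \<Rightarrow> 'c set \<Rightarrow> nat \<Rightarrow> 'c set \<Rightarrow> nat \<Rightarrow> int \<Rightarrow> int \<Rightarrow> 'v \<Rightarrow> 'v \<Rightarrow> 'v"
  mcontr :: "'c \<Rightarrow> 'c \<Rightarrow> 'c set \<Rightarrow> nat \<Rightarrow> int \<Rightarrow> 'v \<Rightarrow> 'v"

record ('c, 'k, 'v) cycop =
  cob :: "'c set \<Rightarrow> ('k, 'v) obj"
  cact :: "'c set \<Rightarrow> ('c \<Rightarrow> 'c) \<Rightarrow> int \<Rightarrow> 'v \<Rightarrow> 'v"
  ccomp :: "'c \<Rightarrow> 'c \<Rightarrow> 'c set \<Rightarrow> 'c set \<Rightarrow> int \<Rightarrow> int \<Rightarrow> 'v \<Rightarrow> 'v \<Rightarrow> 'v"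

text \<open>The conditions under which \<open>a \<circ> b\<close> and \<open>\<xi>\<close> make sense.\<close>

definition comp_ok :: "'c \<Rightarrow> 'c \<Rightarrow> 'c set \<Rightarrow> 'c set \<Rightarrow> bool" where
  "comp_ok a b C1 C2 \<longleftrightarrow>
     finite C1 \<and> finite C2 \<and> a \<notin> C1 \<and> b \<notin> C2 \<and> C1 \<inter> C2 = {}"

definition contr_ok :: "'c \<Rightarrow> 'c \<Rightarrow> 'c set \<Rightarrow> bool" where
  "contr_ok a b C \<longleftrightarrow> finite C \<and> a \<notin> C \<and> b \<notin> C \<and> a \<noteq> b"

definition join_bij :: "'c set \<Rightarrow> ('c \<Rightarrow> 'c) \<Rightarrow> ('c \<Rightarrow> 'c) \<Rightarrow> 'c \<Rightarrow> 'c" where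
  "join_bij C1 \<rho> \<sigma> = (\<lambda>c. if c \<in> C1 then \<rho> c else \<sigma> c)"

locale modular_operad =
  fixes M :: base and K :: "'k ring" and P :: "('c, 'k, 'v) modop"
  assumes obj: "finite C \<Longrightarrow> is_obj M K (mob P C G)"
    and act_cong: "\<lbrakk>finite C; inj_on \<rho> C; \<And>c. c \<in> C \<Longrightarrow> \<rho> c = \<sigma> c; x \<in> elems (mob P C G) i\<rbrakk>
      \<Longrightarrow> mact P C G \<rho> i x = mact P C G \<sigma> i x"
    and act_hom: "\<lbrakk>finite C; inj_on \<rho> C\<rbrakk>
      \<Longrightarrow> base_hom K (mob P C G) (mob P (\<rho> ` C) G) (mact P C G \<rho>)"
    and comp_hom: "comp_ok a b C1 C2
      \<Longrightarrow> base_bihom K (mob P (C1 \<union> {a}) G1) (mob P (C2 \<union> {b}) G2) (mob P (C1 \<union> C2) (G1 + G2))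
            (mcomp P a b C1 G1 C2 G2)"
    and contr_hom: "contr_ok a b C
      \<Longrightarrow> base_hom K (mob P (C \<union> {a, b}) G) (mob P C (G + 1)) (mcontr P a b C G)"
    and contr_sym: "\<lbrakk>contr_ok a b C; x \<in> elems (mob P (C \<union> {a, b}) G) i\<rbrakk>
      \<Longrightarrow> mcontr P a b C G i x = mcontr P b a C G i x"
    and comp_sym: "\<lbrakk>comp_ok a b C1 C2;
        x \<in> elems (mob P (C1 \<union> {a}) G1) i; y \<in> elems (mob P (C2 \<union> {b}) G2) j\<rbrakk>
      \<Longrightarrow> mcomp P a b C1 G1 C2 G2 i j x y =
          koszul (mob P (C1 \<union> C2) (G1 + G2)) i j (mcomp P b a C2 G2 C1 G1 j i y x)"
    and act_id: "\<lbrakk>finite C; x \<in> elems (mob P C G) i\<rbrakk> \<Longrightarrow> mact P C G id i x = x"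
    and act_comp: "\<lbrakk>finite C; inj_on \<sigma> C; inj_on \<rho> (\<sigma> ` C); x \<in> elems (mob P C G) i\<rbrakk>
      \<Longrightarrow> mact P C G (\<rho> \<circ> \<sigma>) i x = mact P (\<sigma> ` C) G \<rho> i (mact P C G \<sigma> i x)"
    and comp_act: "\<lbrakk>comp_ok a b C1 C2; inj_on \<rho> (C1 \<union> {a}); inj_on \<sigma> (C2 \<union> {b});
        \<rho> ` C1 \<inter> \<sigma> ` C2 = {};
        x \<in> elems (mob P (C1 \<union> {a}) G1) i; y \<in> elems (mob P (C2 \<union> {b}) G2) j\<rbrakk>
      \<Longrightarrow> mact P (C1 \<union> C2) (G1 + G2) (join_bij C1 \<rho> \<sigma>) (i + j) (mcomp P a b C1 G1 C2 G2 i j x y) =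
          mcomp P (\<rho> a) (\<sigma> b) (\<rho> ` C1) G1 (\<sigma> ` C2) G2 i j
            (mact P (C1 \<union> {a}) G1 \<rho> i x) (mact P (C2 \<union> {b}) G2 \<sigma> j y)"
    and contr_act: "\<lbrakk>contr_ok a b C; inj_on \<rho> (C \<union> {a, b}); x \<in> elems (mob P (C \<union> {a, b}) G) i\<rbrakk>
      \<Longrightarrow> mact P C (G + 1) \<rho> i (mcontr P a b C G i x) =
          mcontr P (\<rho> a) (\<rho> b) (\<rho> ` C) G i (mact P (C \<union> {a, b}) G \<rho> i x)"
    and contr_contr: "\<lbrakk>contr_ok c d (C \<union> {a, b}); contr_ok a b C;
        contr_ok a b (C \<union> {c, d}); contr_ok c d C;
        x \<in> elems (mob P (C \<union> {a, b, c, d}) G) i\<rbrakk>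
      \<Longrightarrow> mcontr P a b C (G + 1) i (mcontr P c d (C \<union> {a, b}) G i x) =
          mcontr P c d C (G + 1) i (mcontr P a b (C \<union> {c, d}) G i x)"
    and contr_comp_exchange: "\<lbrakk>comp_ok c d (C1 \<union> {a}) (C2 \<union> {b}); contr_ok a b (C1 \<union> C2);
        comp_ok a b (C1 \<union> {c}) (C2 \<union> {d}); contr_ok c d (C1 \<union> C2);
        x \<in> elems (mob P (C1 \<union> {a, c}) G1) i; y \<in> elems (mob P (C2 \<union> {b, d}) G2) j\<rbrakk>
      \<Longrightarrow> mcontr P a b (C1 \<union> C2) (G1 + G2) (i + j)
            (mcomp P c d (C1 \<union> {a}) G1 (C2 \<union> {b}) G2 i j x y) =
          mcontr P c d (C1 \<union> C2) (G1 + G2) (i + j)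
            (mcomp P a b (C1 \<union> {c}) G1 (C2 \<union> {d}) G2 i j x y)"
    and comp_contr: "\<lbrakk>contr_ok c d (C1 \<union> {a}); comp_ok a b C1 C2;
        comp_ok a b (C1 \<union> {c, d}) C2; contr_ok c d (C1 \<union> C2);
        x \<in> elems (mob P (C1 \<union> {a, c, d}) G1) i; y \<in> elems (mob P (C2 \<union> {b}) G2) j\<rbrakk>
      \<Longrightarrow> mcomp P a b C1 (G1 + 1) C2 G2 i j (mcontr P c d (C1 \<union> {a}) G1 i x) y =
          mcontr P c d (C1 \<union> C2) (G1 + G2) (i + j) (mcomp P a b (C1 \<union> {c, d}) G1 C2 G2 i j x y)"
    and comp_assoc: "\<lbrakk>comp_ok c d (C2 \<union> {b}) C3; comp_ok a b C1 (C2 \<union> C3);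
        comp_ok a b C1 (C2 \<union> {c}); comp_ok c d (C1 \<union> C2) C3;
        x \<in> elems (mob P (C1 \<union> {a}) G1) i; y \<in> elems (mob P (C2 \<union> {b, c}) G2) j;
        z \<in> elems (mob P (C3 \<union> {d}) G3) k\<rbrakk>
      \<Longrightarrow> mcomp P a b C1 G1 (C2 \<union> C3) (G2 + G3) i (j + k) x
            (mcomp P c d (C2 \<union> {b}) G2 C3 G3 j k y z) =
          mcomp P c d (C1 \<union> C2) (G1 + G2) C3 G3 (i + j) k
            (mcomp P a b C1 G1 (C2 \<union> {c}) G2 i j x y) z"

locale cyclic_operad =
  fixes M :: base and K :: "'k ring" and A :: "('c, 'k, 'v) cycop"
  assumes obj: "finite C \<Longrightarrow> is_obj M K (cob A C)"
    and act_cong: "\<lbrakk>finite C; inj_on \<rho> C; \<And>c. c \<in> C \<Longrightarrow> \<rho> c = \<sigma> c; x \<in> elems (cob A C) i\<rbrakk>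
      \<Longrightarrow> cact A C \<rho> i x = cact A C \<sigma> i x"
    and act_hom: "\<lbrakk>finite C; inj_on \<rho> C\<rbrakk>
      \<Longrightarrow> base_hom K (cob A C) (cob A (\<rho> ` C)) (cact A C \<rho>)"
    and comp_hom: "comp_ok a b C1 C2
      \<Longrightarrow> base_bihom K (cob A (C1 \<union> {a})) (cob A (C2 \<union> {b})) (cob A (C1 \<union> C2))
            (ccomp A a b C1 C2)"
    and comp_sym: "\<lbrakk>comp_ok a b C1 C2;
        x \<in> elems (cob A (C1 \<union> {a})) i; y \<in> elems (cob A (C2 \<union> {b})) j\<rbrakk>
      \<Longrightarrow> ccomp A a b C1 C2 i j x y = koszul (cob A (C1 \<union> C2)) i j (ccomp A b a C2 C1 j i y x)"
    and act_id: "\<lbrakk>finite C; x \<in> elems (cob A C) i\<rbrakk> \<Longrightarrow> cact A C id i x = x"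
    and act_comp: "\<lbrakk>finite C; inj_on \<sigma> C; inj_on \<rho> (\<sigma> ` C); x \<in> elems (cob A C) i\<rbrakk>
      \<Longrightarrow> cact A C (\<rho> \<circ> \<sigma>) i x = cact A (\<sigma> ` C) \<rho> i (cact A C \<sigma> i x)"
    and comp_act: "\<lbrakk>comp_ok a b C1 C2; inj_on \<rho> (C1 \<union> {a}); inj_on \<sigma> (C2 \<union> {b});
        \<rho> ` C1 \<inter> \<sigma> ` C2 = {};
        x \<in> elems (cob A (C1 \<union> {a})) i; y \<in> elems (cob A (C2 \<union> {b})) j\<rbrakk>
      \<Longrightarrow> cact A (C1 \<union> C2) (join_bij C1 \<rho> \<sigma>) (i + j) (ccomp A a b C1 C2 i j x y) =
          ccomp A (\<rho> a) (\<sigma> b) (\<rho> ` C1) (\<sigma> ` C2) i j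
            (cact A (C1 \<union> {a}) \<rho> i x) (cact A (C2 \<union> {b}) \<sigma> j y)"
    and comp_assoc: "\<lbrakk>comp_ok c d (C2 \<union> {b}) C3; comp_ok a b C1 (C2 \<union> C3);
        comp_ok a b C1 (C2 \<union> {c}); comp_ok c d (C1 \<union> C2) C3;
        x \<in> elems (cob A (C1 \<union> {a})) i; y \<in> elems (cob A (C2 \<union> {b, c})) j;
        z \<in> elems (cob A (C3 \<union> {d})) k\<rbrakk>
      \<Longrightarrow> ccomp A a b C1 (C2 \<union> C3) i (j + k) x (ccomp A c d (C2 \<union> {b}) C3 j k y z) =
          ccomp A c d (C1 \<union> C2) C3 (i + j) k (ccomp A a b C1 (C2 \<union> {c}) i j x y) z"

definition modular_morphism ::
    "'k ring \<Rightarrow> ('c, 'k, 'v) modop \<Rightarrow> ('c, 'k, 'w) modop \<Rightarrow>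
     ('c set \<Rightarrow> nat \<Rightarrow> int \<Rightarrow> 'v \<Rightarrow> 'w) \<Rightarrow> bool" where
  "modular_morphism K P Q \<phi> \<longleftrightarrow>
     (\<forall>C G. finite C \<longrightarrow> base_hom K (mob P C G) (mob Q C G) (\<phi> C G)) \<and>
     (\<forall>C G \<rho> i. \<forall>x\<in>elems (mob P C G) i. finite C \<longrightarrow> inj_on \<rho> C \<longrightarrow>
        \<phi> (\<rho> ` C) G i (mact P C G \<rho> i x) = mact Q C G \<rho> i (\<phi> C G i x)) \<and>
     (\<forall>a b C1 G1 C2 G2 i j. comp_ok a b C1 C2 \<longrightarrow>
        (\<forall>x\<in>elems (mob P (C1 \<union> {a}) G1) i. \<forall>y\<in>elems (mob P (C2 \<union> {b}) G2) j.
          \<phi> (C1 \<union> C2) (G1 + G2) (i + j) (mcomp P a b C1 G1 C2 G2 i j x y) =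
          mcomp Q a b C1 G1 C2 G2 i j (\<phi> (C1 \<union> {a}) G1 i x) (\<phi> (C2 \<union> {b}) G2 j y))) \<and>
     (\<forall>a b C G i. contr_ok a b C \<longrightarrow>
        (\<forall>x\<in>elems (mob P (C \<union> {a, b}) G) i.
          \<phi> C (G + 1) i (mcontr P a b C G i x) = mcontr Q a b C G i (\<phi> (C \<union> {a, b}) G i x)))"

definition modular_isomorphic ::
    "'k ring \<Rightarrow> ('c, 'k, 'v) modop \<Rightarrow> ('c, 'k, 'w) modop \<Rightarrow> bool" where
  "modular_isomorphic K P Q \<longleftrightarrow>
     (\<exists>\<phi> \<psi>. modular_morphism K P Q \<phi> \<and> modular_morphism K Q P \<psi> \<and>
        (\<forall>C G i. finite C \<longrightarrow>
           (\<forall>x\<in>elems (mob P C G) i. \<psi> C G i (\<phi> C G i x) = x) \<and>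
           (\<forall>y\<in>elems (mob Q C G) i. \<phi> C G i (\<psi> C G i y) = y)))"

definition cyclic_morphism ::
    "'k ring \<Rightarrow> ('c, 'k, 'v) cycop \<Rightarrow> ('c, 'k, 'w) cycop \<Rightarrow>
     ('c set \<Rightarrow> int \<Rightarrow> 'v \<Rightarrow> 'w) \<Rightarrow> bool" where
  "cyclic_morphism K A B f \<longleftrightarrow>
     (\<forall>C. finite C \<longrightarrow> base_hom K (cob A C) (cob B C) (f C)) \<and>
     (\<forall>C \<rho> i. \<forall>x\<in>elems (cob A C) i. finite C \<longrightarrow> inj_on \<rho> C \<longrightarrow>
        f (\<rho> ` C) i (cact A C \<rho> i x) = cact B C \<rho> i (f C i x)) \<and>
     (\<forall>a b C1 C2 i j. comp_ok a b C1 C2 \<longrightarrow>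
        (\<forall>x\<in>elems (cob A (C1 \<union> {a})) i. \<forall>y\<in>elems (cob A (C2 \<union> {b})) j.
          f (C1 \<union> C2) (i + j) (ccomp A a b C1 C2 i j x y) =
          ccomp B a b C1 C2 i j (f (C1 \<union> {a}) i x) (f (C2 \<union> {b}) j y)))"

definition cyclic_part :: "('c, 'k, 'v) modop \<Rightarrow> ('c, 'k, 'v) cycop" where
  "cyclic_part P =
     \<lparr>cob = (\<lambda>C. mob P C 0),
      cact = (\<lambda>C. mact P C 0),
      ccomp = (\<lambda>a b C1 C2. mcomp P a b C1 0 C2 0)\<rparr>"

lemma cyclic_operad_cyclic_part:
  assumes "modular_operad M K P"
  shows "cyclic_operad M K (cyclic_part P)"
proof -
  interpret modular_operad M K P by fact
  note c0 = comp_hom[where ?G1.0 = 0 and ?G2.0 = 0, unfolded add_0]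
    comp_sym[where ?G1.0 = 0 and ?G2.0 = 0, unfolded add_0]
    comp_act[where ?G1.0 = 0 and ?G2.0 = 0, unfolded add_0]
    comp_assoc[where ?G1.0 = 0 and ?G2.0 = 0 and ?G3.0 = 0, unfolded add_0]
  show ?thesis
    by unfold_locales
      (unfold cyclic_part_def cycop.simps,
       (erule (1) obj act_hom act_id act_comp c0 | rule obj act_cong act_hom act_id act_comp c0;
         assumption | blast)+)
qed


section \<open>The modular envelope\<close>

text \<open>
  \<open>extends K A \<eta> Q P f g\<close>: the modular operad morphism g from Q to P satisfies g \<circ> \<eta> = f, where
  \<eta> and f are morphisms from the cyclic operad A to the cyclic parts of Q and P.
\<close>

definition extends ::
    "'k ring \<Rightarrow> ('c, 'k, 'a) cycop \<Rightarrow> ('c set \<Rightarrow> int \<Rightarrow> 'a \<Rightarrow> 'v) \<Rightarrow> ('c, 'k, 'v) modop \<Rightarrow>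
     ('c, 'k, 'w) modop \<Rightarrow> ('c set \<Rightarrow> int \<Rightarrow> 'a \<Rightarrow> 'w) \<Rightarrow>
     ('c set \<Rightarrow> nat \<Rightarrow> int \<Rightarrow> 'v \<Rightarrow> 'w) \<Rightarrow> bool" where
  "extends K A \<eta> Q P f g \<longleftrightarrow>
     modular_morphism K Q P g \<and>
     (\<forall>C i. finite C \<longrightarrow> (\<forall>x\<in>elems (cob A C) i. g C 0 i (\<eta> C i x) = f C i x))"

text \<open>Families of functions are the same morphism if they agree on the elements of the source.\<close>

definition unique_extension ::
    "'k ring \<Rightarrow> ('c, 'k, 'a) cycop \<Rightarrow> ('c set \<Rightarrow> int \<Rightarrow> 'a \<Rightarrow> 'v) \<Rightarrow> ('c, 'k, 'v) modop \<Rightarrow>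
     ('c, 'k, 'w) modop \<Rightarrow> ('c set \<Rightarrow> int \<Rightarrow> 'a \<Rightarrow> 'w) \<Rightarrow> bool" where
  "unique_extension K A \<eta> Q P f \<longleftrightarrow>
     (\<exists>g. extends K A \<eta> Q P f g \<and>
        (\<forall>h. extends K A \<eta> Q P f h \<longrightarrow>
           (\<forall>C G i. finite C \<longrightarrow> (\<forall>x\<in>elems (mob Q C G) i. h C G i x = g C G i x))))"

text \<open>
  The value E of the left adjoint at A, with the unit \<eta>, is a universal arrow from A to the
  forgetful functor.  As HOL cannot quantify over types, the universal property is relative to the
  modular operads whose elements are drawn from one given type; a modular envelope has it for
  every type.
\<close>

definition modular_envelope_for ::
    "'t itself \<Rightarrow> base \<Rightarrow> 'k ring \<Rightarrow> ('c, 'k, 'a) cycop \<Rightarrow> ('c, 'k, 'v) modop \<Rightarrow>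
     ('c set \<Rightarrow> int \<Rightarrow> 'a \<Rightarrow> 'v) \<Rightarrow> bool" where
  "modular_envelope_for T M K A E \<eta> \<longleftrightarrow>
     modular_operad M K E \<and> cyclic_morphism K A (cyclic_part E) \<eta> \<and>
     (\<forall>(P :: ('c, 'k, 't) modop) f.
        modular_operad M K P \<longrightarrow> cyclic_morphism K A (cyclic_part P) f \<longrightarrow>
        unique_extension K A \<eta> E P f)"


section \<open>The operad QO\<close>

definition cyc :: "'c list \<Rightarrow> 'c list set" where
  "cyc xs = {rotate n xs | n. True}"

type_synonym 'c symbol = "'c list set multiset \<times> nat"

definition QO_symbols :: "'c set \<Rightarrow> nat \<Rightarrow> 'c symbol set" where
  "QO_symbols C G =
     {(mset (map cyc xss), g) | xss g.
        xss \<noteq> [] \<and> distinct (concat xss) \<and> set (concat xss) = C \<and> 2 * g + (length xss - 1) = G}"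

definition relabel :: "('c \<Rightarrow> 'c) \<Rightarrow> 'c symbol \<Rightarrow> 'c symbol" where
  "relabel \<rho> s = (image_mset (\<lambda>c. map \<rho> ` c) (fst s), snd s)"

text \<open>
  On \<^const>\<open>QO_symbols\<close> the descriptions below determine the result uniquely, because a label occurs
  in exactly one cycle, and exactly once there.
\<close>

definition symbol_comp :: "'c \<Rightarrow> 'c \<Rightarrow> 'c symbol \<Rightarrow> 'c symbol \<Rightarrow> 'c symbol" where
  "symbol_comp a b s t =
     (THE r. \<exists>A B N N' g g'.
        s = (add_mset (cyc (a # A)) N, g) \<and> t = (add_mset (cyc (b # B)) N', g') \<and>
        r = (add_mset (cyc (A @ B)) (N + N'), g + g'))"

definition symbol_contr :: "'c \<Rightarrow> 'c \<Rightarrow> 'c symbol \<Rightarrow> 'c symbol" where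
  "symbol_contr a d s =
     (THE r.
        (\<exists>A B N g. s = (add_mset (cyc (a # A @ d # B)) N, g) \<and>
           r = (add_mset (cyc A) (add_mset (cyc B) N), g)) \<or>
        (\<exists>A B N g. s = (add_mset (cyc (a # A)) (add_mset (cyc (d # B)) N), g) \<and>
           r = (add_mset (cyc (A @ B)) N, g + 1)))"

definition QO_set :: "('c, 'k, 'c symbol) modop" where
  "QO_set =
     \<lparr>mob = (\<lambda>C G. Set_obj (QO_symbols C G)),
      mact = (\<lambda>C G \<rho> i. relabel \<rho>),
      mcomp = (\<lambda>a b C1 G1 C2 G2 i j. symbol_comp a b),
      mcontr = (\<lambda>a b C G i. symbol_contr a b)\<rparr>"

text \<open>The linear span of S; the multiplicative fields of the record are not used by modules.\<close>

definition linear_span :: "'k ring \<Rightarrow> 's set \<Rightarrow> ('k, 's \<Rightarrow> 'k) module" where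
  "linear_span K S =
     \<lparr>carrier = {u. (\<forall>s. u s \<in> carrier K) \<and> finite {s. u s \<noteq> \<zero>\<^bsub>K\<^esub>} \<and> (\<forall>s. s \<notin> S \<longrightarrow> u s = \<zero>\<^bsub>K\<^esub>)},
      monoid.mult = (\<lambda>u v s. \<zero>\<^bsub>K\<^esub>),
      one = (\<lambda>s. \<zero>\<^bsub>K\<^esub>),
      zero = (\<lambda>s. \<zero>\<^bsub>K\<^esub>),
      add = (\<lambda>u v s. u s \<oplus>\<^bsub>K\<^esub> v s),
      smult = (\<lambda>r u s. r \<otimes>\<^bsub>K\<^esub> u s)\<rparr>"

text \<open>Linear and bilinear extensions of maps between basis elements.\<close>

definition lin_ext :: "'k ring \<Rightarrow> ('s \<Rightarrow> 't) \<Rightarrow> ('s \<Rightarrow> 'k) \<Rightarrow> 't \<Rightarrow> 'k" where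
  "lin_ext K \<phi> u = (\<lambda>t. finsum K u {s. u s \<noteq> \<zero>\<^bsub>K\<^esub> \<and> \<phi> s = t})"

definition bilin_ext ::
    "'k ring \<Rightarrow> ('r \<Rightarrow> 's \<Rightarrow> 't) \<Rightarrow> ('r \<Rightarrow> 'k) \<Rightarrow> ('s \<Rightarrow> 'k) \<Rightarrow> 't \<Rightarrow> 'k" where
  "bilin_ext K \<phi> u v =
     (\<lambda>t. finsum K (\<lambda>(r, s). u r \<otimes>\<^bsub>K\<^esub> v s)
        {(r, s). u r \<noteq> \<zero>\<^bsub>K\<^esub> \<and> v s \<noteq> \<zero>\<^bsub>K\<^esub> \<and> \<phi> r s = t})"

definition QO_lin :: "'k ring \<Rightarrow> ('c, 'k, 'c symbol \<Rightarrow> 'k) modop" where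
  "QO_lin K =
     \<lparr>mob = (\<lambda>C G. Cx_obj (\<lambda>i. linear_span K (if i = 0 then QO_symbols C G else {}))
                          (\<lambda>i u s. \<zero>\<^bsub>K\<^esub>)),
      mact = (\<lambda>C G \<rho> i. lin_ext K (relabel \<rho>)),
      mcomp = (\<lambda>a b C1 G1 C2 G2 i j. bilin_ext K (symbol_comp a b)),
      mcontr = (\<lambda>a b C G i. lin_ext K (symbol_contr a b))\<rparr>"

definition Ass_set :: "('c, 'k, 'c symbol) cycop" where
  "Ass_set = cyclic_part QO_set"

definition Ass_lin :: "'k ring \<Rightarrow> ('c, 'k, 'c symbol \<Rightarrow> 'k) cycop" where
  "Ass_lin K = cyclic_part (QO_lin K)"

definition Ass_incl :: "'c set \<Rightarrow> int \<Rightarrow> 'v \<Rightarrow> 'v" where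
  "Ass_incl C i x = x"

lemma QO_symbols_0:
  "QO_symbols C 0 = {({#cyc xs#}, 0) | xs. distinct xs \<and> set xs = C}"
proof (intro Set.set_eqI iffI)
  fix s assume "s \<in> QO_symbols C 0"
  then obtain xss where xss: "xss \<noteq> []" "distinct (concat xss)" "set (concat xss) = C"
      "length xss - 1 = 0" "s = (mset (map cyc xss), 0)"
    by (auto simp: QO_symbols_def)
  then obtain xs where "xss = [xs]" by (cases xss) auto
  with xss show "s \<in> {({#cyc xs#}, 0) | xs. distinct xs \<and> set xs = C}" by auto
next
  fix s assume "s \<in> {({#cyc xs#}, 0 :: nat) | xs. distinct xs \<and> set xs = C}"
  then obtain xs where "s = (mset (map cyc [xs]), 0)" "distinct (concat [xs])" "set (concat [xs]) = C"
    by auto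
  then show "s \<in> QO_symbols C 0"
    unfolding QO_symbols_def by fastforce
qed

end

theory Submission
  imports Defs
begin

text \<open>
  A symbol stands for a surface, and contraction and composition glue boundary points.  Every
  symbol in QO(C, G + 1) is the contraction \<open>\<xi>\<^sub>a\<^sub>b s\<close> of some symbol s in
  QO(C \<squnion> {a, b}, G), as one sees by cutting the surface along an arc
  (\<open>symbol_contr_lift\<close>).  Call such an s a lift of the given symbol.  After G steps only
  symbols of Ass remain.  Hence an extension g of a morphism f from Ass to P is unique, and
  has to satisfy the recursion that g takes \<open>\<xi>\<^sub>a\<^sub>b s\<close> to the contraction of g(s) along a and b.

  Existence means that this recursion does not depend on the lift.  The argument is by induction on
  G.  If s and s' are lifts along disjoint pairs ab and cd and there is a common lift t with
  \<open>\<xi>\<^sub>c\<^sub>d t = s\<close> and \<open>\<xi>\<^sub>a\<^sub>b t = s'\<close>, then s and s' lead to the same value,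
  because contractions in P commute (\<open>diamond\<close>).  A lift arises either by merging two
  cycles of the symbol into one, or by cutting a cycle in two while lowering the genus.  Three
  kinds of common lifts suffice to connect all lifts of a symbol: \<open>merged_value_exchange\<close> changes
  the pair of merged cycles with the help of a third cycle, \<open>merged_value_eq_cut_value\<close> passes from a
  merge to a cut, and \<open>cut_value_interlaced\<close> moves the end points of a cut.  If the lifts are
  symbols of Ass, there is no room for a common lift.  Then the only freedom is where the two cycles are cut open before they
  are merged, and this is removed by the axiom of P which exchanges a contraction with a
  composition (\<open>merged_value_slide\<close>).  The resulting map commutes with compositions because
  contractions can be pulled out of them, until only the composition in Ass remains
  (\<open>respects_comp\<close>).

  That QO is a modular operad rests on one fact: on the collection of cycles, without the genus,
  contraction and composition are both the gluing of two labels, and gluings of disjoint pairs of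
  labels commute (\<open>glue_commute\<close>).  The genus can be recovered from G.  Only the associativity of
  compositions is computed directly.

  In the linear cases the degree 0 cycles of P form a modular operad in sets.  The case of sets,
  applied to the restriction of f to basis vectors, yields the extension on basis vectors, and both
  existence and uniqueness carry over by linearity (\<open>unique_extension_QO_lin\<close>).  The comparison with
  the modular envelope is the uniqueness of universal arrows (\<open>modular_envelope_unique\<close>).
\<close>

section \<open>Cyclic words and families of cycles\<close>

abbreviation add_cycle :: "'c list \<Rightarrow> 'c list set multiset \<Rightarrow> 'c list set multiset" (infixr \<open>\<rhd>\<close> 66) where
  "A \<rhd> N \<equiv> add_mset (cyc A) N"

lemma cyc_rotate_subset: "cyc (rotate m xs) \<subseteq> cyc xs"
  unfolding cyc_def by (auto simp: rotate_rotate)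

lemma cyc_append_commute: "cyc (A @ B) = cyc (B @ A)"
proof -
  have "cyc (B @ A) \<subseteq> cyc (A @ B)" for A B :: "'c list"
    using cyc_rotate_subset[of "length A" "A @ B"] by (simp add: rotate_append)
  then show ?thesis by blast
qed

lemma cyc_eq_iff: "cyc xs = cyc ys \<longleftrightarrow> (\<exists>A B. xs = A @ B \<and> ys = B @ A)"
proof
  assume "cyc xs = cyc ys"
  moreover have "ys \<in> cyc ys" unfolding cyc_def by (auto intro: exI[of _ 0])
  ultimately obtain n where "ys = rotate n xs" unfolding cyc_def by auto
  then have "xs = take (n mod length xs) xs @ drop (n mod length xs) xs"
    "ys = drop (n mod length xs) xs @ take (n mod length xs) xs"
    by (simp_all add: rotate_drop_take)
  then show "\<exists>A B. xs = A @ B \<and> ys = B @ A" by blast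
next
  assume "\<exists>A B. xs = A @ B \<and> ys = B @ A"
  then show "cyc xs = cyc ys" using cyc_append_commute by metis
qed

lemma cyc_eqD: "cyc xs = cyc ys \<Longrightarrow> set xs = set ys \<and> distinct xs = distinct ys"
  by (auto simp: cyc_eq_iff)

lemma cyc_Cons_inject:
  assumes "distinct (a # A)" and "cyc (a # A) = cyc (a # A')"
  shows "A = A'"
  using assms unfolding cyc_eq_iff by (auto simp: Cons_eq_append_conv append_eq_Cons_conv)

lemma image_map_cyc: "map \<rho> ` cyc xs = cyc (map \<rho> xs)"
  by (auto simp: cyc_def rotate_map image_iff)

text \<open>
  A cycle family on C is a symbol of QO without its genus.  The empty family, which underlies no
  symbol, is allowed so that cycles can be removed one at a time.
\<close>

definition cycle_family :: "'c set \<Rightarrow> 'c list set multiset \<Rightarrow> bool" where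
  "cycle_family C N \<longleftrightarrow>
     (\<exists>xss. N = mset (map cyc xss) \<and> distinct (concat xss) \<and> set (concat xss) = C)"

lemma cycle_family_empty [simp]: "cycle_family C {#} \<longleftrightarrow> C = {}"
  by (auto simp: cycle_family_def)

lemma cycle_family_add [simp]:
  "cycle_family C (A \<rhd> N) \<longleftrightarrow> distinct A \<and> set A \<subseteq> C \<and> cycle_family (C - set A) N"
proof
  assume "cycle_family C (A \<rhd> N)"
  then obtain xss where xss: "A \<rhd> N = mset (map cyc xss)" "distinct (concat xss)"
    "set (concat xss) = C" by (auto simp: cycle_family_def)
  then have "cyc A \<in> set (map cyc xss)" by (metis set_mset_mset union_single_eq_member)
  then obtain x where x: "x \<in> set xss" "cyc x = cyc A" by auto
  then obtain ps qs where ps: "xss = ps @ x # qs" by (meson split_list)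
  from xss(1) x have N: "N = mset (map cyc (ps @ qs))" by (simp add: ps)
  have "set x = set A" "distinct x = distinct A" using cyc_eqD[OF x(2)] by auto
  with xss(2,3) show "distinct A \<and> set A \<subseteq> C \<and> cycle_family (C - set A) N"
    unfolding cycle_family_def N ps by (intro conjI exI[of _ "ps @ qs"]) auto
next
  assume A: "distinct A \<and> set A \<subseteq> C \<and> cycle_family (C - set A) N"
  then obtain xss where "N = mset (map cyc xss)" "distinct (concat xss)"
    "set (concat xss) = C - set A" by (auto simp: cycle_family_def)
  with A show "cycle_family C (A \<rhd> N)"
    unfolding cycle_family_def by (intro exI[of _ "A # xss"]) auto
qed

lemma cycle_family_finite: "cycle_family C N \<Longrightarrow> finite C"
  by (auto simp: cycle_family_def)

lemma cycle_family_nonempty: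
  assumes "cycle_family C N" "N \<noteq> {#}"
  obtains A N' where "N = A \<rhd> N'"
proof -
  from assms obtain xss where x: "N = mset (map cyc xss)" by (auto simp: cycle_family_def)
  with assms(2) obtain A yss where "xss = A # yss" by (cases xss) auto
  with x that show ?thesis by auto
qed

lemma cycle_family_obtain:
  assumes "cycle_family C N" "a \<in> C"
  obtains A N' where "N = (a # A) \<rhd> N'"
proof -
  from assms obtain xss where x: "N = mset (map cyc xss)" "a \<in> set (concat xss)"
    by (auto simp: cycle_family_def)
  then obtain xs where "xs \<in> set xss" "a \<in> set xs" by auto
  then obtain ps qs X Y where p: "xss = ps @ xs # qs" "xs = X @ a # Y" by (meson split_list)
  have "cyc xs = cyc (a # Y @ X)" using cyc_append_commute[of X "a # Y"] p by simp
  with x p have "N = (a # Y @ X) \<rhd> (mset (map cyc (ps @ qs)))" by simp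
  then show ?thesis by (rule that)
qed

text \<open>
  A label lies in only one cycle of a family, and only once in it.  So the cycle through a, cut open
  at a, and the collection of the other cycles are both determined by the family.
\<close>

lemma cycle_family_unique:
  assumes "cycle_family C ((a # A) \<rhd> N)"
    and eq: "(a # A) \<rhd> N = (a # A') \<rhd> N'"
  shows "A = A' \<and> N = N'"
proof (cases "cyc (a # A) = cyc (a # A')")
  case True
  moreover have "distinct (a # A)" using assms(1) by simp
  ultimately show ?thesis using eq cyc_Cons_inject by fastforce
next
  case False
  with eq obtain K where "N = (a # A') \<rhd> K"
    by (auto simp: add_eq_conv_ex)
  with assms(1) show ?thesis by auto
qed

lemma cycle_family_union:
  assumes "cycle_family C N" "cycle_family D M" "C \<inter> D = {}"
  shows "cycle_family (C \<union> D) (N + M)"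
proof -
  obtain xss yss where "N = mset (map cyc xss)" "distinct (concat xss)" "set (concat xss) = C"
    "M = mset (map cyc yss)" "distinct (concat yss)" "set (concat yss) = D"
    using assms(1,2) by (auto simp: cycle_family_def)
  with assms(3) show ?thesis
    unfolding cycle_family_def by (intro exI[of _ "xss @ yss"]) auto
qed

abbreviation relabel_family :: "('c \<Rightarrow> 'c) \<Rightarrow> 'c list set multiset \<Rightarrow> 'c list set multiset" where
  "relabel_family \<rho> \<equiv> image_mset (\<lambda>c. map \<rho> ` c)"

lemma cycle_family_relabel:
  assumes "cycle_family C N" "inj_on \<rho> C"
  shows "cycle_family (\<rho> ` C) (relabel_family \<rho> N)"
proof -
  obtain xss where "N = mset (map cyc xss)" "distinct (concat xss)" "set (concat xss) = C"
    using assms(1) by (auto simp: cycle_family_def)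
  with assms(2) show ?thesis
    unfolding cycle_family_def
    by (intro exI[of _ "map (map \<rho>) xss"])
      (auto simp: image_map_cyc multiset.map_comp comp_def distinct_map map_concat[symmetric])
qed

lemma relabel_family_cong:
  assumes "cycle_family C N" "\<And>c. c \<in> C \<Longrightarrow> \<rho> c = \<sigma> c"
  shows "relabel_family \<rho> N = relabel_family \<sigma> N"
proof (rule image_mset_cong)
  fix c assume "c \<in># N"
  with assms(1) obtain xs where "c = cyc xs" "set xs \<subseteq> C"
    by (fastforce simp: cycle_family_def)
  with assms(2) have "map \<rho> xs = map \<sigma> xs" by auto
  then show "map \<rho> ` c = map \<sigma> ` c" using \<open>c = cyc xs\<close> by (simp only: image_map_cyc)
qed

section \<open>Gluing two labels\<close>

text \<open>
  The effect of gluing the boundary points a and b on the boundary circles, whatever happens to the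
  genus.  Contraction acts on cycles in this way, and so does composition once the two families are
  put side by side; this is what lets one commutation result serve several axioms.
\<close>

inductive glue :: "'c \<Rightarrow> 'c \<Rightarrow> 'c list set multiset \<Rightarrow> 'c list set multiset \<Rightarrow> bool" for a b where
  split: "glue a b ((a # A @ b # B) \<rhd> N) (A \<rhd> B \<rhd> N)"
| join: "glue a b ((a # A) \<rhd> (b # B) \<rhd> N) ((A @ B) \<rhd> N)"

lemma glue_splitI:
  assumes "N = (X @ a # Y @ b # Z) \<rhd> M"
    and "R = Y \<rhd> (Z @ X) \<rhd> M"
  shows "glue a b N R"
proof -
  have "N = (a # Y @ b # Z @ X) \<rhd> M"
    using cyc_append_commute[of X "a # Y @ b # Z"] assms(1) by simp
  then show ?thesis using glue.split assms(2) by metis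
qed

lemma glue_joinI:
  assumes "N = (X @ a # Y) \<rhd> (Z @ b # W) \<rhd> M"
    and "R = (Y @ X @ W @ Z) \<rhd> M"
  shows "glue a b N R"
proof -
  have "N = (a # Y @ X) \<rhd> (b # W @ Z) \<rhd> M"
    using cyc_append_commute[of X "a # Y"] cyc_append_commute[of Z "b # W"] assms(1) by simp
  then show ?thesis using glue.join[of a b "Y @ X" "W @ Z" M] assms(2) by simp
qed

lemma glue_sym: "glue a b N R \<Longrightarrow> glue b a N R"
proof (induction rule: glue.induct)
  case (split A B N)
  have "cyc (a # A @ b # B) = cyc (b # B @ a # A)"
    using cyc_append_commute[of "a # A" "b # B"] by simp
  then show ?case using glue.split[of b a B A N] by (simp add: add_mset_commute)
next
  case (join A B N)
  show ?case using glue.join[of b a B A N] cyc_append_commute[of A B] by (simp add: add_mset_commute)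
qed

lemma glue_frame: "glue a b N R \<Longrightarrow> glue a b (N + M) (R + M)"
  by (induction rule: glue.induct) (simp_all add: glue.intros)

lemma glue_relabel: "glue a b N R \<Longrightarrow> glue (\<rho> a) (\<rho> b) (relabel_family \<rho> N) (relabel_family \<rho> R)"
  by (induction rule: glue.induct) (simp_all add: image_map_cyc glue.intros)

lemma glue_functional:
  assumes N: "cycle_family C N" and "glue a b N R" "glue a b N R'"
  shows "R = R'"
  using assms(2)
proof cases
  case 1: (split A B M)
  note N1 = N[unfolded 1(1)]
  from assms(3) show ?thesis
  proof cases
    case 2: (split A' B' M')
    have e: "A @ b # B = A' @ b # B'" "M = M'"
      using cycle_family_unique[OF N1 trans[OF 1(1)[symmetric] 2(1)]] by auto
    moreover from N1 have "b \<notin> set A" "b \<notin> set B" by auto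
    ultimately have "A = A'" "B = B'" by (simp_all add: append_Cons_eq_iff)
    with e 1 2 show ?thesis by simp
  next
    case 2: (join A' B' M')
    have "M = (b # B') \<rhd> M'"
      using cycle_family_unique[OF N1 trans[OF 1(1)[symmetric] 2(1)]] by auto
    with N1 show ?thesis by auto
  qed
next
  case 1: (join A B M)
  note N1 = N[unfolded 1(1)]
  from assms(3) show ?thesis
  proof cases
    case 2: (split A' B' M')
    have "A = A' @ b # B'"
      using cycle_family_unique[OF N1 trans[OF 1(1)[symmetric] 2(1)]] by auto
    with N1 show ?thesis by auto
  next
    case 2: (join A' B' M')
    have e: "A = A'" "(b # B) \<rhd> M = (b # B') \<rhd> M'"
      using cycle_family_unique[OF N1 trans[OF 1(1)[symmetric] 2(1)]] by auto
    have "cycle_family (C - set (a # A)) ((b # B) \<rhd> M)" using N1 by auto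
    from cycle_family_unique[OF this e(2)] e 1 2 show ?thesis by simp
  qed
qed

lemma glue_total:
  assumes "cycle_family C N" "a \<in> C" "b \<in> C" "a \<noteq> b"
  obtains R where "glue a b N R"
proof -
  obtain A M where N: "N = (a # A) \<rhd> M"
    using cycle_family_obtain[OF assms(1,2)] .
  show ?thesis
  proof (cases "b \<in> set A")
    case True
    then obtain X Y where "A = X @ b # Y" by (meson split_list)
    with N that show ?thesis using glue.split by metis
  next
    case False
    with assms N have "cycle_family (C - set (a # A)) M" "b \<in> C - set (a # A)" by auto
    then obtain B M' where "M = (b # B) \<rhd> M'" by (rule cycle_family_obtain)
    with N that show ?thesis using glue.join by metis
  qed
qed

lemma cycle_family_glue:
  assumes "glue a b N R" "cycle_family C N"
  shows "cycle_family (C - {a, b}) R"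
  using assms
proof cases
  case (split A B M)
  then have "C - {a, b} - set A - set B = C - set (a # A @ b # B)" by auto
  with split assms(2) show ?thesis by auto
next
  case (join A B M)
  then have "C - {a, b} - set (A @ B) = C - set (a # A) - set (b # B)" by auto
  with join assms(2) show ?thesis by auto
qed

lemma size_glue:
  assumes "glue a b N R"
  shows "size R = size N + 1 \<or> size R + 1 = size N" and "R \<noteq> {#}"
  using assms by (induction rule: glue.induct) auto

section \<open>Gluings commute\<close>

definition glue_commuting :: "'c \<Rightarrow> 'c \<Rightarrow> 'c \<Rightarrow> 'c \<Rightarrow> 'c list set multiset \<Rightarrow> bool" where
  "glue_commuting a b c d N \<longleftrightarrow>
     (\<exists>S. (\<exists>R. glue c d N R \<and> glue a b R S) \<and> (\<exists>R. glue a b N R \<and> glue c d R S))"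

lemma glue_commutingI:
  "\<lbrakk>glue c d N R; glue a b R S; glue a b N R'; glue c d R' S'; S' = S\<rbrakk>
    \<Longrightarrow> glue_commuting a b c d N"
  unfolding glue_commuting_def by blast

lemma glue_commuting_swap1: "glue_commuting a b c d N \<Longrightarrow> glue_commuting b a c d N"
  and glue_commuting_swap2: "glue_commuting a b c d N \<Longrightarrow> glue_commuting a b d c N"
  and glue_commuting_swap3: "glue_commuting a b c d N \<Longrightarrow> glue_commuting c d a b N"
  unfolding glue_commuting_def by (blast dest: glue_sym)+

text \<open>
  Up to exchanging a with b, c with d, and the two pairs with each other, four labels can be
  distributed over the cycles of a family in eight ways.  In each of them both orders are computed;
  the results agree up to rotating the cycles.  The names record which labels share a cycle, and in
  which cyclic order.
\<close>

lemma glue_commuting_abcd: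
  "glue_commuting a b c d ((a # X @ b # Y @ c # Z @ d # W) \<rhd> M)"
  using cyc_append_commute[of W Y]
  by (intro glue_commutingI[OF
        glue_splitI[of _ "a # X @ b # Y" c Z d W M, OF _ refl]
        glue_splitI[of _ W a X b Y "Z \<rhd> M", OF _ refl]
        glue_splitI[of _ "[]" a X b "Y @ c # Z @ d # W" M, OF _ refl]
        glue_splitI[of _ Y c Z d W "X \<rhd> M", OF _ refl]])
    (simp_all add: add_mset_commute)

lemma glue_commuting_acbd:
  "glue_commuting a b c d ((a # X @ c # Y @ b # Z @ d # W) \<rhd> M)"
  using cyc_append_commute[of Y "X @ W @ Z"]
  by (intro glue_commutingI[OF
        glue_splitI[of _ "a # X" c "Y @ b # Z" d W M, OF _ refl]
        glue_joinI[of _ W a X Y b Z M, OF _ refl]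
        glue_splitI[of _ "[]" a "X @ c # Y" b "Z @ d # W" M, OF _ refl]
        glue_joinI[of _ X c Y Z d W M, OF _ refl]])
    (simp_all add: add_mset_commute)

lemma glue_commuting_abc_d:
  "glue_commuting a b c d ((a # X @ b # Y @ c # Z) \<rhd> (d # W) \<rhd> M)"
  using cyc_append_commute[of Z "Y @ W"]
  by (intro glue_commutingI[OF
        glue_joinI[of _ "a # X @ b # Y" c Z "[]" d W M, OF _ refl]
        glue_splitI[of _ Z a X b "Y @ W" M, OF _ refl]
        glue_splitI[of _ "[]" a X b "Y @ c # Z" "(d # W) \<rhd> M", OF _ refl]
        glue_joinI[of _ Y c Z "[]" d W "X \<rhd> M", OF _ refl]])
    (simp_all add: add_mset_commute)

lemma glue_commuting_ab_cd:
  "glue_commuting a b c d ((a # X @ b # Y) \<rhd> (c # Z @ d # W) \<rhd> M)"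
  by (intro glue_commutingI[OF
        glue_splitI[of _ "[]" c Z d W "(a # X @ b # Y) \<rhd> M", OF _ refl]
        glue_splitI[of _ "[]" a X b Y "Z \<rhd> W \<rhd> M", OF _ refl]
        glue_splitI[of _ "[]" a X b Y "(c # Z @ d # W) \<rhd> M", OF _ refl]
        glue_splitI[of _ "[]" c Z d W "X \<rhd> Y \<rhd> M", OF _ refl]])
    (simp_all add: add_mset_commute)

lemma glue_commuting_ab_c_d:
  "glue_commuting a b c d ((a # X @ b # Y) \<rhd> (c # Z) \<rhd> (d # W) \<rhd> M)"
  by (intro glue_commutingI[OF
        glue_joinI[of _ "[]" c Z "[]" d W "(a # X @ b # Y) \<rhd> M", OF _ refl]
        glue_splitI[of _ "[]" a X b Y "(Z @ W) \<rhd> M", OF _ refl]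
        glue_splitI[of _ "[]" a X b Y "(c # Z) \<rhd> (d # W) \<rhd> M", OF _ refl]
        glue_joinI[of _ "[]" c Z "[]" d W "X \<rhd> Y \<rhd> M", OF _ refl]])
    (simp_all add: add_mset_commute)

lemma glue_commuting_ac_bd:
  "glue_commuting a b c d ((a # X @ c # Y) \<rhd> (b # Z @ d # W) \<rhd> M)"
  using cyc_append_commute[of W X] cyc_append_commute[of Z Y]
  by (intro glue_commutingI[OF
        glue_joinI[of _ "a # X" c Y "b # Z" d W M, OF _ refl]
        glue_splitI[of _ Y a "X @ W" b Z M, OF _ refl]
        glue_joinI[of _ "[]" a "X @ c # Y" "[]" b "Z @ d # W" M, OF _ refl]
        glue_splitI[of _ X c "Y @ Z" d W M, OF _ refl]])
    (simp_all add: add_mset_commute)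

lemma glue_commuting_ac_b_d:
  "glue_commuting a b c d ((a # X @ c # Y) \<rhd> (b # Z) \<rhd> (d # W) \<rhd> M)"
  using cyc_append_commute[of "X @ W" "Y @ Z"]
  by (intro glue_commutingI[OF
        glue_joinI[of _ "a # X" c Y "[]" d W "(b # Z) \<rhd> M", OF _ refl]
        glue_joinI[of _ Y a "X @ W" "[]" b Z M, OF _ refl]
        glue_joinI[of _ "[]" a "X @ c # Y" "[]" b Z "(d # W) \<rhd> M", OF _ refl]
        glue_joinI[of _ X c "Y @ Z" "[]" d W M, OF _ refl]])
    (simp_all add: add_mset_commute)

lemma glue_commuting_a_b_c_d:
  "glue_commuting a b c d ((a # X) \<rhd> (b # Y) \<rhd> (c # Z) \<rhd> (d # W) \<rhd> M)"
  by (intro glue_commutingI[OF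
        glue_joinI[of _ "[]" c Z "[]" d W "(a # X) \<rhd> (b # Y) \<rhd> M", OF _ refl]
        glue_joinI[of _ "[]" a X "[]" b Y "(Z @ W) \<rhd> M", OF _ refl]
        glue_joinI[of _ "[]" a X "[]" b Y "(c # Z) \<rhd> (d # W) \<rhd> M", OF _ refl]
        glue_joinI[of _ "[]" c Z "[]" d W "(X @ Y) \<rhd> M", OF _ refl]])
    (simp_all add: add_mset_commute)

lemma cyc_shift: "cyc (a # X @ b # Y) = cyc (b # Y @ a # X)"
  using cyc_append_commute[of "a # X" "b # Y"] by simp

text \<open>
  If a and b share a cycle with c, rotating that cycle and possibly exchanging a with b puts c behind
  b, and then only the position of d varies.
\<close>

lemma glue_commuting_three:
  assumes N: "cycle_family C ((a # X @ b # Y) \<rhd> M)" and "c \<in> set X \<union> set Y"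
    and d: "d \<in> C" "d \<notin> {a, b, c}"
  shows "glue_commuting a b c d ((a # X @ b # Y) \<rhd> M)"
proof -
  have main: "glue_commuting a b c d ((a # X @ b # Y) \<rhd> M)"
    if N: "cycle_family C ((a # X @ b # Y) \<rhd> M)" and "c \<in> set Y"
      and d: "d \<in> C" "d \<notin> {a, b, c}" for a b X Y
  proof -
    from that obtain Y1 Y2 where Y: "Y = Y1 @ c # Y2" by (meson split_list)
    consider "d \<in> set X" | "d \<in> set Y1" | "d \<in> set Y2" | "d \<notin> set (a # X @ b # Y)"
      using Y d by auto
    then show ?thesis
    proof cases
      case 1
      then obtain X1 X2 where "X = X1 @ d # X2" by (meson split_list)
      then show ?thesis
        using glue_commuting_swap2[OF glue_commuting_acbd[of a b d c X1 X2 Y1 Y2 M]] Y by simp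
    next
      case 2
      then obtain Z1 Z2 where "Y1 = Z1 @ d # Z2" by (meson split_list)
      then show ?thesis
        using glue_commuting_swap2[OF glue_commuting_abcd[of a b d c X Z1 Z2 Y2 M]] Y by simp
    next
      case 3
      then obtain Z1 Z2 where "Y2 = Z1 @ d # Z2" by (meson split_list)
      then show ?thesis using glue_commuting_abcd[of a b c d X Y1 Z1 Z2 M] Y by simp
    next
      case 4
      with N d have "cycle_family (C - set (a # X @ b # Y)) M" "d \<in> C - set (a # X @ b # Y)" by auto
      then obtain W M' where "M = (d # W) \<rhd> M'" by (rule cycle_family_obtain)
      then show ?thesis using glue_commuting_abc_d[of a b c d X Y1 Y2 W M'] Y by simp
    qed
  qed
  show ?thesis
  proof (cases "c \<in> set Y")
    case True
    then show ?thesis using main N d by blast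
  next
    case False
    with assms(2) have "c \<in> set X" by auto
    then have "glue_commuting b a c d ((b # Y @ a # X) \<rhd> M)"
      using main[of b Y a X] N d unfolding cyc_shift[of a X] by blast
    then show ?thesis unfolding cyc_shift[of a X] by (rule glue_commuting_swap1)
  qed
qed

lemma glue_commuting_two:
  assumes N: "cycle_family C ((a # X @ b # Y) \<rhd> M)"
    and c: "c \<in> C" "c \<notin> {a, b}" and d: "d \<in> C" "d \<notin> {a, b, c}"
  shows "glue_commuting a b c d ((a # X @ b # Y) \<rhd> M)"
proof (cases "c \<in> set X \<union> set Y \<or> d \<in> set X \<union> set Y")
  case True
  then show ?thesis
  proof
    assume "c \<in> set X \<union> set Y"
    then show ?thesis using glue_commuting_three N d by metis
  next
    assume "d \<in> set X \<union> set Y"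
    moreover have "c \<notin> {a, b, d}" using c d by auto
    ultimately have "glue_commuting a b d c ((a # X @ b # Y) \<rhd> M)"
      using glue_commuting_three N c by metis
    then show ?thesis by (rule glue_commuting_swap2)
  qed
next
  case False
  let ?D = "C - set (a # X @ b # Y)"
  from False N c d have D: "cycle_family ?D M" "c \<in> ?D" "d \<in> ?D" by auto
  obtain Z M' where M: "M = (c # Z) \<rhd> M'" using cycle_family_obtain[OF D(1,2)] .
  show ?thesis
  proof (cases "d \<in> set Z")
    case True
    then obtain Z1 Z2 where "Z = Z1 @ d # Z2" by (meson split_list)
    then show ?thesis using glue_commuting_ab_cd[of a b c d X Y Z1 Z2 M'] M by simp
  next
    case False
    with M D d have "cycle_family (?D - set (c # Z)) M'" "d \<in> ?D - set (c # Z)" by auto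
    then obtain W M'' where "M' = (d # W) \<rhd> M''" by (rule cycle_family_obtain)
    then show ?thesis using glue_commuting_ab_c_d[of a b c d X Y Z W M''] M by simp
  qed
qed

text \<open>
  Exchanging the labels of a pair, or the pairs, reduces an arbitrary distribution of the labels
  either to one where a and b share a cycle, or to one where a shares its cycle with c only, or to the
  case where all four cycles are different.
\<close>

lemma glue_commuting_family:
  assumes N: "cycle_family C N" and "{a, b, c, d} \<subseteq> C" "distinct [a, b, c, d]"
  shows "glue_commuting a b c d N"
proof -
  have same: "glue_commuting a b c d ((a # A) \<rhd> M)"
    if "cycle_family C ((a # A) \<rhd> M)" "{a, b, c, d} \<subseteq> C" "distinct [a, b, c, d]"
      "b \<in> set A" for a b c d A M
  proof -
    from that(4) obtain X Y where "A = X @ b # Y" by (meson split_list)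
    with that show ?thesis using glue_commuting_two[of C a X b Y M c d] by auto
  qed
  have shared: "glue_commuting a b c d ((a # A) \<rhd> M)"
    if N: "cycle_family C ((a # A) \<rhd> M)" and C: "{a, b, c, d} \<subseteq> C" "distinct [a, b, c, d]"
      and A: "b \<notin> set A" "c \<in> set A" "d \<notin> set A" for a b c d A M
  proof -
    from A obtain X Y where AXY: "A = X @ c # Y" by (meson split_list)
    let ?D = "C - set (a # A)"
    have D: "cycle_family ?D M" "b \<in> ?D" "d \<in> ?D" using N C A by auto
    obtain B M' where M: "M = (b # B) \<rhd> M'" using cycle_family_obtain[OF D(1,2)] .
    show ?thesis
    proof (cases "d \<in> set B")
      case True
      then obtain Z W where "B = Z @ d # W" by (meson split_list)
      then show ?thesis using glue_commuting_ac_bd[of a b c d X Y Z W M'] M AXY by simp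
    next
      case False
      with M D C have "cycle_family (?D - set (b # B)) M'" "d \<in> ?D - set (b # B)" by auto
      then obtain W M'' where "M' = (d # W) \<rhd> M''" by (rule cycle_family_obtain)
      then show ?thesis using glue_commuting_ac_b_d[of a b c d X Y B W M''] M AXY by simp
    qed
  qed
  obtain A M where A: "N = (a # A) \<rhd> M"
    using cycle_family_obtain[OF N, of a] assms(2) by auto
  obtain B M' where B: "N = (b # B) \<rhd> M'"
    using cycle_family_obtain[OF N, of b] assms(2) by auto
  obtain Z M'' where Z: "N = (c # Z) \<rhd> M''"
    using cycle_family_obtain[OF N, of c] assms(2) by auto
  note NA = N[unfolded A] and NB = N[unfolded B] and NZ = N[unfolded Z]
  note labels = assms(2,3)
  consider "b \<in> set A" | "d \<in> set Z" | "b \<notin> set A" "c \<in> set A" "d \<notin> set A"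
    | "b \<notin> set A" "d \<in> set A" "c \<notin> set A" | "a \<notin> set B" "c \<in> set B" "d \<notin> set B"
    | "a \<notin> set B" "d \<in> set B" "c \<notin> set B" | "b \<notin> set A" "c \<notin> set A" "d \<notin> set A" 
      "a \<notin> set B" "c \<notin> set B" "d \<notin> set B" "d \<notin> set Z"
    | "c \<in> set A" "d \<in> set A" | "c \<in> set B" "d \<in> set B" | "a \<in> set B" by blast
  then show ?thesis
  proof cases
    case 1
    show ?thesis unfolding A by (rule same[OF NA]) (use labels 1 in auto)
  next
    case 2
    have "glue_commuting c d a b N" unfolding Z by (rule same[OF NZ]) (use labels 2 in auto)
    then show ?thesis by (rule glue_commuting_swap3)
  next
    case 3
    show ?thesis unfolding A by (rule shared[OF NA]) (use labels 3 in auto)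
  next
    case 4
    have "glue_commuting a b d c N" unfolding A by (rule shared[OF NA]) (use labels 4 in auto)
    then show ?thesis by (rule glue_commuting_swap2)
  next
    case 5
    have "glue_commuting b a c d N" unfolding B by (rule shared[OF NB]) (use labels 5 in auto)
    then show ?thesis by (rule glue_commuting_swap1)
  next
    case 6
    have "glue_commuting b a d c N" unfolding B by (rule shared[OF NB]) (use labels 6 in auto)
    then show ?thesis by (rule glue_commuting_swap1[OF glue_commuting_swap2])
  next
    case 7
    let ?D = "C - set (a # A)"
    have D: "cycle_family ?D M" "b \<in> ?D" "c \<in> ?D" "d \<in> ?D" using NA 7 labels by auto
    obtain B1 M1 where M1: "M = (b # B1) \<rhd> M1" using cycle_family_obtain[OF D(1,2)] .
    have "N = (b # B1) \<rhd> (a # A) \<rhd> M1"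
      unfolding A M1 by (rule add_mset_commute)
    from cycle_family_unique[OF NB trans[OF B[symmetric] this]] have B1: "B1 = B" by simp
    from D[unfolded M1 B1] 7 labels have D1: "cycle_family (?D - set (b # B)) M1"
      "c \<in> ?D - set (b # B)" "d \<in> ?D - set (b # B)" by auto
    obtain Z1 M2 where M2: "M1 = (c # Z1) \<rhd> M2" using cycle_family_obtain[OF D1(1,2)] .
    have "N = (c # Z1) \<rhd> (a # A) \<rhd> (b # B) \<rhd> M2"
      unfolding A M1 M2 B1 by (simp only: add_mset_commute)
    from cycle_family_unique[OF NZ trans[OF Z[symmetric] this]] have Z1: "Z1 = Z" by simp
    from D1[unfolded M2 Z1] 7 labels have "cycle_family (?D - set (b # B) - set (c # Z)) M2"
      "d \<in> ?D - set (b # B) - set (c # Z)" by auto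
    then obtain W M3 where "M2 = (d # W) \<rhd> M3" by (rule cycle_family_obtain)
    then show ?thesis unfolding A M1 M2 by (simp only: glue_commuting_a_b_c_d)
  next
    case 8
    from split_list[OF 8(1)] obtain X Y where X: "A = X @ c # Y" by blast
    have "glue_commuting c d a b ((c # Y @ a # X) \<rhd> M)"
      by (rule same[OF NA[unfolded X cyc_shift[of a X c Y]]]) (use labels 8 X in auto)
    then have "glue_commuting c d a b N" unfolding A X cyc_shift[of a X c Y] .
    then show ?thesis by (rule glue_commuting_swap3)
  next
    case 9
    from split_list[OF 9(1)] obtain X Y where X: "B = X @ c # Y" by blast
    have "glue_commuting c d a b ((c # Y @ b # X) \<rhd> M')"
      by (rule same[OF NB[unfolded X cyc_shift[of b X c Y]]]) (use labels 9 X in auto)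
    then have "glue_commuting c d a b N" unfolding B X cyc_shift[of b X c Y] .
    then show ?thesis by (rule glue_commuting_swap3)
  next
    case 10
    have "glue_commuting b a c d N" unfolding B by (rule same[OF NB]) (use labels 10 in auto)
    then show ?thesis by (rule glue_commuting_swap1)
  qed
qed

lemma glue_commute:
  assumes N: "cycle_family C N" and "{a, b, c, d} \<subseteq> C" "distinct [a, b, c, d]"
    and "glue c d N R" "glue a b R S" and "glue a b N R'" "glue c d R' S'"
  shows "S = S'"
proof -
  obtain T Q Q' where T: "glue c d N Q" "glue a b Q T" "glue a b N Q'" "glue c d Q' T"
    using glue_commuting_family[OF assms(1-3)] unfolding glue_commuting_def by blast
  have Q: "Q = R" "Q' = R'"
    using glue_functional[OF N T(1) assms(4)] glue_functional[OF N T(3) assms(6)] by simp_all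
  have R: "cycle_family (C - {c, d}) R" "cycle_family (C - {a, b}) R'"
    using cycle_family_glue[OF assms(4) N] cycle_family_glue[OF assms(6) N] by simp_all
  show ?thesis
    using glue_functional[OF R(1) T(2)[unfolded Q] assms(5)]
      glue_functional[OF R(2) T(4)[unfolded Q] assms(7)] by simp
qed

section \<open>Contraction and composition of symbols\<close>

lemma QO_symbols_iff:
  "s \<in> QO_symbols C G \<longleftrightarrow>
     cycle_family C (fst s) \<and> fst s \<noteq> {#} \<and> 2 * snd s + (size (fst s) - 1) = G"
proof (cases s)
  case (Pair N g)
  show ?thesis unfolding QO_symbols_def cycle_family_def Pair by auto
qed

text \<open>
  The genus of a symbol in QO(C, G) can be recovered from G and the number of its cycles, so
  equalities between symbols need only be checked on cycle families.
\<close>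

lemma QO_symbols_eqI:
  assumes "s \<in> QO_symbols C G" "t \<in> QO_symbols D G" "fst s = fst t"
  shows "s = t"
  using assms by (auto simp: QO_symbols_iff prod_eq_iff)

text \<open>
  The two clauses defining the contraction of symbols are the two rules for gluing.  The genus grows
  exactly if the number of cycles drops, which is why G grows by one in both.
\<close>

lemma symbol_contr_glue:
  assumes s: "s \<in> QO_symbols (C \<union> {a, b}) G" and ok: "contr_ok a b C"
  shows "symbol_contr a b s \<in> QO_symbols C (G + 1)"
    and "glue a b (fst s) (fst (symbol_contr a b s))"
proof -
  from s have N: "cycle_family (C \<union> {a, b}) (fst s)" "fst s \<noteq> {#}"
    and G: "2 * snd s + (size (fst s) - 1) = G" by (auto simp: QO_symbols_iff)
  from ok have "a \<noteq> b" by (auto simp: contr_ok_def)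
  then obtain R where R: "glue a b (fst s) R" using glue_total[OF N(1), of a b] by auto
  \<comment> \<open>The genus is unchanged if a cycle was split, which is seen from the number of cycles.\<close>
  define r where "r = (R, if size (fst s) < size R then snd s else snd s + 1)"
  have "symbol_contr a b s = r"
    unfolding symbol_contr_def
  proof (rule the_equality)
    from R show "(\<exists>A B N g. s = ((a # A @ b # B) \<rhd> N, g) \<and>
           r = (A \<rhd> B \<rhd> N, g)) \<or>
        (\<exists>A B N g. s = ((a # A) \<rhd> (b # B) \<rhd> N, g) \<and>
           r = ((A @ B) \<rhd> N, g + 1))" (is "?P r")
    proof cases
      case (split A B M)
      then have "s = ((a # A @ b # B) \<rhd> M, snd s) \<and>
           r = (A \<rhd> B \<rhd> M, snd s)"
        by (auto simp: r_def prod_eq_iff)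
      then show ?thesis by blast
    next
      case (join A B M)
      then have "s = ((a # A) \<rhd> (b # B) \<rhd> M, snd s) \<and>
           r = ((A @ B) \<rhd> M, snd s + 1)"
        by (auto simp: r_def prod_eq_iff)
      then show ?thesis by blast
    qed
  next
    fix r' assume "(\<exists>A B N g. s = ((a # A @ b # B) \<rhd> N, g) \<and>
           r' = (A \<rhd> B \<rhd> N, g)) \<or>
        (\<exists>A B N g. s = ((a # A) \<rhd> (b # B) \<rhd> N, g) \<and>
           r' = ((A @ B) \<rhd> N, g + 1))"
    then have r': "glue a b (fst s) (fst r') \<and>
        snd r' = (if size (fst s) < size (fst r') then snd s else snd s + 1)"
      by (auto intro: glue.intros)
    then have "fst r' = R" using glue_functional[OF N(1) _ R] by blast
    with r' show "r' = r" by (simp add: r_def prod_eq_iff)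
  qed
  moreover have "r \<in> QO_symbols C (G + 1)"
  proof -
    have "C \<union> {a, b} - {a, b} = C" using ok by (auto simp: contr_ok_def)
    then have "cycle_family C R" using cycle_family_glue[OF R N(1)] by simp
    moreover have "size (fst s) > 0" "size R > 0"
      using N(2) size_glue(2)[OF R] by (simp_all add: nonempty_has_size)
    ultimately show ?thesis
      using size_glue[OF R] G by (auto simp: QO_symbols_iff r_def)
  qed
  ultimately show "symbol_contr a b s \<in> QO_symbols C (G + 1)"
    and "glue a b (fst s) (fst (symbol_contr a b s))" using R by (auto simp: r_def)
qed

lemma symbol_contr_eqI:
  assumes "s \<in> QO_symbols (C \<union> {a, b}) G" "contr_ok a b C" "r \<in> QO_symbols C (G + 1)"
    and "glue a b (fst s) (fst r)"
  shows "symbol_contr a b s = r"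
proof (rule QO_symbols_eqI[OF symbol_contr_glue(1)[OF assms(1,2)] assms(3)])
  have N: "cycle_family (C \<union> {a, b}) (fst s)" using assms(1) by (simp add: QO_symbols_iff)
  show "fst (symbol_contr a b s) = fst r"
    using glue_functional[OF N symbol_contr_glue(2)[OF assms(1,2)] assms(4)] .
qed

text \<open>
  In a composition along a and b these two labels may be equal, and each of them may also be a label
  of the other symbol.  Then the two families together are not a cycle family, so composition needs
  its own relation, which keeps them apart.
\<close>

inductive comp_glue ::
    "'c \<Rightarrow> 'c \<Rightarrow> 'c list set multiset \<Rightarrow> 'c list set multiset \<Rightarrow> 'c list set multiset \<Rightarrow> bool"
  for a b where
  "comp_glue a b ((a # A) \<rhd> M) ((b # B) \<rhd> N)
     ((A @ B) \<rhd> (M + N))"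

lemma comp_glueI:
  assumes "N = (X @ a # Y) \<rhd> M" "N' = (Z @ b # W) \<rhd> M'"
    and "R = (Y @ X @ W @ Z) \<rhd> (M + M')"
  shows "comp_glue a b N N' R"
proof -
  have "N = (a # Y @ X) \<rhd> M" "N' = (b # W @ Z) \<rhd> M'"
    using cyc_append_commute[of X "a # Y"] cyc_append_commute[of Z "b # W"] assms(1,2) by simp_all
  then show ?thesis using comp_glue.intros[of a b "Y @ X" M "W @ Z" M'] assms(3) by simp
qed

lemma comp_glue_functional:
  assumes "cycle_family C N" "cycle_family D N'" and 1: "comp_glue a b N N' R" and 2: "comp_glue a b N N' R'"
  shows "R = R'"
  using 1
proof cases
  case 1: (1 A M B M')
  from 2 show ?thesis
  proof cases
    case 2: (1 A1 M1 B1 M1')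
    have "A = A1 \<and> M = M1"
      using cycle_family_unique[OF assms(1)[unfolded 1] trans[OF 1(1)[symmetric] 2(1)]] .
    moreover have "B = B1 \<and> M' = M1'"
      using cycle_family_unique[OF assms(2)[unfolded 1] trans[OF 1(2)[symmetric] 2(2)]] .
    ultimately show ?thesis using 1(3) 2(3) by simp
  qed
qed

lemma comp_glue_imp_glue: "comp_glue a b N N' R \<Longrightarrow> glue a b (N + N') R"
proof (induction rule: comp_glue.induct)
  case (1 A M B N)
  show ?case using glue.join[of a b A B "M + N"] by (simp add: add_mset_commute)
qed

lemma comp_glue_sym: "comp_glue a b N N' R \<Longrightarrow> comp_glue b a N' N R"
proof (induction rule: comp_glue.induct)
  case (1 A M B N)
  show ?case
    using comp_glue.intros[of b a B N A M] cyc_append_commute[of A B] by (simp add: union_commute)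
qed

lemma symbol_comp_glue:
  assumes s: "s \<in> QO_symbols (C1 \<union> {a}) G1" and t: "t \<in> QO_symbols (C2 \<union> {b}) G2"
    and ok: "comp_ok a b C1 C2"
  shows "symbol_comp a b s t \<in> QO_symbols (C1 \<union> C2) (G1 + G2)"
    and "comp_glue a b (fst s) (fst t) (fst (symbol_comp a b s t))"
proof -
  from s t have N: "cycle_family (C1 \<union> {a}) (fst s)" "cycle_family (C2 \<union> {b}) (fst t)"
    and G: "2 * snd s + (size (fst s) - 1) = G1" "2 * snd t + (size (fst t) - 1) = G2"
    by (auto simp: QO_symbols_iff)
  obtain A M where A: "fst s = (a # A) \<rhd> M"
    using cycle_family_obtain[OF N(1), of a] by auto
  obtain B M' where B: "fst t = (b # B) \<rhd> M'"
    using cycle_family_obtain[OF N(2), of b] by auto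
  define r where "r = ((A @ B) \<rhd> (M + M'), snd s + snd t)"
  have R: "comp_glue a b (fst s) (fst t) (fst r)" by (simp add: A B r_def comp_glue.intros)
  have "symbol_comp a b s t = r"
    unfolding symbol_comp_def
  proof (rule the_equality)
    have "s = ((a # A) \<rhd> M, snd s) \<and> t = ((b # B) \<rhd> M', snd t) \<and>
        r = ((A @ B) \<rhd> (M + M'), snd s + snd t)"
      using A B by (auto simp: r_def prod_eq_iff)
    then show "\<exists>A B N N' g g'. s = ((a # A) \<rhd> N, g) \<and>
        t = ((b # B) \<rhd> N', g') \<and> r = ((A @ B) \<rhd> (N + N'), g + g')"
      by blast
  next
    fix r' assume "\<exists>A B N N' g g'. s = ((a # A) \<rhd> N, g) \<and>
        t = ((b # B) \<rhd> N', g') \<and> r' = ((A @ B) \<rhd> (N + N'), g + g')"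
    then have r': "comp_glue a b (fst s) (fst t) (fst r')" "snd r' = snd s + snd t"
      by (auto intro: comp_glue.intros)
    have "fst r' = fst r" using comp_glue_functional[OF N r'(1) R] .
    with r' show "r' = r" by (simp add: r_def prod_eq_iff)
  qed
  moreover have "r \<in> QO_symbols (C1 \<union> C2) (G1 + G2)"
  proof -
    from N(1) ok have M: "cycle_family (C1 - set A) M" "distinct A" "set A \<subseteq> C1" "a \<notin> set A"
      unfolding A by (auto simp: comp_ok_def Diff_insert2[symmetric] insert_Diff_if)
    from N(2) ok have M': "cycle_family (C2 - set B) M'" "distinct B" "set B \<subseteq> C2" "b \<notin> set B"
      unfolding B by (auto simp: comp_ok_def Diff_insert2[symmetric] insert_Diff_if)
    have "cycle_family ((C1 - set A) \<union> (C2 - set B)) (M + M')"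
      using ok by (intro cycle_family_union M M') (auto simp: comp_ok_def)
    moreover have "(C1 - set A) \<union> (C2 - set B) = C1 \<union> C2 - set (A @ B)"
      using M M' ok by (auto simp: comp_ok_def)
    ultimately have "cycle_family (C1 \<union> C2) (fst r)"
      using M M' ok by (auto simp: r_def comp_ok_def)
    then show ?thesis using G A B by (auto simp: QO_symbols_iff r_def)
  qed
  ultimately show "symbol_comp a b s t \<in> QO_symbols (C1 \<union> C2) (G1 + G2)"
    and "comp_glue a b (fst s) (fst t) (fst (symbol_comp a b s t))" using R by (auto simp: r_def)
qed

lemma fst_relabel [simp]: "fst (relabel \<rho> s) = relabel_family \<rho> (fst s)"
  by (simp add: relabel_def)

lemma relabel_mem: "s \<in> QO_symbols C G \<Longrightarrow> inj_on \<rho> C \<Longrightarrow> relabel \<rho> s \<in> QO_symbols (\<rho> ` C) G"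
  by (auto simp: QO_symbols_iff cycle_family_relabel relabel_def)

lemma relabel_cong:
  assumes "s \<in> QO_symbols C G" "\<And>c. c \<in> C \<Longrightarrow> \<rho> c = \<sigma> c"
  shows "relabel \<rho> s = relabel \<sigma> s"
  using assms relabel_family_cong[of C "fst s" \<rho> \<sigma>] by (auto simp: relabel_def QO_symbols_iff)

lemma relabel_id [simp]: "relabel id s = s" "relabel (\<lambda>c. c) s = s"
  by (simp_all add: relabel_def)

lemma relabel_comp: "relabel (\<rho> \<circ> \<sigma>) s = relabel \<rho> (relabel \<sigma> s)"
  by (simp add: relabel_def multiset.map_comp comp_def image_image)

lemma contr_ok_image:
  assumes "contr_ok a b C" "inj_on \<rho> (C \<union> {a, b})"
  shows "contr_ok (\<rho> a) (\<rho> b) (\<rho> ` C)"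
proof -
  have "\<rho> a \<notin> \<rho> ` C" "\<rho> b \<notin> \<rho> ` C" "\<rho> a \<noteq> \<rho> b"
    using assms inj_on_image_mem_iff[OF assms(2), of a C] inj_on_image_mem_iff[OF assms(2), of b C]
      inj_onD[OF assms(2), of a b]
    by (auto simp: contr_ok_def)
  then show ?thesis using assms(1) by (simp add: contr_ok_def)
qed

lemma comp_ok_image:
  assumes "comp_ok a b C1 C2" "inj_on \<rho> (C1 \<union> {a})" "inj_on \<sigma> (C2 \<union> {b})" "\<rho> ` C1 \<inter> \<sigma> ` C2 = {}"
  shows "comp_ok (\<rho> a) (\<sigma> b) (\<rho> ` C1) (\<sigma> ` C2)"
proof -
  have "\<rho> a \<notin> \<rho> ` C1" "\<sigma> b \<notin> \<sigma> ` C2"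
    using assms(1) inj_on_image_mem_iff[OF assms(2), of a C1] inj_on_image_mem_iff[OF assms(3), of b C2]
    by (auto simp: comp_ok_def)
  then show ?thesis using assms(1,4) by (simp add: comp_ok_def)
qed

lemma relabel_contr:
  assumes "contr_ok a b C" "inj_on \<rho> (C \<union> {a, b})" "s \<in> QO_symbols (C \<union> {a, b}) G"
  shows "relabel \<rho> (symbol_contr a b s) = symbol_contr (\<rho> a) (\<rho> b) (relabel \<rho> s)"
proof (rule symbol_contr_eqI[symmetric])
  have "\<rho> ` (C \<union> {a, b}) = \<rho> ` C \<union> {\<rho> a, \<rho> b}" by auto
  with relabel_mem[OF assms(3,2)] show "relabel \<rho> s \<in> QO_symbols (\<rho> ` C \<union> {\<rho> a, \<rho> b}) G" by simp
  from assms(1,2) show "contr_ok (\<rho> a) (\<rho> b) (\<rho> ` C)" by (rule contr_ok_image)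
  show "relabel \<rho> (symbol_contr a b s) \<in> QO_symbols (\<rho> ` C) (G + 1)"
    using symbol_contr_glue(1)[OF assms(3,1)] inj_on_subset[OF assms(2), of C] by (intro relabel_mem) auto
  show "glue (\<rho> a) (\<rho> b) (fst (relabel \<rho> s)) (fst (relabel \<rho> (symbol_contr a b s)))"
    using symbol_contr_glue(2)[OF assms(3,1)] by (simp add: glue_relabel)
qed

lemma symbol_comp_eqI:
  assumes "s \<in> QO_symbols (C1 \<union> {a}) G1" "t \<in> QO_symbols (C2 \<union> {b}) G2" "comp_ok a b C1 C2"
    and "r \<in> QO_symbols (C1 \<union> C2) (G1 + G2)" "comp_glue a b (fst s) (fst t) (fst r)"
  shows "symbol_comp a b s t = r"
proof (rule QO_symbols_eqI[OF symbol_comp_glue(1)[OF assms(1-3)] assms(4)])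
  have N: "cycle_family (C1 \<union> {a}) (fst s)" "cycle_family (C2 \<union> {b}) (fst t)"
    using assms(1,2) by (auto simp: QO_symbols_iff)
  show "fst (symbol_comp a b s t) = fst r"
    using comp_glue_functional[OF N symbol_comp_glue(2)[OF assms(1-3)] assms(5)] .
qed

lemma inj_on_join_bij:
  assumes ok: "comp_ok a b C1 C2" and inj: "inj_on \<rho> (C1 \<union> {a})" "inj_on \<sigma> (C2 \<union> {b})"
    and disj: "\<rho> ` C1 \<inter> \<sigma> ` C2 = {}"
  shows "inj_on (join_bij C1 \<rho> \<sigma>) (C1 \<union> C2)"
    and "join_bij C1 \<rho> \<sigma> ` (C1 \<union> C2) = \<rho> ` C1 \<union> \<sigma> ` C2"
proof -
  let ?\<tau> = "join_bij C1 \<rho> \<sigma>"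
  have \<tau>: "?\<tau> c = \<rho> c" if "c \<in> C1" for c using that by (simp add: join_bij_def)
  have \<tau>': "?\<tau> c = \<sigma> c" if "c \<in> C2" for c using that ok by (auto simp: join_bij_def comp_ok_def)
  have "inj_on ?\<tau> C1" "inj_on ?\<tau> C2"
    using inj_on_subset[OF inj(1), of C1] inj_on_subset[OF inj(2), of C2]
      inj_on_cong[of C1 ?\<tau> \<rho>, OF \<tau>] inj_on_cong[of C2 ?\<tau> \<sigma>, OF \<tau>'] by auto
  moreover have "?\<tau> ` C1 = \<rho> ` C1" "?\<tau> ` C2 = \<sigma> ` C2" by (simp_all add: \<tau> \<tau>' cong: image_cong)
  ultimately show "inj_on ?\<tau> (C1 \<union> C2)"
    unfolding inj_on_Un using disj by blast
  show "?\<tau> ` (C1 \<union> C2) = \<rho> ` C1 \<union> \<sigma> ` C2" by (simp add: image_Un \<tau> \<tau>' cong: image_cong)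
qed

lemma relabel_symbol_comp:
  assumes ok: "comp_ok a b C1 C2" and inj: "inj_on \<rho> (C1 \<union> {a})" "inj_on \<sigma> (C2 \<union> {b})"
    and disj: "\<rho> ` C1 \<inter> \<sigma> ` C2 = {}"
    and s: "s \<in> QO_symbols (C1 \<union> {a}) G1" and t: "t \<in> QO_symbols (C2 \<union> {b}) G2"
  shows "relabel (join_bij C1 \<rho> \<sigma>) (symbol_comp a b s t) =
    symbol_comp (\<rho> a) (\<sigma> b) (relabel \<rho> s) (relabel \<sigma> t)"
proof (rule symbol_comp_eqI[where ?C1.0 = "\<rho> ` C1" and ?C2.0 = "\<sigma> ` C2" and ?G1.0 = G1 and ?G2.0 = G2, symmetric])
  show "relabel \<rho> s \<in> QO_symbols (\<rho> ` C1 \<union> {\<rho> a}) G1" using relabel_mem[OF s inj(1)] by simp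
  show "relabel \<sigma> t \<in> QO_symbols (\<sigma> ` C2 \<union> {\<sigma> b}) G2" using relabel_mem[OF t inj(2)] by simp
  show "comp_ok (\<rho> a) (\<sigma> b) (\<rho> ` C1) (\<sigma> ` C2)"
    using ok inj disj by (rule comp_ok_image)
  let ?\<tau> = "join_bij C1 \<rho> \<sigma>"
  have \<tau>: "?\<tau> c = \<rho> c" if "c \<in> C1" for c using that by (simp add: join_bij_def)
  have \<tau>': "?\<tau> c = \<sigma> c" if "c \<in> C2" for c using that ok by (auto simp: join_bij_def comp_ok_def)
  show "relabel ?\<tau> (symbol_comp a b s t) \<in> QO_symbols (\<rho> ` C1 \<union> \<sigma> ` C2) (G1 + G2)"
    using relabel_mem[OF symbol_comp_glue(1)[OF s t ok] inj_on_join_bij(1)[OF ok inj disj]]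
    unfolding inj_on_join_bij(2)[OF ok inj disj] .
  have N: "cycle_family (C1 \<union> {a}) (fst s)" "cycle_family (C2 \<union> {b}) (fst t)"
    using s t by (auto simp: QO_symbols_iff)
  from symbol_comp_glue(2)[OF s t ok]
  show "comp_glue (\<rho> a) (\<sigma> b) (fst (relabel \<rho> s)) (fst (relabel \<sigma> t))
     (fst (relabel ?\<tau> (symbol_comp a b s t)))"
  proof cases
    case (1 A M B M')
    from N(1) ok have M: "cycle_family (C1 - set A) M" "set A \<subseteq> C1" "a \<notin> set A"
      unfolding 1 by (auto simp: comp_ok_def insert_Diff_if Diff_insert2[symmetric])
    from N(2) ok have M': "cycle_family (C2 - set B) M'" "set B \<subseteq> C2" "b \<notin> set B"
      unfolding 1 by (auto simp: comp_ok_def insert_Diff_if Diff_insert2[symmetric])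
    have AB: "map ?\<tau> A = map \<rho> A" "map ?\<tau> B = map \<sigma> B" using M M' \<tau> \<tau>' by auto
    moreover have "relabel_family ?\<tau> M = relabel_family \<rho> M"
      "relabel_family ?\<tau> M' = relabel_family \<sigma> M'"
      using relabel_family_cong[OF M(1)] relabel_family_cong[OF M'(1)] \<tau> \<tau>' by blast+
    ultimately show ?thesis
      using 1 comp_glue.intros[of "\<rho> a" "\<sigma> b" "map \<rho> A" "relabel_family \<rho> M" "map \<sigma> B" "relabel_family \<sigma> M'"]
      by (simp add: image_map_cyc AB del: map_eq_conv)
  qed
qed

lemma symbol_contr_sym:
  assumes "contr_ok a b C" "s \<in> QO_symbols (C \<union> {a, b}) G"
  shows "symbol_contr a b s = symbol_contr b a s"
proof (rule symbol_contr_eqI[OF assms(2,1)])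
  have *: "s \<in> QO_symbols (C \<union> {b, a}) G" "contr_ok b a C"
    using assms by (auto simp: contr_ok_def insert_commute)
  then show "symbol_contr b a s \<in> QO_symbols C (G + 1)"
    "glue a b (fst s) (fst (symbol_contr b a s))"
    using symbol_contr_glue[OF *] by (auto intro: glue_sym)
qed

lemma symbol_comp_sym:
  assumes "comp_ok a b C1 C2" "s \<in> QO_symbols (C1 \<union> {a}) G1" "t \<in> QO_symbols (C2 \<union> {b}) G2"
  shows "symbol_comp a b s t = symbol_comp b a t s"
proof (rule symbol_comp_eqI[OF assms(2,3,1)])
  have *: "comp_ok b a C2 C1" using assms(1) by (auto simp: comp_ok_def)
  show "symbol_comp b a t s \<in> QO_symbols (C1 \<union> C2) (G1 + G2)"
    using symbol_comp_glue(1)[OF assms(3,2) *] by (simp add: Un_commute add.commute)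
  show "comp_glue a b (fst s) (fst t) (fst (symbol_comp b a t s))"
    using symbol_comp_glue(2)[OF assms(3,2) *] by (rule comp_glue_sym)
qed

lemma symbol_contr_contr:
  assumes "contr_ok c d (C \<union> {a, b})" "contr_ok a b C"
    and ok: "contr_ok a b (C \<union> {c, d})" "contr_ok c d C"
    and s: "s \<in> QO_symbols (C \<union> {a, b, c, d}) G"
  shows "symbol_contr a b (symbol_contr c d s) = symbol_contr c d (symbol_contr a b s)"
proof -
  have s1: "s \<in> QO_symbols (C \<union> {a, b} \<union> {c, d}) G" and s2: "s \<in> QO_symbols (C \<union> {c, d} \<union> {a, b}) G"
    using s by (simp_all add: insert_commute)
  note 1 = symbol_contr_glue[OF s1 assms(1)]
  note 2 = symbol_contr_glue[OF s2 assms(3)]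
  note 11 = symbol_contr_glue[OF 1(1) assms(2)]
  note 22 = symbol_contr_glue[OF 2(1) assms(4)]
  have N: "cycle_family (C \<union> {a, b, c, d}) (fst s)" using s by (simp add: QO_symbols_iff)
  have "distinct [a, b, c, d]" using assms by (auto simp: contr_ok_def)
  from glue_commute[OF N _ this 1(2) 11(2) 2(2) 22(2)]
  show ?thesis by (intro QO_symbols_eqI[OF 11(1) 22(1)]) auto
qed

lemma fst_symbol_comp:
  assumes "s \<in> QO_symbols (C1 \<union> {a}) G1" "t \<in> QO_symbols (C2 \<union> {b}) G2" "comp_ok a b C1 C2"
    and "comp_glue a b (fst s) (fst t) R"
  shows "fst (symbol_comp a b s t) = R"
proof -
  have "cycle_family (C1 \<union> {a}) (fst s)" "cycle_family (C2 \<union> {b}) (fst t)"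
    using assms(1,2) by (auto simp: QO_symbols_iff)
  from comp_glue_functional[OF this symbol_comp_glue(2)[OF assms(1-3)] assms(4)] show ?thesis .
qed

text \<open>
  The labels at which two symbols are composed are dummies.  Renaming them to fresh ones makes the
  two families disjoint, so that composition becomes a gluing of their union.
\<close>

lemma symbol_comp_rename:
  assumes ok: "comp_ok a b C1 C2" and fresh: "a' \<notin> C1" "b' \<notin> C2"
    and s: "s \<in> QO_symbols (C1 \<union> {a}) G1" and t: "t \<in> QO_symbols (C2 \<union> {b}) G2"
  shows "symbol_comp a b s t = symbol_comp a' b' (relabel (id(a := a')) s) (relabel (id(b := b')) t)"
proof -
  let ?\<rho> = "id(a := a')" and ?\<sigma> = "id(b := b')"
  have id: "?\<rho> c = c" if "c \<in> C1" for c using ok that by (auto simp: comp_ok_def)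
  have id': "?\<sigma> c = c" if "c \<in> C2" for c using ok that by (auto simp: comp_ok_def)
  have im: "?\<rho> ` C1 = C1" "?\<sigma> ` C2 = C2" using id id' by (simp_all cong: image_cong)
  have "inj_on ?\<rho> C1" "inj_on ?\<sigma> C2" using id id' by (simp_all add: inj_on_def)
  then have inj: "inj_on ?\<rho> (C1 \<union> {a})" "inj_on ?\<sigma> (C2 \<union> {b})"
    using fresh im ok by (auto simp: comp_ok_def)
  have "relabel (join_bij C1 ?\<rho> ?\<sigma>) (symbol_comp a b s t) = symbol_comp a b s t"
    by (rule trans[OF relabel_cong[OF symbol_comp_glue(1)[OF s t ok]] relabel_id(1)])
      (auto simp: join_bij_def id id' simp del: fun_upd_apply)
  with relabel_symbol_comp[OF ok inj _ s t] show ?thesis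
    using ok im by (simp add: comp_ok_def)
qed

lemma inj_on_rename: "a' \<notin> C \<Longrightarrow> inj_on (id(a := a')) (C \<union> {a})"
  by (auto simp: inj_on_def)

lemma image_rename: "a \<notin> C \<Longrightarrow> id(a := a') ` (C \<union> {a}) = C \<union> {a'}"
  by auto

lemma relabel_rename_mem:
  assumes "s \<in> QO_symbols (C \<union> {a}) G" "a \<notin> C" "a' \<notin> C"
  shows "relabel (id(a := a')) s \<in> QO_symbols (C \<union> {a'}) G"
  using relabel_mem[OF assms(1) inj_on_rename[OF assms(3)]] image_rename[OF assms(2)] by metis

text \<open>
  Both sides glue the same two pairs in the disjoint union of the two families, in the two possible
  orders.
\<close>

lemma symbol_contr_comp_exchange_distinct:
  assumes ok: "comp_ok c d (C1 \<union> {a}) (C2 \<union> {b})" "contr_ok a b (C1 \<union> C2)"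
    "comp_ok a b (C1 \<union> {c}) (C2 \<union> {d})" "contr_ok c d (C1 \<union> C2)"
    and ad: "a \<noteq> d" and bc: "b \<noteq> c"
    and s: "s \<in> QO_symbols (C1 \<union> {a, c}) G1" and t: "t \<in> QO_symbols (C2 \<union> {b, d}) G2"
  shows "symbol_contr a b (symbol_comp c d s t) = symbol_contr c d (symbol_comp a b s t)"
proof -
  have s1: "s \<in> QO_symbols (C1 \<union> {a} \<union> {c}) G1" and s2: "s \<in> QO_symbols (C1 \<union> {c} \<union> {a}) G1"
    and t1: "t \<in> QO_symbols (C2 \<union> {b} \<union> {d}) G2" and t2: "t \<in> QO_symbols (C2 \<union> {d} \<union> {b}) G2"
    using s t by (simp_all add: insert_commute)
  note 1 = symbol_comp_glue[OF s1 t1 ok(1)]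
  note 2 = symbol_comp_glue[OF s2 t2 ok(3)]
  have m: "symbol_comp c d s t \<in> QO_symbols (C1 \<union> C2 \<union> {a, b}) (G1 + G2)"
    "symbol_comp a b s t \<in> QO_symbols (C1 \<union> C2 \<union> {c, d}) (G1 + G2)"
    using 1(1) 2(1) by (simp_all add: insert_commute)
  note 11 = symbol_contr_glue[OF m(1) ok(2)]
  note 22 = symbol_contr_glue[OF m(2) ok(4)]
  have d: "distinct [a, b, c, d]" using ok ad bc by (auto simp: contr_ok_def comp_ok_def)
  have "cycle_family ((C1 \<union> {a, c}) \<union> (C2 \<union> {b, d})) (fst s + fst t)"
    using s t ok ad bc by (intro cycle_family_union) (auto simp: QO_symbols_iff comp_ok_def contr_ok_def)
  from glue_commute[OF this _ d comp_glue_imp_glue[OF 1(2)] 11(2) comp_glue_imp_glue[OF 2(2)] 22(2)]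
  show ?thesis by (intro QO_symbols_eqI[OF 11(1) 22(1)]) auto
qed

text \<open>
  The exchange law also has to hold if d equals a, a label of the other symbol.  On both sides d can
  be replaced by a fresh label: on the left it is a dummy of a composition, on the right of a
  contraction.
\<close>

lemma symbol_contr_comp_exchange_rename:
  assumes ok: "comp_ok c d (C1 \<union> {a}) (C2 \<union> {b})" "contr_ok a b (C1 \<union> C2)"
    "comp_ok a b (C1 \<union> {c}) (C2 \<union> {d})" "contr_ok c d (C1 \<union> C2)"
    and fresh: "d' \<notin> C1 \<union> C2 \<union> {a, b, c, d}"
    and s: "s \<in> QO_symbols (C1 \<union> {a, c}) G1" and t: "t \<in> QO_symbols (C2 \<union> {b, d}) G2"
    and eq: "symbol_contr a b (symbol_comp c d' s (relabel (id(d := d')) t)) =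
      symbol_contr c d' (symbol_comp a b s (relabel (id(d := d')) t))"
  shows "symbol_contr a b (symbol_comp c d s t) = symbol_contr c d (symbol_comp a b s t)"
proof -
  let ?\<sigma> = "id(d := d')"
  have s1: "s \<in> QO_symbols (C1 \<union> {a} \<union> {c}) G1" and s2: "s \<in> QO_symbols (C1 \<union> {c} \<union> {a}) G1"
    and t1: "t \<in> QO_symbols (C2 \<union> {b} \<union> {d}) G2" and t2: "t \<in> QO_symbols (C2 \<union> {d} \<union> {b}) G2"
    using s t by (simp_all add: insert_commute)
  have "symbol_comp c d s t = symbol_comp c d' (relabel (id(c := c)) s) (relabel ?\<sigma> t)"
    using ok fresh by (intro symbol_comp_rename[OF ok(1) _ _ s1 t1]) (auto simp: comp_ok_def)
  then have L: "symbol_comp c d s t = symbol_comp c d' s (relabel ?\<sigma> t)"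
    by (simp add: fun_upd_idem)
  have u: "symbol_comp a b s t \<in> QO_symbols (C1 \<union> C2 \<union> {c, d}) (G1 + G2)"
    using symbol_comp_glue(1)[OF s2 t2 ok(3)] by (simp add: insert_commute)
  have "inj_on ?\<sigma> (C1 \<union> C2 \<union> {c, d})"
    using inj_on_rename[of d' "C1 \<union> C2 \<union> {c}" d] fresh by (simp add: insert_commute)
  from relabel_contr[OF ok(4) this u]
  have "relabel ?\<sigma> (symbol_contr c d (symbol_comp a b s t)) =
      symbol_contr c d' (relabel ?\<sigma> (symbol_comp a b s t))"
    using ok(4) by (simp add: contr_ok_def)
  moreover have "relabel ?\<sigma> (symbol_contr c d (symbol_comp a b s t)) = symbol_contr c d (symbol_comp a b s t)"
    by (rule trans[OF relabel_cong[OF symbol_contr_glue(1)[OF u ok(4)]] relabel_id(1)])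
      (use ok(4) in \<open>auto simp: contr_ok_def\<close>)
  moreover have "relabel ?\<sigma> (symbol_comp a b s t) = symbol_comp a b s (relabel ?\<sigma> t)"
  proof -
    have "relabel (join_bij (C1 \<union> {c}) id ?\<sigma>) (symbol_comp a b s t) =
        symbol_comp (id a) (?\<sigma> b) (relabel id s) (relabel ?\<sigma> t)"
    proof (rule relabel_symbol_comp[OF ok(3) _ _ _ s2 t2])
      show "inj_on ?\<sigma> (C2 \<union> {d} \<union> {b})"
        using inj_on_rename[of d' "C2 \<union> {b}" d] fresh by (simp add: insert_commute)
      have "?\<sigma> ` (C2 \<union> {d}) = C2 \<union> {d'}" using ok(1) by (intro image_rename) (auto simp: comp_ok_def)
      then show "id ` (C1 \<union> {c}) \<inter> ?\<sigma> ` (C2 \<union> {d}) = {}"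
        using ok(3) fresh by (auto simp: comp_ok_def)
    qed simp
    moreover have "relabel (join_bij (C1 \<union> {c}) id ?\<sigma>) (symbol_comp a b s t) = relabel ?\<sigma> (symbol_comp a b s t)"
      using ok(3,4) by (intro relabel_cong[OF u]) (auto simp: join_bij_def contr_ok_def)
    moreover have "b \<noteq> d" using ok(3) by (auto simp: comp_ok_def)
    ultimately show ?thesis by simp
  qed
  ultimately show ?thesis using eq L by simp
qed

lemma symbol_contr_comp_exchange:
  fixes C1 :: "'c set"
  assumes inf: "infinite (UNIV :: 'c set)"
    and ok: "comp_ok c d (C1 \<union> {a}) (C2 \<union> {b})" "contr_ok a b (C1 \<union> C2)"
    "comp_ok a b (C1 \<union> {c}) (C2 \<union> {d})" "contr_ok c d (C1 \<union> C2)"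
    and s: "s \<in> QO_symbols (C1 \<union> {a, c}) G1" and t: "t \<in> QO_symbols (C2 \<union> {b, d}) G2"
  shows "symbol_contr a b (symbol_comp c d s t) = symbol_contr c d (symbol_comp a b s t)"
proof -
  have fin: "finite (C1 \<union> C2 \<union> {a, b, c, d})" using ok by (simp add: comp_ok_def)
  obtain d' where d': "d' \<notin> C1 \<union> C2 \<union> {a, b, c, d}" using ex_new_if_finite[OF inf fin] by blast
  have "finite (C1 \<union> C2 \<union> {a, b, c, d, d'})" using fin by simp
  from ex_new_if_finite[OF inf this] obtain c' where c': "c' \<notin> C1 \<union> C2 \<union> {a, b, c, d, d'}" by blast
  let ?s = "relabel (id(c := c')) s" and ?t = "relabel (id(d := d')) t"
  have "?s \<in> QO_symbols (C1 \<union> {a} \<union> {c'}) G1"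
    using s c' ok(1) by (intro relabel_rename_mem) (auto simp: insert_commute comp_ok_def)
  then have s': "?s \<in> QO_symbols (C1 \<union> {a, c'}) G1" by (simp add: insert_commute)
  have "?t \<in> QO_symbols (C2 \<union> {b} \<union> {d'}) G2"
    using t d' ok(1) by (intro relabel_rename_mem) (auto simp: insert_commute comp_ok_def)
  then have t': "?t \<in> QO_symbols (C2 \<union> {b, d'}) G2" by (simp add: insert_commute)
  note defs = comp_ok_def contr_ok_def
  have ok1: "comp_ok d' c (C2 \<union> {b}) (C1 \<union> {a})" "contr_ok b a (C2 \<union> C1)"
    "comp_ok b a (C2 \<union> {d'}) (C1 \<union> {c})" "contr_ok d' c (C2 \<union> C1)"
    using ok d' by (auto simp: defs)
  have ok2: "comp_ok d' c' (C2 \<union> {b}) (C1 \<union> {a})" "contr_ok b a (C2 \<union> C1)"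
    "comp_ok b a (C2 \<union> {d'}) (C1 \<union> {c'})" "contr_ok d' c' (C2 \<union> C1)"
    using ok d' c' by (auto simp: defs)
  have ok3: "comp_ok c d' (C1 \<union> {a}) (C2 \<union> {b})" "comp_ok a b (C1 \<union> {c}) (C2 \<union> {d'})"
    "contr_ok a b (C1 \<union> C2)" "contr_ok c d' (C1 \<union> C2)"
    using ok d' by (auto simp: defs)
  have "symbol_contr b a (symbol_comp d' c' ?t ?s) = symbol_contr d' c' (symbol_comp b a ?t ?s)"
    using c' d' by (intro symbol_contr_comp_exchange_distinct[OF ok2 _ _ t' s']) auto
  then have 1: "symbol_contr b a (symbol_comp d' c ?t s) = symbol_contr d' c (symbol_comp b a ?t s)"
    using c' by (intro symbol_contr_comp_exchange_rename[OF ok1 _ t' s]) auto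
  have s1: "s \<in> QO_symbols (C1 \<union> {a} \<union> {c}) G1" and s2: "s \<in> QO_symbols (C1 \<union> {c} \<union> {a}) G1"
    and t1: "?t \<in> QO_symbols (C2 \<union> {b} \<union> {d'}) G2" and t2: "?t \<in> QO_symbols (C2 \<union> {d'} \<union> {b}) G2"
    using s t' by (simp_all add: insert_commute)
  have "symbol_comp c d' s ?t \<in> QO_symbols (C1 \<union> C2 \<union> {a, b}) (G1 + G2)"
    "symbol_comp a b s ?t \<in> QO_symbols (C1 \<union> C2 \<union> {c, d'}) (G1 + G2)"
    using symbol_comp_glue(1)[OF s1 t1 ok3(1)] symbol_comp_glue(1)[OF s2 t2 ok3(2)]
    by (simp_all add: insert_commute)
  note sym = symbol_contr_sym[OF ok3(3) this(1)] symbol_contr_sym[OF ok3(4) this(2)]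
    symbol_comp_sym[OF ok3(1) s1 t1] symbol_comp_sym[OF ok3(2) s2 t2]
  have "symbol_contr a b (symbol_comp c d' s ?t) = symbol_contr c d' (symbol_comp a b s ?t)"
    using 1 unfolding sym(3,4)[symmetric] by (simp only: sym(1,2))
  then show ?thesis using d' by (intro symbol_contr_comp_exchange_rename[OF ok _ s t]) auto
qed

text \<open>
  Again two pairs are glued in the disjoint union of the families, this time in orders that contract
  first or last.
\<close>

lemma symbol_comp_contr_distinct:
  assumes ok: "contr_ok c d (C1 \<union> {a})" "comp_ok a b C1 C2"
    "comp_ok a b (C1 \<union> {c, d}) C2" "contr_ok c d (C1 \<union> C2)"
    and ab: "a \<notin> C2" "b \<notin> C1 \<union> {a, c, d}"
    and s: "s \<in> QO_symbols (C1 \<union> {a, c, d}) G1" and t: "t \<in> QO_symbols (C2 \<union> {b}) G2"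
  shows "symbol_comp a b (symbol_contr c d s) t = symbol_contr c d (symbol_comp a b s t)"
proof -
  have s1: "s \<in> QO_symbols (C1 \<union> {a} \<union> {c, d}) G1" and s2: "s \<in> QO_symbols (C1 \<union> {c, d} \<union> {a}) G1"
    using s by (simp_all add: insert_commute)
  note 1 = symbol_contr_glue[OF s1 ok(1)]
  note 11 = symbol_comp_glue[OF 1(1) t ok(2)]
  note 2 = symbol_comp_glue[OF s2 t ok(3)]
  have m: "symbol_comp a b s t \<in> QO_symbols (C1 \<union> C2 \<union> {c, d}) (G1 + G2)"
    using 2(1) by (simp add: insert_commute)
  note 22 = symbol_contr_glue[OF m ok(4)]
  have d: "distinct [a, b, c, d]" using ok ab by (auto simp: contr_ok_def comp_ok_def)
  have "cycle_family ((C1 \<union> {a, c, d}) \<union> (C2 \<union> {b})) (fst s + fst t)"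
    using s t ok ab by (intro cycle_family_union) (auto simp: QO_symbols_iff comp_ok_def contr_ok_def)
  from glue_commute[OF this _ d glue_frame[OF 1(2)] comp_glue_imp_glue[OF 11(2)]
      comp_glue_imp_glue[OF 2(2)] 22(2)]
  have "fst (symbol_comp a b (symbol_contr c d s) t) = fst (symbol_contr c d (symbol_comp a b s t))"
    by auto
  then show ?thesis using 11(1) 22(1) by (intro QO_symbols_eqI) auto
qed

lemma symbol_comp_contr:
  fixes C1 :: "'c set"
  assumes inf: "infinite (UNIV :: 'c set)"
    and ok: "contr_ok c d (C1 \<union> {a})" "comp_ok a b C1 C2"
    "comp_ok a b (C1 \<union> {c, d}) C2" "contr_ok c d (C1 \<union> C2)"
    and s: "s \<in> QO_symbols (C1 \<union> {a, c, d}) G1" and t: "t \<in> QO_symbols (C2 \<union> {b}) G2"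
  shows "symbol_comp a b (symbol_contr c d s) t = symbol_contr c d (symbol_comp a b s t)"
proof -
  have fin: "finite (C1 \<union> C2 \<union> {a, b, c, d})" using ok by (simp add: comp_ok_def)
  obtain a' where a': "a' \<notin> C1 \<union> C2 \<union> {a, b, c, d}" using ex_new_if_finite[OF inf fin] by blast
  have "finite (C1 \<union> C2 \<union> {a, b, c, d, a'})" using fin by simp
  from ex_new_if_finite[OF inf this] obtain b' where b': "b' \<notin> C1 \<union> C2 \<union> {a, b, c, d, a'}" by blast
  let ?\<rho> = "id(a := a')" and ?\<sigma> = "id(b := b')"
  note defs = comp_ok_def contr_ok_def
  have s1: "s \<in> QO_symbols (C1 \<union> {a} \<union> {c, d}) G1" and s2: "s \<in> QO_symbols (C1 \<union> {c, d} \<union> {a}) G1"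
    using s by (simp_all add: insert_commute)
  have "relabel ?\<rho> s \<in> QO_symbols (C1 \<union> {c, d} \<union> {a'}) G1"
    using s2 a' ok by (intro relabel_rename_mem) (auto simp: defs)
  then have s': "relabel ?\<rho> s \<in> QO_symbols (C1 \<union> {a', c, d}) G1" by (simp add: insert_commute)
  have t': "relabel ?\<sigma> t \<in> QO_symbols (C2 \<union> {b'}) G2"
    using t b' ok by (intro relabel_rename_mem) (auto simp: defs)
  have ok': "contr_ok c d (C1 \<union> {a'})" "comp_ok a' b' C1 C2"
    "comp_ok a' b' (C1 \<union> {c, d}) C2" "contr_ok c d (C1 \<union> C2)"
    using ok a' b' by (auto simp: defs)
  have "inj_on ?\<rho> (C1 \<union> {a} \<union> {c, d})"
    using inj_on_rename[of a' "C1 \<union> {c, d}" a] a' by (simp add: insert_commute)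
  from relabel_contr[OF ok(1) this s1]
  have c: "relabel ?\<rho> (symbol_contr c d s) = symbol_contr c d (relabel ?\<rho> s)"
    using ok(1) by (simp add: contr_ok_def)
  have "symbol_comp a b (symbol_contr c d s) t =
      symbol_comp a' b' (relabel ?\<rho> (symbol_contr c d s)) (relabel ?\<sigma> t)"
    using a' b' by (intro symbol_comp_rename[OF ok(2) _ _ symbol_contr_glue(1)[OF s1 ok(1)] t]) auto
  moreover have "symbol_comp a b s t = symbol_comp a' b' (relabel ?\<rho> s) (relabel ?\<sigma> t)"
    using a' b' by (intro symbol_comp_rename[OF ok(3) _ _ s2 t]) auto
  moreover have "symbol_comp a' b' (symbol_contr c d (relabel ?\<rho> s)) (relabel ?\<sigma> t) =
      symbol_contr c d (symbol_comp a' b' (relabel ?\<rho> s) (relabel ?\<sigma> t))"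
    using a' b' by (intro symbol_comp_contr_distinct[OF ok' _ _ s' t']) auto
  ultimately show ?thesis using c by simp
qed

text \<open>
  Here the labels may collide in many ways, and instead of renaming all of them it is simpler to
  compute both sides: the middle symbol has b and c either in one cycle or in two.
\<close>

lemma symbol_comp_assoc:
  assumes ok: "comp_ok c d (C2 \<union> {b}) C3" "comp_ok a b C1 (C2 \<union> C3)"
    "comp_ok a b C1 (C2 \<union> {c})" "comp_ok c d (C1 \<union> C2) C3"
    and x: "x \<in> QO_symbols (C1 \<union> {a}) G1" and y: "y \<in> QO_symbols (C2 \<union> {b, c}) G2"
    and z: "z \<in> QO_symbols (C3 \<union> {d}) G3"
  shows "symbol_comp a b x (symbol_comp c d y z) = symbol_comp c d (symbol_comp a b x y) z"
proof -
  have y1: "y \<in> QO_symbols (C2 \<union> {b} \<union> {c}) G2" and y2: "y \<in> QO_symbols (C2 \<union> {c} \<union> {b}) G2"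
    using y by (simp_all add: insert_commute)
  have "symbol_comp c d y z \<in> QO_symbols (C2 \<union> C3 \<union> {b}) (G2 + G3)"
    using symbol_comp_glue(1)[OF y1 z ok(1)] by (simp add: insert_commute)
  note 1 = fst_symbol_comp[OF y1 z ok(1)] fst_symbol_comp[OF x this ok(2)] symbol_comp_glue(1)[OF x this ok(2)]
  have "symbol_comp a b x y \<in> QO_symbols (C1 \<union> C2 \<union> {c}) (G1 + G2)"
    using symbol_comp_glue(1)[OF x y2 ok(3)] by (simp add: insert_commute)
  note 2 = fst_symbol_comp[OF x y2 ok(3)] fst_symbol_comp[OF this z ok(4)] symbol_comp_glue(1)[OF this z ok(4)]
  have N: "cycle_family (C1 \<union> {a}) (fst x)" "cycle_family (C2 \<union> {b, c}) (fst y)"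
    "cycle_family (C3 \<union> {d}) (fst z)" using x y z by (auto simp: QO_symbols_iff)
  obtain A M where A: "fst x = (a # A) \<rhd> M" using cycle_family_obtain[OF N(1), of a] by auto
  obtain D M' where D: "fst z = (d # D) \<rhd> M'" using cycle_family_obtain[OF N(3), of d] by auto
  obtain B K where B: "fst y = (b # B) \<rhd> K" using cycle_family_obtain[OF N(2), of b] by auto
  have "fst (symbol_comp a b x (symbol_comp c d y z)) = fst (symbol_comp c d (symbol_comp a b x y) z)"
  proof (cases "c \<in> set B")
    case True
    then obtain X Y where X: "B = X @ c # Y" by (meson split_list)
    have e1: "fst (symbol_comp c d y z) = (Y @ (b # X) @ D) \<rhd> (K + M')"
      by (intro 1(1) comp_glueI[of _ "b # X" c Y K _ "[]" d D M']) (simp_all add: A B D X)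
    have e2: "fst (symbol_comp a b x (symbol_comp c d y z)) =
        (A @ (X @ D) @ Y) \<rhd> (M + (K + M'))"
      by (intro 1(2) comp_glueI[of _ "[]" a A M _ Y b "X @ D" "K + M'"]) (simp_all add: A e1)
    have e3: "fst (symbol_comp a b x y) = (A @ X @ c # Y) \<rhd> (M + K)"
      by (intro 2(1) comp_glueI[of _ "[]" a A M _ "[]" b "X @ c # Y" K]) (simp_all add: A B X)
    have e4: "fst (symbol_comp c d (symbol_comp a b x y) z) =
        (Y @ (A @ X) @ D) \<rhd> ((M + K) + M')"
      by (intro 2(2) comp_glueI[of _ "A @ X" c Y "M + K" _ "[]" d D M']) (simp_all add: D e3)
    show ?thesis using cyc_append_commute[of Y "A @ X @ D"] by (simp add: e2 e4 ac_simps)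
  next
    case False
    have "b \<noteq> c" using ok by (auto simp: comp_ok_def)
    with N(2)[unfolded B] False have "cycle_family (C2 \<union> {b, c} - set (b # B)) K"
      "c \<in> C2 \<union> {b, c} - set (b # B)" by auto
    then obtain E L where E: "K = (c # E) \<rhd> L" by (rule cycle_family_obtain)
    have e1: "fst (symbol_comp c d y z) = (E @ D) \<rhd> ((b # B) \<rhd> L + M')"
      by (intro 1(1) comp_glueI[of _ "[]" c E "(b # B) \<rhd> L" _ "[]" d D M'])
        (simp_all add: B D E add_mset_commute)
    have e2: "fst (symbol_comp a b x (symbol_comp c d y z)) =
        (A @ B) \<rhd> (M + (E @ D) \<rhd> (L + M'))"
      by (intro 1(2) comp_glueI[of _ "[]" a A M _ "[]" b B "(E @ D) \<rhd> (L + M')"])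
        (simp_all add: A e1 add_mset_commute)
    have e3: "fst (symbol_comp a b x y) = (A @ B) \<rhd> (M + (c # E) \<rhd> L)"
      by (intro 2(1) comp_glueI[of _ "[]" a A M _ "[]" b B "(c # E) \<rhd> L"])
        (simp_all add: A B E)
    have e4: "fst (symbol_comp c d (symbol_comp a b x y) z) =
        (E @ D) \<rhd> ((A @ B) \<rhd> (M + L) + M')"
      by (intro 2(2) comp_glueI[of _ "[]" c E "(A @ B) \<rhd> (M + L)" _ "[]" d D M'])
        (simp_all add: D e3 add_mset_commute)
    show ?thesis by (simp add: e2 e4 ac_simps add_mset_commute)
  qed
  then show ?thesis using 1(3) 2(3) by (intro QO_symbols_eqI) (auto simp: ac_simps)
qed

section \<open>The modular operad of symbols\<close>

lemma QO_set_simps: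
  "mob (QO_set :: ('c, 'k, 'c symbol) modop) C G = Set_obj (QO_symbols C G)"
  "mact (QO_set :: ('c, 'k, 'c symbol) modop) C G \<rho> i x = relabel \<rho> x"
  "mcomp (QO_set :: ('c, 'k, 'c symbol) modop) a b C1 G1 C2 G2 i j x y = symbol_comp a b x y"
  "mcontr (QO_set :: ('c, 'k, 'c symbol) modop) a b C G i x = symbol_contr a b x"
  by (simp_all add: QO_set_def)

lemma elems_Set_obj: "x \<in> elems (Set_obj A) i \<longleftrightarrow> i = 0 \<and> x \<in> A"
  by simp

theorem modular_operad_QO_set:
  assumes inf: "infinite (UNIV :: 'c set)"
  shows "modular_operad Sets K (QO_set :: ('c, 'k, 'c symbol) modop)"
proof (unfold_locales, unfold QO_set_simps elems_Set_obj, goal_cases)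
  case 1 then show ?case by simp
next
  case 2 then show ?case by (blast intro: relabel_cong)
next
  case 3 then show ?case by (simp add: QO_set_def relabel_mem)
next
  case 4 then show ?case by (simp add: QO_set_def symbol_comp_glue(1))
next
  case 5 then show ?case using symbol_contr_glue(1) by (auto simp: QO_set_def)
next
  case 6 then show ?case by (blast intro: symbol_contr_sym)
next
  case 7 then show ?case unfolding koszul.simps by (elim conjE) (erule (2) symbol_comp_sym)
next
  case 8 then show ?case by simp
next
  case 9 then show ?case by (simp only: relabel_comp)
next
  case (10 a b C1 C2 \<rho> \<sigma> x G1 i y G2 j)
  from 10(5,6) show ?case by (elim conjE) (rule relabel_symbol_comp[OF 10(1-4)])
next
  case 11 then show ?case by (elim conjE) (erule (2) relabel_contr)
next
  case 12 from 12(5) show ?case by (elim conjE) (rule symbol_contr_contr[OF 12(1-4)])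
next
  case 13 from 13(5,6) show ?case by (elim conjE) (rule symbol_contr_comp_exchange[OF inf 13(1-4)])
next
  case 14 from 14(5,6) show ?case by (elim conjE) (rule symbol_comp_contr[OF inf 14(1-4)])
next
  case 15 from 15(5,6,7) show ?case by (elim conjE) (rule symbol_comp_assoc[OF 15(1-4)])
qed

section \<open>Morphisms\<close>

lemma base_hom_elems: "base_hom K X Y \<phi> \<Longrightarrow> x \<in> elems X i \<Longrightarrow> \<phi> i x \<in> elems Y i"
  by (cases "(K, X, Y, \<phi>)" rule: base_hom.cases) (auto simp: K_linear_def split: if_splits)

lemma cyclic_morphismD:
  assumes "cyclic_morphism K A B f"
  shows "finite C \<Longrightarrow> base_hom K (cob A C) (cob B C) (f C)"
    and "\<lbrakk>finite C; inj_on \<rho> C; x \<in> elems (cob A C) i\<rbrakk>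
      \<Longrightarrow> f (\<rho> ` C) i (cact A C \<rho> i x) = cact B C \<rho> i (f C i x)"
    and "\<lbrakk>comp_ok a b C1 C2; x \<in> elems (cob A (C1 \<union> {a})) i; y \<in> elems (cob A (C2 \<union> {b})) j\<rbrakk>
      \<Longrightarrow> f (C1 \<union> C2) (i + j) (ccomp A a b C1 C2 i j x y) =
        ccomp B a b C1 C2 i j (f (C1 \<union> {a}) i x) (f (C2 \<union> {b}) j y)"
proof -
  note m = assms[unfolded cyclic_morphism_def]
  show "finite C \<Longrightarrow> base_hom K (cob A C) (cob B C) (f C)"
    using m[THEN conjunct1, rule_format] .
  show "\<lbrakk>finite C; inj_on \<rho> C; x \<in> elems (cob A C) i\<rbrakk>
      \<Longrightarrow> f (\<rho> ` C) i (cact A C \<rho> i x) = cact B C \<rho> i (f C i x)"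
    using m[THEN conjunct2, THEN conjunct1, rule_format] .
  show "\<lbrakk>comp_ok a b C1 C2; x \<in> elems (cob A (C1 \<union> {a})) i; y \<in> elems (cob A (C2 \<union> {b})) j\<rbrakk>
      \<Longrightarrow> f (C1 \<union> C2) (i + j) (ccomp A a b C1 C2 i j x y) =
        ccomp B a b C1 C2 i j (f (C1 \<union> {a}) i x) (f (C2 \<union> {b}) j y)"
    using m[THEN conjunct2, THEN conjunct2, rule_format] .
qed

lemma modular_morphismD:
  assumes "modular_morphism K P Q \<phi>"
  shows "finite C \<Longrightarrow> base_hom K (mob P C G) (mob Q C G) (\<phi> C G)"
    and "\<lbrakk>finite C; inj_on \<rho> C; x \<in> elems (mob P C G) i\<rbrakk>
      \<Longrightarrow> \<phi> (\<rho> ` C) G i (mact P C G \<rho> i x) = mact Q C G \<rho> i (\<phi> C G i x)"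
    and "\<lbrakk>comp_ok a b C1 C2; x \<in> elems (mob P (C1 \<union> {a}) G1) i; y \<in> elems (mob P (C2 \<union> {b}) G2) j\<rbrakk>
      \<Longrightarrow> \<phi> (C1 \<union> C2) (G1 + G2) (i + j) (mcomp P a b C1 G1 C2 G2 i j x y) =
        mcomp Q a b C1 G1 C2 G2 i j (\<phi> (C1 \<union> {a}) G1 i x) (\<phi> (C2 \<union> {b}) G2 j y)"
    and "\<lbrakk>contr_ok a b C; x \<in> elems (mob P (C \<union> {a, b}) G) i\<rbrakk>
      \<Longrightarrow> \<phi> C (G + 1) i (mcontr P a b C G i x) = mcontr Q a b C G i (\<phi> (C \<union> {a, b}) G i x)"
proof -
  note m = assms[unfolded modular_morphism_def]
  show "finite C \<Longrightarrow> base_hom K (mob P C G) (mob Q C G) (\<phi> C G)"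
    using m[THEN conjunct1, rule_format] .
  show "\<lbrakk>finite C; inj_on \<rho> C; x \<in> elems (mob P C G) i\<rbrakk>
      \<Longrightarrow> \<phi> (\<rho> ` C) G i (mact P C G \<rho> i x) = mact Q C G \<rho> i (\<phi> C G i x)"
    using m[THEN conjunct2, THEN conjunct1, rule_format] .
  show "\<lbrakk>comp_ok a b C1 C2; x \<in> elems (mob P (C1 \<union> {a}) G1) i; y \<in> elems (mob P (C2 \<union> {b}) G2) j\<rbrakk>
      \<Longrightarrow> \<phi> (C1 \<union> C2) (G1 + G2) (i + j) (mcomp P a b C1 G1 C2 G2 i j x y) =
        mcomp Q a b C1 G1 C2 G2 i j (\<phi> (C1 \<union> {a}) G1 i x) (\<phi> (C2 \<union> {b}) G2 j y)"
    using m[THEN conjunct2, THEN conjunct2, THEN conjunct1, rule_format] .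
  show "\<lbrakk>contr_ok a b C; x \<in> elems (mob P (C \<union> {a, b}) G) i\<rbrakk>
      \<Longrightarrow> \<phi> C (G + 1) i (mcontr P a b C G i x) = mcontr Q a b C G i (\<phi> (C \<union> {a, b}) G i x)"
    using m[THEN conjunct2, THEN conjunct2, THEN conjunct2, rule_format] .
qed

lemma Ass_set_simps:
  "cob (Ass_set :: ('c, 'k, 'c symbol) cycop) C = Set_obj (QO_symbols C 0)"
  "cact (Ass_set :: ('c, 'k, 'c symbol) cycop) C \<rho> i x = relabel \<rho> x"
  "ccomp (Ass_set :: ('c, 'k, 'c symbol) cycop) a b C1 C2 i j x y = symbol_comp a b x y"
  by (simp_all add: Ass_set_def cyclic_part_def QO_set_def)

lemma cyclic_part_simps:
  "cob (cyclic_part P) C = mob P C 0"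
  "cact (cyclic_part P) C = mact P C 0"
  "ccomp (cyclic_part P) a b C1 C2 = mcomp P a b C1 0 C2 0"
  by (simp_all add: cyclic_part_def)

lemma QO_symbols_finite: "s \<in> QO_symbols C G \<Longrightarrow> finite C"
  using cycle_family_finite by (auto simp: QO_symbols_iff)

section \<open>Extending a morphism along contractions\<close>

text \<open>
  Every surface with G > 0 is obtained by gluing two boundary points: if there are two boundary
  circles, cut along an arc that joins them; if there is only one, the genus is positive, and an arc
  that starts and ends on this circle can be chosen so that cutting lowers the genus.
\<close>

lemma symbol_contr_lift:
  assumes u: "u \<in> QO_symbols C (Suc G)" and ok: "contr_ok a b C"
  obtains s where "s \<in> QO_symbols (C \<union> {a, b}) G" "symbol_contr a b s = u"
proof -
  have N: "cycle_family C (fst u)" "fst u \<noteq> {#}" "2 * snd u + (size (fst u) - 1) = Suc G"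
    using u by (auto simp: QO_symbols_iff)
  obtain A M where A: "fst u = A \<rhd> M" using cycle_family_nonempty[OF N(1,2)] .
  show ?thesis
  proof (cases "M = {#}")
    case False
    have M: "cycle_family (C - set A) M" using N(1) A by simp
    obtain B M' where B: "M = B \<rhd> M'" using cycle_family_nonempty[OF M False] .
    define s where "s = ((a # A @ b # B) \<rhd> M', snd u)"
    have D: "cycle_family (C - set A - set B) M'" using M B by simp
    moreover have "C \<union> {a, b} - set (a # A @ b # B) = C - set A - set B"
      using N(1) ok by (auto simp: A B contr_ok_def)
    ultimately have s: "s \<in> QO_symbols (C \<union> {a, b}) G"
      using N A B ok by (auto simp: s_def QO_symbols_iff contr_ok_def)
    have "glue a b (fst s) (fst u)" by (simp add: s_def A B glue.split)
    then have "symbol_contr a b s = u" using u by (intro symbol_contr_eqI[OF s ok]) auto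
    with s show ?thesis by (rule that)
  next
    case True
    \<comment> \<open>The genus is positive here; the single cycle is cut into itself and an empty word.\<close>
    define s where "s = ({#cyc (a # A), cyc [b]#}, snd u - 1)"
    have s: "s \<in> QO_symbols (C \<union> {a, b}) G"
      using N A True ok by (auto simp: s_def QO_symbols_iff contr_ok_def)
    have "glue a b (fst s) (fst u)" using glue.join[of a b A "[]" "{#}"] by (simp add: s_def A True)
    then have "symbol_contr a b s = u" using u by (intro symbol_contr_eqI[OF s ok]) auto
    with s show ?thesis by (rule that)
  qed
qed

locale ass_morphism = modular_operad Sets K P
  for K :: "'k ring" and P :: "('c, 'k, 'v) modop" +
  fixes f :: "'c set \<Rightarrow> int \<Rightarrow> 'c symbol \<Rightarrow> 'v"
  assumes inf: "infinite (UNIV :: 'c set)"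
    and f: "cyclic_morphism K Ass_set (cyclic_part P) f"
begin

abbreviation points :: "'c set \<Rightarrow> nat \<Rightarrow> 'v set" where
  "points C G \<equiv> elems (mob P C G) 0"

lemma contr_mem:
  "\<lbrakk>contr_ok a b C; x \<in> points (C \<union> {a, b}) G\<rbrakk> \<Longrightarrow> mcontr P a b C G 0 x \<in> points C (Suc G)"
  using base_hom_elems[OF contr_hom] by fastforce

lemma f_mem: "s \<in> QO_symbols C 0 \<Longrightarrow> f C 0 s \<in> points C 0"
  using base_hom_elems[OF cyclic_morphismD(1)[OF f], of C s 0] QO_symbols_finite[of s C 0]
  by (simp add: Ass_set_simps cyclic_part_simps)

lemma f_act:
  "\<lbrakk>s \<in> QO_symbols C 0; inj_on \<rho> C\<rbrakk> \<Longrightarrow> f (\<rho> ` C) 0 (relabel \<rho> s) = mact P C 0 \<rho> 0 (f C 0 s)"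
  using cyclic_morphismD(2)[OF f, of C \<rho> s 0] QO_symbols_finite[of s C 0]
  by (simp add: Ass_set_simps cyclic_part_simps)

lemma f_comp:
  "\<lbrakk>comp_ok a b C1 C2; s \<in> QO_symbols (C1 \<union> {a}) 0; t \<in> QO_symbols (C2 \<union> {b}) 0\<rbrakk>
    \<Longrightarrow> f (C1 \<union> C2) 0 (symbol_comp a b s t) =
      mcomp P a b C1 0 C2 0 0 0 (f (C1 \<union> {a}) 0 s) (f (C2 \<union> {b}) 0 t)"
  using cyclic_morphismD(3)[OF f, of a b C1 C2 s 0 t 0] by (simp add: Ass_set_simps cyclic_part_simps)

text \<open>
  Since a morphism has to commute with contractions, its value at a symbol is forced by its value at
  any lift of that symbol.  The recursion uses an arbitrary lift; that the choice is immaterial is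
  the property \<open>lifts_agree_at\<close> below.
\<close>

primrec extension :: "nat \<Rightarrow> 'c set \<Rightarrow> 'c symbol \<Rightarrow> 'v" where
  "extension 0 C u = f C 0 u"
| "extension (Suc G) C u =
     (let (a, b, s) = (SOME (a, b, s). contr_ok a b C \<and> s \<in> QO_symbols (C \<union> {a, b}) G \<and> symbol_contr a b s = u)
      in mcontr P a b C G 0 (extension G (C \<union> {a, b}) s))"

definition lift_value :: "nat \<Rightarrow> 'c \<Rightarrow> 'c \<Rightarrow> 'c set \<Rightarrow> 'c symbol \<Rightarrow> 'v" where
  "lift_value G a b C s = mcontr P a b C G 0 (extension G (C \<union> {a, b}) s)"

definition equivariant_at :: "nat \<Rightarrow> bool" where
  "equivariant_at G \<longleftrightarrow>
     (\<forall>C. \<forall>s\<in>QO_symbols C G. extension G C s \<in> points C G \<and>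
        (\<forall>\<rho>. inj_on \<rho> C \<longrightarrow> extension G (\<rho> ` C) (relabel \<rho> s) = mact P C G \<rho> 0 (extension G C s)))"

definition lifts_agree_at :: "nat \<Rightarrow> bool" where
  "lifts_agree_at G \<longleftrightarrow>
     (\<forall>a b C c d s t. contr_ok a b C \<longrightarrow> contr_ok c d C \<longrightarrow>
        s \<in> QO_symbols (C \<union> {a, b}) G \<longrightarrow> t \<in> QO_symbols (C \<union> {c, d}) G \<longrightarrow>
        symbol_contr a b s = symbol_contr c d t \<longrightarrow> lift_value G a b C s = lift_value G c d C t)"

lemma equivariant_at_0: "equivariant_at 0"
  unfolding equivariant_at_def using f_mem f_act by simp

lemma fresh_pair:
  assumes "finite (C :: 'c set)"
  obtains a b where "a \<notin> C" "b \<notin> C" "a \<noteq> b"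
proof -
  from ex_new_if_finite[OF inf assms] obtain a where a: "a \<notin> C" ..
  have "finite (insert a C)" using assms by simp
  from ex_new_if_finite[OF inf this] obtain b where b: "b \<notin> insert a C" ..
  show ?thesis by (rule that[of a b]) (use a b in auto)
qed

lemma extension_contr:
  assumes agree: "lifts_agree_at G" and ok: "contr_ok a b C" and s: "s \<in> QO_symbols (C \<union> {a, b}) G"
  shows "extension (Suc G) C (symbol_contr a b s) = lift_value G a b C s"
proof -
  let ?R = "\<lambda>(c, d, t). contr_ok c d C \<and> t \<in> QO_symbols (C \<union> {c, d}) G \<and> symbol_contr c d t = symbol_contr a b s"
  obtain c d t where cd: "(SOME x. ?R x) = (c, d, t)" by (rule prod_cases3)
  have "?R (a, b, s)" using ok s by simp
  then have "?R (SOME x. ?R x)" by (rule someI)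
  then have R: "contr_ok c d C" "t \<in> QO_symbols (C \<union> {c, d}) G" "symbol_contr c d t = symbol_contr a b s"
    unfolding cd by simp_all
  have "extension (Suc G) C (symbol_contr a b s) = lift_value G c d C t"
    unfolding extension.simps cd by (simp add: lift_value_def)
  also have "\<dots> = lift_value G a b C s" using agree R ok s unfolding lifts_agree_at_def by blast
  finally show ?thesis .
qed

text \<open>
  A bijection out of C is extended to a lift by sending the two extra labels to fresh ones; a
  relabelled lift is a lift of the relabelled symbol.
\<close>

lemma equivariant_at_Suc:
  assumes G: "equivariant_at G" and agree: "lifts_agree_at G"
  shows "equivariant_at (Suc G)"
  unfolding equivariant_at_def
proof (intro allI ballI conjI impI)
  fix C :: "'c set" and u assume u: "u \<in> QO_symbols C (Suc G)"
  note fin = QO_symbols_finite[OF u]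
  obtain a b where "a \<notin> C" "b \<notin> C" "a \<noteq> b" using fresh_pair[OF fin] .
  then have ok: "contr_ok a b C" using fin by (simp add: contr_ok_def)
  obtain s where s: "s \<in> QO_symbols (C \<union> {a, b}) G" "symbol_contr a b s = u"
    using symbol_contr_lift[OF u ok] .
  let ?x = "extension G (C \<union> {a, b}) s"
  have x: "?x \<in> points (C \<union> {a, b}) G" using G s unfolding equivariant_at_def by blast
  have e: "extension (Suc G) C u = mcontr P a b C G 0 ?x"
    using extension_contr[OF agree ok s(1)] s(2) by (simp add: lift_value_def)
  then show "extension (Suc G) C u \<in> points C (Suc G)" using contr_mem[OF ok x] by simp
  fix \<rho> :: "'c \<Rightarrow> 'c" assume \<rho>: "inj_on \<rho> C"
  obtain a' b' where ab': "a' \<notin> \<rho> ` C" "b' \<notin> \<rho> ` C" "a' \<noteq> b'"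
    using fresh_pair[OF finite_imageI[OF fin]] .
  let ?\<sigma> = "\<rho>(a := a', b := b')"
  have \<sigma>: "?\<sigma> c = \<rho> c" if "c \<in> C" for c using that ok by (auto simp: contr_ok_def)
  then have im: "?\<sigma> ` C = \<rho> ` C" by (simp cong: image_cong)
  have ab: "?\<sigma> a = a'" "?\<sigma> b = b'" using ok by (auto simp: contr_ok_def)
  have "inj_on ?\<sigma> C" using \<rho> inj_on_cong[of C ?\<sigma> \<rho>, OF \<sigma>] by simp
  then have inj: "inj_on ?\<sigma> (C \<union> {a, b})" using ab ab' im ok
    by (auto simp: contr_ok_def simp del: fun_upd_apply)
  have im2: "?\<sigma> ` (C \<union> {a, b}) = \<rho> ` C \<union> {a', b'}"
    unfolding image_Un im using ab by (auto simp del: fun_upd_apply)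
  have ok': "contr_ok a' b' (\<rho> ` C)" using ab' fin by (simp add: contr_ok_def)
  have s': "relabel ?\<sigma> s \<in> QO_symbols (\<rho> ` C \<union> {a', b'}) G"
    using relabel_mem[OF s(1) inj] unfolding im2 .
  have "relabel \<rho> u = relabel ?\<sigma> u" using relabel_cong[OF u, of ?\<sigma> \<rho>] \<sigma> by auto
  also have "\<dots> = symbol_contr a' b' (relabel ?\<sigma> s)"
    using relabel_contr[OF ok inj s(1)] s(2) unfolding ab by simp
  finally have "extension (Suc G) (\<rho> ` C) (relabel \<rho> u) =
      mcontr P a' b' (\<rho> ` C) G 0 (extension G (\<rho> ` C \<union> {a', b'}) (relabel ?\<sigma> s))"
    using extension_contr[OF agree ok' s'] by (simp add: lift_value_def)
  also have "extension G (\<rho> ` C \<union> {a', b'}) (relabel ?\<sigma> s) = mact P (C \<union> {a, b}) G ?\<sigma> 0 ?x"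
    using G s(1) inj unfolding equivariant_at_def im2[symmetric] by blast
  also have "mcontr P a' b' (\<rho> ` C) G 0 \<dots> = mact P C (G + 1) ?\<sigma> 0 (mcontr P a b C G 0 ?x)"
    using contr_act[OF ok inj x] unfolding ab im by simp
  also have "\<dots> = mact P C (Suc G) \<rho> 0 (extension (Suc G) C u)"
    using act_cong[OF fin \<open>inj_on ?\<sigma> C\<close> \<sigma> contr_mem[OF ok x]]
    unfolding e Suc_eq_plus1[symmetric] .
  finally show "extension (Suc G) (\<rho> ` C) (relabel \<rho> u) = mact P C (Suc G) \<rho> 0 (extension (Suc G) C u)" .
qed

text \<open>
  The extra labels of a lift can be renamed without changing its value.  This allows two lifts to
  be compared under the assumption that they use the same labels, or disjoint ones.
\<close>

lemma lift_value_rename: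
  assumes G: "equivariant_at G" and ok: "contr_ok a b C" "contr_ok c d C"
    and s: "s \<in> QO_symbols (C \<union> {a, b}) G"
  shows "lift_value G a b C s = lift_value G c d C (relabel (id(a := c, b := d)) s)"
    and "relabel (id(a := c, b := d)) s \<in> QO_symbols (C \<union> {c, d}) G"
    and "symbol_contr c d (relabel (id(a := c, b := d)) s) = symbol_contr a b s"
proof -
  let ?\<sigma> = "id(a := c, b := d)" and ?x = "extension G (C \<union> {a, b}) s"
  have fin: "finite C" using ok by (simp add: contr_ok_def)
  have \<sigma>: "?\<sigma> c = c" if "c \<in> C" for c using that ok by (auto simp: contr_ok_def)
  have im: "?\<sigma> ` C = C" using \<sigma> by (simp cong: image_cong)
  have ab: "?\<sigma> a = c" "?\<sigma> b = d" using ok by (auto simp: contr_ok_def)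
  have "inj_on ?\<sigma> C" using \<sigma> by (simp add: inj_on_def)
  then have inj: "inj_on ?\<sigma> (C \<union> {a, b})" using ab im ok
    by (auto simp: contr_ok_def simp del: fun_upd_apply)
  have im2: "?\<sigma> ` (C \<union> {a, b}) = C \<union> {c, d}"
    unfolding image_Un im using ab by (auto simp del: fun_upd_apply)
  show s': "relabel ?\<sigma> s \<in> QO_symbols (C \<union> {c, d}) G" using relabel_mem[OF s inj] unfolding im2 .
  have "relabel ?\<sigma> (symbol_contr a b s) = symbol_contr c d (relabel ?\<sigma> s)"
    using relabel_contr[OF ok(1) inj s] unfolding ab .
  moreover have "relabel ?\<sigma> (symbol_contr a b s) = symbol_contr a b s"
    by (rule trans[OF relabel_cong[OF symbol_contr_glue(1)[OF s ok(1)]] relabel_id(1)])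
      (auto simp: \<sigma> simp del: fun_upd_apply)
  ultimately show "symbol_contr c d (relabel ?\<sigma> s) = symbol_contr a b s" by simp
  have x: "?x \<in> points (C \<union> {a, b}) G" using G s unfolding equivariant_at_def by blast
  have "extension G (C \<union> {c, d}) (relabel ?\<sigma> s) = mact P (C \<union> {a, b}) G ?\<sigma> 0 ?x"
    using G s inj unfolding equivariant_at_def im2[symmetric] by blast
  then have "lift_value G c d C (relabel ?\<sigma> s) = mact P C (G + 1) ?\<sigma> 0 (mcontr P a b C G 0 ?x)"
    using contr_act[OF ok(1) inj x] unfolding ab im by (simp add: lift_value_def)
  also have "\<dots> = mact P C (G + 1) id 0 (mcontr P a b C G 0 ?x)"
    using contr_mem[OF ok(1) x] \<open>inj_on ?\<sigma> C\<close> by (intro act_cong[OF fin]) (auto simp: \<sigma> simp del: fun_upd_apply)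
  also have "\<dots> = lift_value G a b C s" using act_id[OF fin] contr_mem[OF ok(1) x] by (simp add: lift_value_def)
  finally show "lift_value G a b C s = lift_value G c d C (relabel ?\<sigma> s)" by simp
qed

end

section \<open>Values of lifts\<close>

lemma cycle_family_addI:
  assumes "cycle_family D M" "distinct A" "set A \<inter> D = {}" "C = set A \<union> D"
  shows "cycle_family C (A \<rhd> M)"
proof -
  have "C - set A = D" using assms(3,4) by auto
  with assms show ?thesis by simp
qed

lemma relabel_family_id:
  assumes "cycle_family D M" "\<And>c. c \<in> D \<Longrightarrow> \<rho> c = c"
  shows "relabel_family \<rho> M = M"
proof -
  have "relabel_family \<rho> M = relabel_family id M" using assms by (intro relabel_family_cong) auto
  then show ?thesis by simp
qed

text \<open>
  The situation in which the lifts of a symbol over C are compared.  The labels r and t next to p and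
  q make room for common lifts of a lift along (p, q) and a lift along (r, t); everything is already
  known to be well defined for such common lifts, whose index is one below G.
\<close>

locale lifting = ass_morphism K P f
  for K :: "'k ring" and P :: "('c, 'k, 'v) modop" and f +
  fixes C :: "'c set" and p q r t :: 'c and G :: nat
  assumes fin: "finite C" and labels: "distinct [p, q, r, t]" "{p, q, r, t} \<inter> C = {}"
    and equiv: "equivariant_at G"
    and below: "\<And>G'. G = Suc G' \<Longrightarrow> equivariant_at G' \<and> lifts_agree_at G'"
begin

text \<open>
  A lift arises from a symbol either by merging two of its cycles U and V into one, or by cutting one
  of its cycles into A and B and lowering the genus.
\<close>

abbreviation merged :: "'c \<Rightarrow> 'c \<Rightarrow> 'c list \<Rightarrow> 'c list \<Rightarrow> 'c list set multiset \<Rightarrow> nat \<Rightarrow> 'c symbol" where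
  "merged a b U V M g \<equiv> ((a # U @ b # V) \<rhd> M, g)"

abbreviation cut :: "'c \<Rightarrow> 'c \<Rightarrow> 'c list \<Rightarrow> 'c list \<Rightarrow> 'c list set multiset \<Rightarrow> nat \<Rightarrow> 'c symbol" where
  "cut a b A B M g \<equiv> ((a # A) \<rhd> (b # B) \<rhd> M, g)"

lemma ok_pq: "contr_ok p q C" and ok_qp: "contr_ok q p C" and ok_rt: "contr_ok r t C"
  using labels fin by (auto simp: contr_ok_def)

lemma merged_mem:
  assumes ok: "contr_ok a b C" and N: "cycle_family C (U \<rhd> V \<rhd> M)"
    and G: "2 * g + size M = G"
  shows "merged a b U V M g \<in> QO_symbols (C \<union> {a, b}) G"
proof -
  have "cycle_family (C - set U - set V) M" using N by simp
  then have "cycle_family (C \<union> {a, b}) ((a # U @ b # V) \<rhd> M)"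
    by (rule cycle_family_addI) (use N ok in \<open>auto simp: contr_ok_def\<close>)
  then show ?thesis using G by (simp add: QO_symbols_iff)
qed

lemma cut_mem:
  assumes ok: "contr_ok a b C" and N: "cycle_family C ((A @ B) \<rhd> M)"
    and G: "2 * g + size M + 1 = G"
  shows "cut a b A B M g \<in> QO_symbols (C \<union> {a, b}) G"
proof -
  have "cycle_family (C - set (A @ B)) M" using N by simp
  then have "cycle_family (C \<union> {b} - set A) ((b # B) \<rhd> M)"
    by (rule cycle_family_addI) (use N ok in \<open>auto simp: contr_ok_def\<close>)
  then have "cycle_family (C \<union> {a, b}) ((a # A) \<rhd> (b # B) \<rhd> M)"
    by (rule cycle_family_addI) (use N ok in \<open>auto simp: contr_ok_def\<close>)
  then show ?thesis using G by (simp add: QO_symbols_iff)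
qed

lemma merged_rename:
  assumes ok: "contr_ok a b C" "contr_ok c d C" and N: "cycle_family C (U \<rhd> V \<rhd> M)"
    and G: "2 * g + size M = G"
  shows "lift_value G a b C (merged a b U V M g) = lift_value G c d C (merged c d U V M g)"
proof -
  let ?\<sigma> = "id(a := c, b := d)"
  have id: "?\<sigma> x = x" if "x \<in> C" for x using that ok(1) by (auto simp: contr_ok_def)
  have M: "relabel_family ?\<sigma> M = M" using N id by (intro relabel_family_id[of "C - set U - set V"]) auto
  have UV: "set U \<subseteq> C" "set V \<subseteq> C" using N by auto
  have "map ?\<sigma> U = U" "map ?\<sigma> V = V" using UV id by (auto intro!: map_idI simp del: fun_upd_apply)
  moreover have "?\<sigma> a = c" "?\<sigma> b = d" using ok(1) by (auto simp: contr_ok_def)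
  ultimately have "relabel ?\<sigma> (merged a b U V M g) = merged c d U V M g"
    using M by (simp add: relabel_def image_map_cyc del: fun_upd_apply)
  then show ?thesis using lift_value_rename(1)[OF equiv ok merged_mem[OF ok(1) N G]] by simp
qed

lemma cut_rename:
  assumes ok: "contr_ok a b C" "contr_ok c d C" and N: "cycle_family C ((A @ B) \<rhd> M)"
    and G: "2 * g + size M + 1 = G"
  shows "lift_value G a b C (cut a b A B M g) = lift_value G c d C (cut c d A B M g)"
proof -
  let ?\<sigma> = "id(a := c, b := d)"
  have id: "?\<sigma> x = x" if "x \<in> C" for x using that ok(1) by (auto simp: contr_ok_def)
  have M: "relabel_family ?\<sigma> M = M" using N id by (intro relabel_family_id[of "C - set (A @ B)"]) auto
  have UV: "set A \<subseteq> C" "set B \<subseteq> C" using N by auto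
  have "map ?\<sigma> A = A" "map ?\<sigma> B = B" using UV id by (auto intro!: map_idI simp del: fun_upd_apply)
  moreover have "?\<sigma> a = c" "?\<sigma> b = d" using ok(1) by (auto simp: contr_ok_def)
  ultimately have "relabel ?\<sigma> (cut a b A B M g) = cut c d A B M g"
    using M by (simp add: relabel_def image_map_cyc del: fun_upd_apply)
  then show ?thesis using lift_value_rename(1)[OF equiv ok cut_mem[OF ok(1) N G]] by simp
qed

lemma lift_value_sym:
  assumes "contr_ok a b C" "s \<in> QO_symbols (C \<union> {a, b}) G"
  shows "lift_value G a b C s = lift_value G b a C s"
proof -
  have "extension G (C \<union> {a, b}) s \<in> points (C \<union> {a, b}) G"
    using equiv assms(2) unfolding equivariant_at_def by blast
  from contr_sym[OF assms(1) this] show ?thesis by (simp add: lift_value_def insert_commute)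
qed

definition merged_value :: "nat \<Rightarrow> 'c list \<Rightarrow> 'c list \<Rightarrow> 'c list set multiset \<Rightarrow> 'v" where
  "merged_value g U V M = lift_value G p q C (merged p q U V M g)"

definition cut_value :: "nat \<Rightarrow> 'c list \<Rightarrow> 'c list \<Rightarrow> 'c list set multiset \<Rightarrow> 'v" where
  "cut_value g A B M = lift_value G p q C (cut p q A B M g)"

lemma merged_value_sym:
  assumes N: "cycle_family C (U \<rhd> V \<rhd> M)" and G: "2 * g + size M = G"
  shows "merged_value g U V M = merged_value g V U M"
proof -
  have N': "cycle_family C (V \<rhd> U \<rhd> M)" using N by (simp only: add_mset_commute)
  have "merged_value g U V M = lift_value G q p C (merged p q U V M g)"
    unfolding merged_value_def using lift_value_sym[OF ok_pq merged_mem[OF ok_pq N G]] .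
  also have "merged p q U V M g = merged q p V U M g" using cyc_shift[of p U q V] by simp
  also have "lift_value G q p C \<dots> = merged_value g V U M"
    unfolding merged_value_def using merged_rename[OF ok_qp ok_pq N' G] .
  finally show ?thesis .
qed

lemma cut_value_sym:
  assumes N: "cycle_family C ((A @ B) \<rhd> M)" and G: "2 * g + size M + 1 = G"
  shows "cut_value g A B M = cut_value g B A M"
proof -
  have N': "cycle_family C ((B @ A) \<rhd> M)" using N cyc_append_commute[of A B] by simp
  have "cut_value g A B M = lift_value G q p C (cut p q A B M g)"
    unfolding cut_value_def using lift_value_sym[OF ok_pq cut_mem[OF ok_pq N G]] .
  also have "cut p q A B M g = cut q p B A M g" by (simp add: add_mset_commute)
  also have "lift_value G q p C \<dots> = cut_value g B A M"
    unfolding cut_value_def using cut_rename[OF ok_qp ok_pq N' G] .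
  finally show ?thesis .
qed

text \<open>
  The mechanism behind all comparisons: two lifts along disjoint pairs of labels have the same value
  if they have a common lift T, because contractions commute in P.
\<close>

lemma diamond:
  assumes G: "G = Suc G'" and T: "T \<in> QO_symbols (C \<union> {p, q, r, t}) G'"
    and s: "s \<in> QO_symbols (C \<union> {p, q}) G" "glue r t (fst T) (fst s)"
    and s': "s' \<in> QO_symbols (C \<union> {r, t}) G" "glue p q (fst T) (fst s')"
  shows "lift_value G p q C s = lift_value G r t C s'"
proof -
  from below[OF G] have equiv': "equivariant_at G'" and agree': "lifts_agree_at G'" by simp_all
  have ok: "contr_ok r t (C \<union> {p, q})" "contr_ok p q (C \<union> {r, t})"
    using labels fin by (auto simp: contr_ok_def)
  have T1: "T \<in> QO_symbols (C \<union> {p, q} \<union> {r, t}) G'" and T2: "T \<in> QO_symbols (C \<union> {r, t} \<union> {p, q}) G'"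
    using T by (simp_all add: insert_commute)
  have "symbol_contr r t T = s" using s G by (intro symbol_contr_eqI[OF T1 ok(1)]) auto
  with extension_contr[OF agree' ok(1) T1]
  have e1: "extension G (C \<union> {p, q}) s = mcontr P r t (C \<union> {p, q}) G' 0 (extension G' (C \<union> {p, q, r, t}) T)"
    unfolding G lift_value_def by (simp add: insert_commute)
  have "symbol_contr p q T = s'" using s' G by (intro symbol_contr_eqI[OF T2 ok(2)]) auto
  with extension_contr[OF agree' ok(2) T2]
  have e2: "extension G (C \<union> {r, t}) s' = mcontr P p q (C \<union> {r, t}) G' 0 (extension G' (C \<union> {p, q, r, t}) T)"
    unfolding G lift_value_def by (simp add: insert_commute)
  have "extension G' (C \<union> {p, q, r, t}) T \<in> points (C \<union> {p, q, r, t}) G'"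
    using equiv' T unfolding equivariant_at_def by blast
  from contr_contr[OF ok(1) ok_pq ok(2) ok_rt this] show ?thesis
    unfolding lift_value_def e1 e2 by (simp add: G)
qed

lemma four_label_symbol:
  assumes "cycle_family D M" "distinct A" "set A \<inter> D = {}" "set A \<union> D = C \<union> {p, q, r, t}"
    and "2 * g + size M = G'"
  shows "(A \<rhd> M, g) \<in> QO_symbols (C \<union> {p, q, r, t}) G'"
  using cycle_family_addI[OF assms(1-3) assms(4)[symmetric]] assms(5) by (simp add: QO_symbols_iff)

text \<open>
  In the common lift the word W stands between t and r, and V between q and p.  Gluing t to r splits
  off W and leaves U1 and U2 merged with V; gluing p to q splits off V and leaves U2 and U1 merged with
  W.  So a third cycle lets one move from one pair of merged cycles to another.
\<close>

lemma merged_value_exchange: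
  assumes N: "cycle_family C ((U1 @ U2) \<rhd> V \<rhd> W \<rhd> M)"
    and G: "2 * g + size M + 1 = G"
  shows "merged_value g (U1 @ U2) V (W \<rhd> M) = merged_value g (U2 @ U1) W (V \<rhd> M)"
proof -
  let ?T = "((p # U1 @ t # W @ r # U2 @ q # V) \<rhd> M, g)"
  let ?D = "C - set (U1 @ U2) - set V - set W"
  have D: "cycle_family ?D M" using N by simp
  have T: "?T \<in> QO_symbols (C \<union> {p, q, r, t}) (2 * g + size M)"
    by (rule four_label_symbol[OF D]) (use N labels in auto)
  have N': "cycle_family C ((U2 @ U1) \<rhd> W \<rhd> V \<rhd> M)"
    using N cyc_append_commute[of U1 U2] by (simp only: add_mset_commute)
  have s: "merged p q (U1 @ U2) V (W \<rhd> M) g \<in> QO_symbols (C \<union> {p, q}) G"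
    using N G by (intro merged_mem[OF ok_pq]) (simp_all only: add_mset_commute size_add_mset)
  have s': "merged r t (U2 @ U1) W (V \<rhd> M) g \<in> QO_symbols (C \<union> {r, t}) G"
    using N' G by (intro merged_mem[OF ok_rt]) (simp_all only: add_mset_commute size_add_mset)
  have "glue t r (fst ?T) (fst (merged p q (U1 @ U2) V (W \<rhd> M) g))"
    using cyc_append_commute[of "U2 @ q # V" "p # U1"]
    by (intro glue_splitI[of _ "p # U1" t W r "U2 @ q # V"]) (simp_all add: add_mset_commute)
  note 1 = glue_sym[OF this]
  have 2: "glue p q (fst ?T) (fst (merged r t (U2 @ U1) W (V \<rhd> M) g))"
    using cyc_append_commute[of "U1 @ t # W" "r # U2"]
    by (intro glue_splitI[of _ "[]" p "U1 @ t # W @ r # U2" q V]) (simp_all add: add_mset_commute)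
  have "lift_value G p q C (merged p q (U1 @ U2) V (W \<rhd> M) g) =
      lift_value G r t C (merged r t (U2 @ U1) W (V \<rhd> M) g)"
    using G by (intro diamond[OF _ T s 1 s' 2]) simp
  also have "\<dots> = lift_value G p q C (merged p q (U2 @ U1) W (V \<rhd> M) g)"
    using G by (intro merged_rename[OF ok_rt ok_pq N']) simp
  finally show ?thesis by (simp add: merged_value_def)
qed

text \<open>
  In the common lift, gluing t to r joins its two cycles, which raises the genus and leaves V merged
  with the remaining cycle; gluing p to q splits off V and leaves the remaining cycle cut.
\<close>

lemma merged_value_eq_cut_value:
  assumes N: "cycle_family C ((A2 @ B @ A1) \<rhd> V \<rhd> M)"
    and G: "2 * g + size M + 2 = G"
  shows "merged_value (g + 1) (A2 @ B @ A1) V M = cut_value g (A1 @ A2) B (V \<rhd> M)"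
proof -
  let ?T = "((t # B) \<rhd> (r # A1 @ q # V @ p # A2) \<rhd> M, g)"
  let ?D = "C - set (A2 @ B @ A1) - set V" and ?L = "r # A1 @ q # V @ p # A2"
  have D: "cycle_family ?D M" using N by simp
  have D': "cycle_family (set ?L \<union> ?D) (?L \<rhd> M)"
    by (rule cycle_family_addI[OF D]) (use N labels in auto)
  have T: "?T \<in> QO_symbols (C \<union> {p, q, r, t}) (2 * g + size M + 1)"
    by (rule four_label_symbol[OF D']) (use N labels in auto)
  have rot: "cyc (A2 @ B @ A1) = cyc ((A1 @ A2) @ B)" using cyc_append_commute[of "A2 @ B" A1] by simp
  have N': "cycle_family C (((A1 @ A2) @ B) \<rhd> V \<rhd> M)"
    using N unfolding rot .
  have s: "merged p q (A2 @ B @ A1) V M (g + 1) \<in> QO_symbols (C \<union> {p, q}) G"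
    using N G by (intro merged_mem[OF ok_pq]) simp_all
  have s': "cut r t (A1 @ A2) B (V \<rhd> M) g \<in> QO_symbols (C \<union> {r, t}) G"
    using G by (intro cut_mem[OF ok_rt N']) simp
  have "glue t r (fst ?T) (fst (merged p q (A2 @ B @ A1) V M (g + 1)))"
    using cyc_append_commute[of "B @ A1 @ q # V" "p # A2"]
    by (intro glue_joinI[of _ "[]" t B "[]" r "A1 @ q # V @ p # A2" M]) simp_all
  note 1 = glue_sym[OF this]
  have "glue q p (fst ?T) (fst (cut r t (A1 @ A2) B (V \<rhd> M) g))"
    using cyc_append_commute[of A2 "r # A1"]
    by (intro glue_splitI[of _ "r # A1" q V p A2 "(t # B) \<rhd> M"]) (simp_all add: add_mset_commute)
  note 2 = glue_sym[OF this]
  have "lift_value G p q C (merged p q (A2 @ B @ A1) V M (g + 1)) =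
      lift_value G r t C (cut r t (A1 @ A2) B (V \<rhd> M) g)"
    using G by (intro diamond[OF _ T s 1 s' 2]) simp
  also have "\<dots> = lift_value G p q C (cut p q (A1 @ A2) B (V \<rhd> M) g)"
    using G by (intro cut_rename[OF ok_rt ok_pq N']) simp
  finally show ?thesis by (simp add: merged_value_def cut_value_def)
qed

text \<open>
  Two cuts of one cycle whose end points alternate along the circle come from a common lift with one
  cycle less, in which gluing either pair splits that cycle.
\<close>

lemma cut_value_interlaced:
  assumes N: "cycle_family C ((X1 @ X2 @ X3 @ X4) \<rhd> M)"
    and G: "2 * g + size M + 1 = G"
  shows "cut_value g (X1 @ X2) (X3 @ X4) M = cut_value g (X2 @ X3) (X4 @ X1) M"
proof -
  let ?T = "((r # X2 @ p # X1 @ t # X4 @ q # X3) \<rhd> M, g)"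
  have D: "cycle_family (C - set (X1 @ X2 @ X3 @ X4)) M" using N by simp
  have T: "?T \<in> QO_symbols (C \<union> {p, q, r, t}) (2 * g + size M)"
    by (rule four_label_symbol[OF D]) (use N labels in auto)
  have N1: "cycle_family C (((X1 @ X2) @ (X3 @ X4)) \<rhd> M)" using N by simp
  have N': "cycle_family C (((X2 @ X3) @ (X4 @ X1)) \<rhd> M)"
    using N cyc_append_commute[of X1 "X2 @ X3 @ X4"] by simp
  note s = cut_mem[OF ok_pq N1 G] and s' = cut_mem[OF ok_rt N' G]
  have 1: "glue r t (fst ?T) (fst (cut p q (X1 @ X2) (X3 @ X4) M g))"
    using cyc_append_commute[of X2 "p # X1"] cyc_append_commute[of X4 "q # X3"]
    by (intro glue_splitI[of _ "[]" r "X2 @ p # X1" t "X4 @ q # X3" M]) simp_all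
  have 2: "glue p q (fst ?T) (fst (cut r t (X2 @ X3) (X4 @ X1) M g))"
    using cyc_append_commute[of X1 "t # X4"] cyc_append_commute[of X3 "r # X2"]
    by (intro glue_splitI[of _ "r # X2" p "X1 @ t # X4" q X3 M]) (simp_all add: add_mset_commute)
  have "lift_value G p q C (cut p q (X1 @ X2) (X3 @ X4) M g) = lift_value G r t C (cut r t (X2 @ X3) (X4 @ X1) M g)"
    using G by (intro diamond[OF _ T s 1 s' 2]) simp
  also have "\<dots> = lift_value G p q C (cut p q (X2 @ X3) (X4 @ X1) M g)"
    using cut_rename[OF ok_rt ok_pq N' G] .
  finally show ?thesis by (simp add: cut_value_def)
qed

text \<open>
  For G = 0 the lifts are single cycles and have no lifts themselves.  Both sides are instead values
  of the exchange law for the composition of two cycles x and y: gluing p to q after composing along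
  r and t, and the other way round.
\<close>

lemma merged_value_slide:
  assumes N: "cycle_family C {#cyc (Y @ Z), cyc (W @ X)#}" and G: "G = 0"
  shows "merged_value 0 (Y @ Z) (W @ X) {#} = merged_value 0 (X @ W) (Z @ Y) {#}"
proof -
  let ?C1 = "set X \<union> set Y" and ?C2 = "set Z \<union> set W"
  let ?x = "({#cyc (r # X @ p # Y)#}, 0)" and ?y = "({#cyc (t # Z @ q # W)#}, 0)"
  have C: "?C1 \<union> ?C2 = C" using N by auto
  have disj: "distinct X" "distinct Y" "distinct Z" "distinct W" "?C1 \<inter> ?C2 = {}" "set X \<inter> set Y = {}"
    "set Z \<inter> set W = {}" and fr: "p \<notin> C" "q \<notin> C" "r \<notin> C" "t \<notin> C"
    using N labels by auto
  have x: "?x \<in> QO_symbols (?C1 \<union> {p, r}) 0" and y: "?y \<in> QO_symbols (?C2 \<union> {q, t}) 0"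
    using disj fr labels C by (auto simp: QO_symbols_iff)
  have x1: "?x \<in> QO_symbols (?C1 \<union> {p} \<union> {r}) 0" and x2: "?x \<in> QO_symbols (?C1 \<union> {r} \<union> {p}) 0"
    and y1: "?y \<in> QO_symbols (?C2 \<union> {q} \<union> {t}) 0" and y2: "?y \<in> QO_symbols (?C2 \<union> {t} \<union> {q}) 0"
    using x y by (simp_all add: insert_commute)
  have ok: "comp_ok r t (?C1 \<union> {p}) (?C2 \<union> {q})" "comp_ok p q (?C1 \<union> {r}) (?C2 \<union> {t})"
    using disj fr labels C by (auto simp: comp_ok_def)
  have okc: "contr_ok p q (?C1 \<union> ?C2)" "contr_ok r t (?C1 \<union> ?C2)"
    unfolding C by (rule ok_pq ok_rt)+
  have N': "cycle_family C ((X @ W) \<rhd> (Z @ Y) \<rhd> {#})"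
    using N cyc_append_commute[of X W] cyc_append_commute[of Z Y] by (simp only: add_mset_commute)
  have e1: "symbol_comp r t ?x ?y = merged p q (Y @ Z) (W @ X) {#} 0"
  proof (rule symbol_comp_eqI[OF x1 y1 ok(1)])
    have "?C1 \<union> {p} \<union> (?C2 \<union> {q}) = C \<union> {p, q}" using C by auto
    then show "merged p q (Y @ Z) (W @ X) {#} 0 \<in> QO_symbols (?C1 \<union> {p} \<union> (?C2 \<union> {q})) (0 + 0)"
      using merged_mem[OF ok_pq N, of 0] G by simp
    show "comp_glue r t (fst ?x) (fst ?y) (fst (merged p q (Y @ Z) (W @ X) {#} 0))"
      using cyc_append_commute[of X "p # Y @ Z @ q # W"]
      by (intro comp_glueI[of _ "[]" r "X @ p # Y" "{#}" _ "[]" t "Z @ q # W" "{#}"]) simp_all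
  qed
  have e2: "symbol_comp p q ?x ?y = merged r t (X @ W) (Z @ Y) {#} 0"
  proof (rule symbol_comp_eqI[OF x2 y2 ok(2)])
    have "?C1 \<union> {r} \<union> (?C2 \<union> {t}) = C \<union> {r, t}" using C by auto
    then show "merged r t (X @ W) (Z @ Y) {#} 0 \<in> QO_symbols (?C1 \<union> {r} \<union> (?C2 \<union> {t})) (0 + 0)"
      using merged_mem[OF ok_rt N', of 0] G by simp
    show "comp_glue p q (fst ?x) (fst ?y) (fst (merged r t (X @ W) (Z @ Y) {#} 0))"
      using cyc_append_commute[of Y "r # X @ W @ t # Z"]
      by (intro comp_glueI[of _ "r # X" p Y "{#}" _ "t # Z" q W "{#}"]) simp_all
  qed
  have "lift_value G p q C (merged p q (Y @ Z) (W @ X) {#} 0) = lift_value G r t C (merged r t (X @ W) (Z @ Y) {#} 0)"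
    using contr_comp_exchange[OF ok(1) okc(1) ok(2) okc(2) f_mem[OF x] f_mem[OF y]]
      f_comp[OF ok(1) x1 y1] f_comp[OF ok(2) x2 y2]
    unfolding e1 e2 lift_value_def G extension.simps C[symmetric]
    by (simp add: ac_simps insert_commute)
  also have "\<dots> = lift_value G p q C (merged p q (X @ W) (Z @ Y) {#} 0)"
    using G by (intro merged_rename[OF ok_rt ok_pq N']) simp
  finally show ?thesis by (simp add: merged_value_def)
qed

end

section \<open>Independence of the lift\<close>

lemma koszul_0 [simp]: "koszul X 0 0 z = z"
  by (cases X) simp_all

context lifting
begin

text \<open>
  A rotation of the word A @ B starts within A or within B; both cases are instances of
  \<open>merged_value_eq_cut_value\<close>, the second one with A and B exchanged.
\<close>

lemma merged_value_eq_cut_value_rotated: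
  assumes U: "cyc U = cyc (A @ B)" and N: "cycle_family C (U \<rhd> V \<rhd> M)"
    and G: "2 * g + size M + 2 = G"
  shows "merged_value (g + 1) U V M = cut_value g A B (V \<rhd> M)"
proof -
  from U obtain Q P' where QP: "U = Q @ P'" "A @ B = P' @ Q" by (auto simp: cyc_eq_iff)
  from QP(2) obtain us where "A = P' @ us \<and> us @ B = Q \<or> A @ us = P' \<and> B = us @ Q"
    unfolding append_eq_append_conv2 by blast
  then show ?thesis
  proof
    assume "A = P' @ us \<and> us @ B = Q"
    then have e: "A = P' @ us" "U = us @ B @ P'" using QP(1) by auto
    show ?thesis using merged_value_eq_cut_value[OF N[unfolded e(2)] G] unfolding e .
  next
    assume "A @ us = P' \<and> B = us @ Q"
    then have e: "B = us @ Q" "U = Q @ A @ us" using QP(1) by auto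
    have N': "cycle_family C ((B @ A) \<rhd> V \<rhd> M)"
      using N cyc_append_commute[of A B] unfolding U by (simp only:)
    have "merged_value (g + 1) U V M = cut_value g B A (V \<rhd> M)"
      using merged_value_eq_cut_value[OF N[unfolded e(2)] G] unfolding e .
    also have "\<dots> = cut_value g A B (V \<rhd> M)"
      using G by (intro cut_value_sym[OF N']) simp
    finally show ?thesis .
  qed
qed

text \<open>
  The point at which a merged cycle is cut open is irrelevant.  If the genus is positive, one passes
  through a cut of U, if there is a third cycle, through merging U with that cycle; otherwise G = 0 and
  the slide applies.
\<close>

lemma merged_value_rotate:
  assumes U: "cyc U = cyc U'" and N: "cycle_family C (U \<rhd> V \<rhd> M)"
    and G: "2 * g + size M = G"
  shows "merged_value g U V M = merged_value g U' V M"
proof -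
  note N' = N[unfolded U]
  from U obtain X Y where XY: "U = X @ Y" "U' = Y @ X" by (auto simp: cyc_eq_iff)
  show ?thesis
  proof (cases g)
    case (Suc h)
    have h: "2 * h + size M + 2 = G" using G Suc by simp
    have "cyc U = cyc (U @ [])" "cyc U' = cyc (U @ [])" using U by simp_all
    from merged_value_eq_cut_value_rotated[OF this(1) N h] merged_value_eq_cut_value_rotated[OF this(2) N' h]
    show ?thesis by (simp add: Suc)
  next
    case 0
    show ?thesis
    proof (cases "M = {#}")
      case True
      then have G0: "G = 0" using G 0 by simp
      have "merged_value 0 (X @ Y) (V @ []) {#} = merged_value 0 ([] @ V) (Y @ X) {#}"
        using N XY True by (intro merged_value_slide[OF _ G0]) simp
      also have "\<dots> = merged_value 0 (Y @ X) V {#}"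
        using N' XY True G0 merged_value_sym[of "Y @ X" V "{#}" 0] by simp
      finally show ?thesis using XY 0 True by simp
    next
      case False
      have "cycle_family (C - set U - set V) M" using N by simp
      then obtain W M' where W: "M = W \<rhd> M'" using cycle_family_nonempty False by blast
      have h: "2 * g + size M' + 1 = G" using G W by simp
      have "merged_value g (X @ Y) V (W \<rhd> M') = merged_value g (Y @ X) W (V \<rhd> M')"
        using N W XY by (intro merged_value_exchange[OF _ h]) simp
      moreover have "merged_value g ([] @ (Y @ X)) V (W \<rhd> M') =
          merged_value g ((Y @ X) @ []) W (V \<rhd> M')"
        using N' W XY by (intro merged_value_exchange[OF _ h]) simp
      ultimately show ?thesis using W XY by simp
    qed
  qed
qed

lemma merged_value_cong:
  assumes U: "cyc U = cyc U'" and V: "cyc V = cyc V'"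
    and N: "cycle_family C (U \<rhd> V \<rhd> M)" and G: "2 * g + size M = G"
  shows "merged_value g U V M = merged_value g U' V' M"
proof -
  note N' = N[unfolded U] and N'' = N[unfolded U V]
  have M: "cycle_family C (V \<rhd> U' \<rhd> M)" using N' by (simp only: add_mset_commute)
  have "merged_value g U V M = merged_value g U' V M" using merged_value_rotate[OF U N G] .
  also have "\<dots> = merged_value g V U' M" using merged_value_sym[OF N' G] .
  also have "\<dots> = merged_value g V' U' M" using merged_value_rotate[OF V M G] .
  also have "\<dots> = merged_value g U' V' M" using merged_value_sym[OF N'' G] by simp
  finally show ?thesis .
qed

lemma merged_value_swap:
  assumes N: "cycle_family C (U \<rhd> V \<rhd> W \<rhd> M)"
    and G: "2 * g + size M + 1 = G"
  shows "merged_value g U V (W \<rhd> M) = merged_value g U W (V \<rhd> M)"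
  using merged_value_exchange[of "[]" U V W M g] N G by simp

lemma merged_value_unique_first:
  assumes N: "cycle_family C (U \<rhd> V \<rhd> M)" and G: "2 * g + size M = G"
    and U: "cyc U = cyc X" and VM: "V \<rhd> M = Y \<rhd> M'"
  shows "merged_value g U V M = merged_value g X Y M'"
proof -
  from VM consider "cyc V = cyc Y" "M = M'"
    | K where "M = Y \<rhd> K" "M' = V \<rhd> K"
    unfolding add_eq_conv_ex by blast
  then show ?thesis
  proof cases
    case 1
    show ?thesis using merged_value_cong[OF U 1(1) N G] unfolding 1(2) .
  next
    case 2
    have G': "2 * g + size K + 1 = G" "2 * g + size (V \<rhd> K) = G" using G 2 by simp_all
    have N': "cycle_family C (U \<rhd> Y \<rhd> V \<rhd> K)"
      using N unfolding 2 by (simp only: add_mset_commute)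
    have "merged_value g U V M = merged_value g U Y (V \<rhd> K)"
      using merged_value_swap[OF N[unfolded 2] G'(1)] unfolding 2 .
    also have "\<dots> = merged_value g X Y M'" using merged_value_cong[OF U refl N' G'(2)] unfolding 2 .
    finally show ?thesis .
  qed
qed

text \<open>
  Any pair of merged cycles can be replaced by any other one: replace its two members one after the
  other, using a swap with a third cycle where needed.
\<close>

lemma merged_value_unique:
  assumes N: "cycle_family C (U \<rhd> V \<rhd> M)" and G: "2 * g + size M = G"
    and eq: "U \<rhd> V \<rhd> M = X \<rhd> Y \<rhd> M'"
  shows "merged_value g U V M = merged_value g X Y M'"
proof -
  from eq consider "cyc U = cyc X" "V \<rhd> M = Y \<rhd> M'"
    | K where "V \<rhd> M = X \<rhd> K" "Y \<rhd> M' = U \<rhd> K"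
    unfolding add_eq_conv_ex[of "cyc U"] by blast
  then show ?thesis
  proof cases
    case 1
    then show ?thesis by (rule merged_value_unique_first[OF N G])
  next
    case K: 2
    from K(1) consider "cyc V = cyc X" "M = K" | L where "M = X \<rhd> L" "K = V \<rhd> L"
      unfolding add_eq_conv_ex by blast
    then show ?thesis
    proof cases
      case 1
      have N': "cycle_family C (V \<rhd> U \<rhd> M)" using N by (simp only: add_mset_commute)
      have "merged_value g V U M = merged_value g X Y M'"
        using merged_value_unique_first[OF N' G 1(1) K(2)[folded 1(2), symmetric]] .
      then show ?thesis using merged_value_sym[OF N G] by simp
    next
      case 2
      have G': "2 * g + size L + 1 = G" "2 * g + size K = G" using G 2 by simp_all
      have N': "cycle_family C (U \<rhd> X \<rhd> K)"
        using N unfolding 2 by (simp only: add_mset_commute)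
      have N'': "cycle_family C (X \<rhd> U \<rhd> K)"
        using N' by (simp only: add_mset_commute)
      have "merged_value g U V M = merged_value g U X K"
        using merged_value_swap[OF N[unfolded 2] G'(1)] unfolding 2 .
      also have "\<dots> = merged_value g X U K" using merged_value_sym[OF N' G'(2)] .
      also have "\<dots> = merged_value g X Y M'"
        using merged_value_unique_first[OF N'' G'(2) refl K(2)[symmetric]] .
      finally show ?thesis .
    qed
  qed
qed

text \<open>
  Two steps between alternating cuts lead from an arbitrary cut of a cycle to the cut that leaves one
  part empty, with the cycle read from any given starting point.
\<close>

lemma cut_value_rotate:
  assumes W: "cyc W = cyc (A @ B)" and N: "cycle_family C (W \<rhd> M)"
    and G: "2 * g + size M + 1 = G"
  shows "cut_value g A B M = cut_value g W [] M"
proof -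
  \<comment> \<open>Each step moves one end point: from us B P' | (empty) to B P' | us, and then to P' us | B.\<close>
  have main: "cut_value g (us @ B @ P') [] M = cut_value g (P' @ us) B M"
    if "cycle_family C ((us @ B @ P') \<rhd> M)" for us B P'
  proof -
    have "cut_value g (us @ (B @ P')) ([] @ []) M = cut_value g ((B @ P') @ []) ([] @ us) M"
      using that by (intro cut_value_interlaced[OF _ G]) simp
    moreover have "cut_value g (B @ P') (us @ []) M = cut_value g (P' @ us) ([] @ B) M"
      using that cyc_append_commute[of us "B @ P'"] by (intro cut_value_interlaced[OF _ G]) simp
    ultimately show ?thesis by simp
  qed
  from W obtain Q P' where QP: "W = Q @ P'" "A @ B = P' @ Q" by (auto simp: cyc_eq_iff)
  from QP(2) obtain us where "A = P' @ us \<and> us @ B = Q \<or> A @ us = P' \<and> B = us @ Q"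
    unfolding append_eq_append_conv2 by blast
  then show ?thesis
  proof
    assume "A = P' @ us \<and> us @ B = Q"
    then have e: "A = P' @ us" "W = us @ B @ P'" using QP(1) by auto
    show ?thesis using main[OF N[unfolded e(2)]] unfolding e by simp
  next
    assume "A @ us = P' \<and> B = us @ Q"
    then have e: "B = us @ Q" "W = Q @ A @ us" using QP(1) by auto
    have "cut_value g W [] M = cut_value g B A M" using main[OF N[unfolded e(2)]] unfolding e by simp
    moreover have "cut_value g A B M = cut_value g B A M"
      using N by (intro cut_value_sym[OF _ G]) (simp only: W)
    ultimately show ?thesis by simp
  qed
qed

lemma lift_cases:
  assumes s: "s \<in> QO_symbols (C \<union> {p, q}) G" and u: "symbol_contr p q s = u"
  obtains (merged) U V M where "lift_value G p q C s = merged_value (snd u) U V M"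
      "fst u = U \<rhd> V \<rhd> M" "2 * snd u + size M = G"
  | (cut) A B M g where "lift_value G p q C s = cut_value g A B M" "fst u = (A @ B) \<rhd> M"
      "snd u = g + 1" "2 * g + size M + 1 = G"
proof -
  have S: "2 * snd s + (size (fst s) - 1) = G" and U: "2 * snd u + (size (fst u) - 1) = G + 1"
    using s symbol_contr_glue(1)[OF s ok_pq] u by (auto simp: QO_symbols_iff)
  have "glue p q (fst s) (fst u)" using symbol_contr_glue(2)[OF s ok_pq] u by simp
  then show ?thesis
  proof cases
    case (split A B M)
    have "snd s = snd u" using S U split by simp
    then have "s = ((p # A @ q # B) \<rhd> M, snd u)" using split by (simp add: prod_eq_iff)
    then have "lift_value G p q C s = merged_value (snd u) A B M" by (simp add: merged_value_def)
    then show ?thesis by (rule merged) (use split U in simp_all)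
  next
    case (join A B M)
    have "snd u = snd s + 1" using S U join by simp
    have "s = ((p # A) \<rhd> (q # B) \<rhd> M, snd s)" using join by (simp add: prod_eq_iff)
    then have "lift_value G p q C s = cut_value (snd s) A B M" by (simp add: cut_value_def)
    then show ?thesis by (rule cut) (use join U S \<open>snd u = snd s + 1\<close> in simp_all)
  qed
qed

text \<open>
  As soon as there are at least two cycles, a cut can be replaced by a merge.
\<close>

lemma lift_merged:
  assumes s: "s \<in> QO_symbols (C \<union> {p, q}) G" and u: "symbol_contr p q s = u" and "size (fst u) \<noteq> 1"
  obtains U V M where "lift_value G p q C s = merged_value (snd u) U V M"
      "fst u = U \<rhd> V \<rhd> M" "2 * snd u + size M = G"
  using s u
proof (cases rule: lift_cases)
  case (merged U V M)
  then show ?thesis by (rule that)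
next
  case (cut A B M g)
  have N: "cycle_family C (fst u)" using symbol_contr_glue(1)[OF s ok_pq] u by (auto simp: QO_symbols_iff)
  have M: "M \<noteq> {#}" using assms(3) cut(2) by auto
  have "cycle_family (C - set (A @ B)) M" using N unfolding cut(2) by simp
  then obtain V K where K: "M = V \<rhd> K" using cycle_family_nonempty[OF _ M] by blast
  have "merged_value (g + 1) (A @ B) V K = cut_value g A B M"
    unfolding K using N cut(4) unfolding cut(2) K by (intro merged_value_eq_cut_value_rotated) simp_all
  then show ?thesis using cut K by (intro that[of "A @ B" V K]) simp_all
qed

lemma lifts_agree:
  assumes s: "s \<in> QO_symbols (C \<union> {p, q}) G" "symbol_contr p q s = u"
    and s': "s' \<in> QO_symbols (C \<union> {p, q}) G" "symbol_contr p q s' = u"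
  shows "lift_value G p q C s = lift_value G p q C s'"
proof -
  have N: "cycle_family C (fst u)" using symbol_contr_glue(1)[OF s(1) ok_pq] s(2) by (auto simp: QO_symbols_iff)
  show ?thesis
  proof (cases "size (fst u) = 1")
    case False
    obtain U V M where 1: "lift_value G p q C s = merged_value (snd u) U V M"
      "fst u = U \<rhd> V \<rhd> M" "2 * snd u + size M = G"
      using lift_merged[OF s False] .
    obtain X Y M' where 2: "lift_value G p q C s' = merged_value (snd u) X Y M'"
      "fst u = X \<rhd> Y \<rhd> M'" "2 * snd u + size M' = G"
      using lift_merged[OF s' False] .
    show ?thesis unfolding 1(1) 2(1)
      by (rule merged_value_unique[OF N[unfolded 1(2)] 1(3) trans[OF 1(2)[symmetric] 2(2)]])
  next
    case True
    have ex: "\<exists>A B g. lift_value G p q C v = cut_value g A B {#} \<and> fst u = {#cyc (A @ B)#} \<and>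
        snd u = g + 1 \<and> 2 * g + 1 = G"
      if "v \<in> QO_symbols (C \<union> {p, q}) G" "symbol_contr p q v = u" for v
      using that
    proof (cases rule: lift_cases)
      case (merged U V M)
      with True show ?thesis by simp
    next
      case (cut A B M g)
      then have "M = {#}" using True by simp
      with cut show ?thesis by auto
    qed
    obtain A B g where 1: "lift_value G p q C s = cut_value g A B {#}" "fst u = {#cyc (A @ B)#}"
      "snd u = g + 1" "2 * g + 1 = G" using ex[OF s] by blast
    obtain A' B' h where 2: "lift_value G p q C s' = cut_value h A' B' {#}" "fst u = {#cyc (A' @ B')#}"
      "snd u = h + 1" using ex[OF s'] by blast
    have h: "h = g" using 1 2 by simp
    have W: "cyc (A @ B) = cyc (A' @ B')" using 1(2) 2(2) by simp
    have G: "2 * g + size {#} + 1 = G" using 1(4) by simp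
    show ?thesis unfolding 1(1) 2(1) h
      using cut_value_rotate[OF refl N[unfolded 1(2)] G] cut_value_rotate[OF W N[unfolded 1(2)] G] by simp
  qed
qed

end

section \<open>The extension for sets\<close>

context ass_morphism
begin

lemma lifts_agree_at_step:
  assumes equiv: "equivariant_at G"
    and below: "\<And>G'. G = Suc G' \<Longrightarrow> equivariant_at G' \<and> lifts_agree_at G'"
  shows "lifts_agree_at G"
  unfolding lifts_agree_at_def
proof (intro allI impI)
  fix a b C c d and s s' :: "'c symbol"
  assume ok: "contr_ok a b C" "contr_ok c d C"
    and s: "s \<in> QO_symbols (C \<union> {a, b}) G" "s' \<in> QO_symbols (C \<union> {c, d}) G"
    and eq: "symbol_contr a b s = symbol_contr c d s'"
  have fin: "finite C" using ok by (simp add: contr_ok_def)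
  obtain p q where pq: "p \<notin> C" "q \<notin> C" "p \<noteq> q" using fresh_pair[OF fin] .
  have "finite (C \<union> {p, q})" using fin by simp
  then obtain r t where rt: "r \<notin> C \<union> {p, q}" "t \<notin> C \<union> {p, q}" "r \<noteq> t" by (rule fresh_pair)
  interpret lifting K P f C p q r t G
    using fin pq rt equiv below by unfold_locales auto
  note 1 = lift_value_rename[OF equiv ok(1) ok_pq s(1)] and 2 = lift_value_rename[OF equiv ok(2) ok_pq s(2)]
  show "lift_value G a b C s = lift_value G c d C s'"
    unfolding 1(1) 2(1) by (rule lifts_agree[OF 1(2) refl 2(2)]) (use 1(3) 2(3) eq in simp)
qed

text \<open>
  Equivariance at G is used for comparing the lifts in QO(C, G), and this comparison for equivariance
  at G + 1; so the two are proved in a single induction.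
\<close>

lemma equivariant_and_lifts_agree: "equivariant_at G \<and> lifts_agree_at G"
proof (induction G)
  case 0
  have "lifts_agree_at 0" by (rule lifts_agree_at_step[OF equivariant_at_0]) simp
  with equivariant_at_0 show ?case by simp
next
  case (Suc G)
  then have e: "equivariant_at (Suc G)" by (simp add: equivariant_at_Suc)
  have "lifts_agree_at (Suc G)" by (rule lifts_agree_at_step[OF e]) (use Suc in simp)
  with e show ?case by simp
qed

lemma extension_mem: "s \<in> QO_symbols C G \<Longrightarrow> extension G C s \<in> points C G"
  using equivariant_and_lifts_agree[of G] unfolding equivariant_at_def by blast

lemma extension_act:
  "\<lbrakk>s \<in> QO_symbols C G; inj_on \<rho> C\<rbrakk>
    \<Longrightarrow> extension G (\<rho> ` C) (relabel \<rho> s) = mact P C G \<rho> 0 (extension G C s)"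
  using equivariant_and_lifts_agree[of G] unfolding equivariant_at_def by blast

lemma extension_symbol_contr:
  assumes "contr_ok a b C" "s \<in> QO_symbols (C \<union> {a, b}) G"
  shows "extension (Suc G) C (symbol_contr a b s) = mcontr P a b C G 0 (extension G (C \<union> {a, b}) s)"
  using extension_contr[OF conjunct2[OF equivariant_and_lifts_agree] assms] by (simp add: lift_value_def)

definition respects_comp :: "nat \<Rightarrow> nat \<Rightarrow> bool" where
  "respects_comp G1 G2 \<longleftrightarrow>
     (\<forall>a b C1 C2. comp_ok a b C1 C2 \<longrightarrow>
        (\<forall>s\<in>QO_symbols (C1 \<union> {a}) G1. \<forall>t\<in>QO_symbols (C2 \<union> {b}) G2.
          extension (G1 + G2) (C1 \<union> C2) (symbol_comp a b s t) =
          mcomp P a b C1 G1 C2 G2 0 0 (extension G1 (C1 \<union> {a}) s) (extension G2 (C2 \<union> {b}) t)))"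

lemma respects_comp_sym: "respects_comp G1 G2 \<Longrightarrow> respects_comp G2 G1"
  unfolding respects_comp_def
proof (intro allI impI ballI)
  fix a b :: 'c and C1 C2 s t
  assume R: "\<forall>a b C1 C2. comp_ok a b C1 C2 \<longrightarrow>
        (\<forall>s\<in>QO_symbols (C1 \<union> {a}) G1. \<forall>t\<in>QO_symbols (C2 \<union> {b}) G2.
          extension (G1 + G2) (C1 \<union> C2) (symbol_comp a b s t) =
          mcomp P a b C1 G1 C2 G2 0 0 (extension G1 (C1 \<union> {a}) s) (extension G2 (C2 \<union> {b}) t))"
    and ok: "comp_ok a b C1 C2" and s: "s \<in> QO_symbols (C1 \<union> {a}) G2" and t: "t \<in> QO_symbols (C2 \<union> {b}) G1"
  have ok': "comp_ok b a C2 C1" using ok by (auto simp: comp_ok_def)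
  have "extension (G1 + G2) (C2 \<union> C1) (symbol_comp b a t s) =
      mcomp P b a C2 G1 C1 G2 0 0 (extension G1 (C2 \<union> {b}) t) (extension G2 (C1 \<union> {a}) s)"
    using R ok' s t by blast
  moreover have "symbol_comp b a t s = symbol_comp a b s t" using symbol_comp_sym[OF ok s t] by simp
  moreover have "mcomp P a b C1 G2 C2 G1 0 0 (extension G2 (C1 \<union> {a}) s) (extension G1 (C2 \<union> {b}) t) =
      mcomp P b a C2 G1 C1 G2 0 0 (extension G1 (C2 \<union> {b}) t) (extension G2 (C1 \<union> {a}) s)"
    using comp_sym[OF ok extension_mem[OF s] extension_mem[OF t]] by simp
  ultimately show "extension (G2 + G1) (C1 \<union> C2) (symbol_comp a b s t) =
      mcomp P a b C1 G2 C2 G1 0 0 (extension G2 (C1 \<union> {a}) s) (extension G1 (C2 \<union> {b}) t)"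
    by (simp add: Un_commute add.commute)
qed

text \<open>
  A contraction in the left factor can be pulled out of a composition, both for symbols and in P.
\<close>

lemma respects_comp_Suc:
  assumes R: "respects_comp G1 G2"
  shows "respects_comp (Suc G1) G2"
  unfolding respects_comp_def
proof (intro allI impI ballI)
  fix a b :: 'c and C1 C2 s t
  assume ok: "comp_ok a b C1 C2" and s: "s \<in> QO_symbols (C1 \<union> {a}) (Suc G1)"
    and t: "t \<in> QO_symbols (C2 \<union> {b}) G2"
  have "finite (C1 \<union> C2 \<union> {a, b})" using ok by (simp add: comp_ok_def)
  then obtain c d where cd: "c \<notin> C1 \<union> C2 \<union> {a, b}" "d \<notin> C1 \<union> C2 \<union> {a, b}" "c \<noteq> d"
    by (rule fresh_pair)
  have okc: "contr_ok c d (C1 \<union> {a})" "comp_ok a b (C1 \<union> {c, d}) C2" "contr_ok c d (C1 \<union> C2)"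
    using ok cd by (auto simp: contr_ok_def comp_ok_def)
  obtain s' where s': "s' \<in> QO_symbols (C1 \<union> {a} \<union> {c, d}) G1" "symbol_contr c d s' = s"
    using symbol_contr_lift[OF s okc(1)] .
  have s1: "s' \<in> QO_symbols (C1 \<union> {a, c, d}) G1" and s2: "s' \<in> QO_symbols (C1 \<union> {c, d} \<union> {a}) G1"
    using s'(1) by (simp_all add: insert_commute)
  let ?x = "extension G1 (C1 \<union> {a, c, d}) s'" and ?y = "extension G2 (C2 \<union> {b}) t"
  have m: "symbol_comp a b s' t \<in> QO_symbols (C1 \<union> C2 \<union> {c, d}) (G1 + G2)"
    using symbol_comp_glue(1)[OF s2 t okc(2)] by (simp add: insert_commute)
  have e: "extension (Suc G1) (C1 \<union> {a}) s = mcontr P c d (C1 \<union> {a}) G1 0 ?x"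
    using extension_symbol_contr[OF okc(1) s'(1)] s'(2) by (simp add: insert_commute)
  have "extension (G1 + G2) (C1 \<union> {c, d} \<union> C2) (symbol_comp a b s' t) =
      mcomp P a b (C1 \<union> {c, d}) G1 C2 G2 0 0 (extension G1 (C1 \<union> {c, d} \<union> {a}) s') ?y"
    using R okc(2) s2 t unfolding respects_comp_def by blast
  then have e2: "extension (G1 + G2) (C1 \<union> C2 \<union> {c, d}) (symbol_comp a b s' t) =
      mcomp P a b (C1 \<union> {c, d}) G1 C2 G2 0 0 ?x ?y" by (simp add: insert_commute)
  have "symbol_comp a b s t = symbol_contr c d (symbol_comp a b s' t)"
    using symbol_comp_contr[OF inf okc(1) ok okc(2,3) s1 t] s'(2) by simp
  then have "extension (Suc G1 + G2) (C1 \<union> C2) (symbol_comp a b s t) =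
      mcontr P c d (C1 \<union> C2) (G1 + G2) 0 (mcomp P a b (C1 \<union> {c, d}) G1 C2 G2 0 0 ?x ?y)"
    using extension_symbol_contr[OF okc(3) m] e2 by (simp del: extension.simps)
  also have "\<dots> = mcomp P a b C1 (Suc G1) C2 G2 0 0 (extension (Suc G1) (C1 \<union> {a}) s) ?y"
    using comp_contr[OF okc(1) ok okc(2,3) extension_mem[OF s1] extension_mem[OF t]] unfolding e by simp
  finally show "extension (Suc G1 + G2) (C1 \<union> C2) (symbol_comp a b s t) =
      mcomp P a b C1 (Suc G1) C2 G2 0 0 (extension (Suc G1) (C1 \<union> {a}) s) ?y" .
qed

lemma respects_comp: "respects_comp G1 G2"
proof -
  have "respects_comp 0 0" unfolding respects_comp_def using f_comp by simp
  then have "respects_comp G2 0" by (induction G2) (simp_all add: respects_comp_Suc)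
  then have "respects_comp 0 G2" by (rule respects_comp_sym)
  then show ?thesis by (induction G1) (simp_all add: respects_comp_Suc)
qed

lemma Set_obj_exists:
  assumes "finite C"
  obtains A where "mob P C G = Set_obj A"
  using obj[OF assms, of G] by (cases "mob P C G") auto

lemma modular_morphism_extension: "modular_morphism K QO_set P (\<lambda>C G i. extension G C)"
  unfolding modular_morphism_def QO_set_simps
proof (intro conjI allI ballI impI)
  fix C :: "'c set" and G assume "finite C"
  then obtain A where A: "mob P C G = Set_obj A" by (rule Set_obj_exists)
  show "base_hom K (Set_obj (QO_symbols C G)) (mob P C G) (\<lambda>i. extension G C)"
    using extension_mem[of _ C G] by (auto simp: A)
next
  fix C :: "'c set" and G i x and \<rho> :: "'c \<Rightarrow> 'c"
  assume "x \<in> elems (Set_obj (QO_symbols C G) :: ('k, 'c symbol) obj) i" "finite C" "inj_on \<rho> C"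
  then show "extension G (\<rho> ` C) (relabel \<rho> x) = mact P C G \<rho> i (extension G C x)"
    unfolding elems_Set_obj using extension_act by blast
next
  fix a b :: 'c and C1 C2 G1 G2 i j x y
  assume "comp_ok a b C1 C2" "x \<in> elems (Set_obj (QO_symbols (C1 \<union> {a}) G1) :: ('k, 'c symbol) obj) i"
    "y \<in> elems (Set_obj (QO_symbols (C2 \<union> {b}) G2) :: ('k, 'c symbol) obj) j"
  then show "extension (G1 + G2) (C1 \<union> C2) (symbol_comp a b x y) =
      mcomp P a b C1 G1 C2 G2 i j (extension G1 (C1 \<union> {a}) x) (extension G2 (C2 \<union> {b}) y)"
    unfolding elems_Set_obj using respects_comp[of G1 G2] unfolding respects_comp_def by blast
next
  fix a b :: 'c and C G i x
  assume "contr_ok a b C" "x \<in> elems (Set_obj (QO_symbols (C \<union> {a, b}) G) :: ('k, 'c symbol) obj) i"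
  then show "extension (G + 1) C (symbol_contr a b x) = mcontr P a b C G i (extension G (C \<union> {a, b}) x)"
    unfolding elems_Set_obj Suc_eq_plus1[symmetric] using extension_symbol_contr by blast
qed

text \<open>
  Symbols are iterated contractions of cycles, on which the morphism is prescribed.
\<close>

lemma extends_unique:
  assumes h: "extends K Ass_set Ass_incl QO_set P f h" and u: "u \<in> QO_symbols C G"
  shows "h C G 0 u = extension G C u"
  using u
proof (induction G arbitrary: C u)
  case 0
  then have "finite C" using QO_symbols_finite by blast
  then show ?case using h 0 by (simp add: extends_def Ass_set_simps Ass_incl_def)
next
  case (Suc G)
  then have fin: "finite C" using QO_symbols_finite by blast
  obtain a b where "a \<notin> C" "b \<notin> C" "a \<noteq> b" using fresh_pair[OF fin] .
  then have ok: "contr_ok a b C" using fin by (simp add: contr_ok_def)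
  obtain s where s: "s \<in> QO_symbols (C \<union> {a, b}) G" "symbol_contr a b s = u"
    using symbol_contr_lift[OF Suc.prems ok] .
  have "modular_morphism K QO_set P h" using h by (simp add: extends_def)
  from modular_morphismD(4)[OF this ok, of s G 0] s
  have "h C (Suc G) 0 u = mcontr P a b C G 0 (h (C \<union> {a, b}) G 0 s)" by (simp add: QO_set_simps)
  also have "\<dots> = extension (Suc G) C u"
    using extension_symbol_contr[OF ok s(1)] s(2) Suc.IH[OF s(1)] by (simp del: extension.simps)
  finally show ?case .
qed

lemma extends_extension: "extends K Ass_set Ass_incl QO_set P f (\<lambda>C G i. extension G C)"
  using modular_morphism_extension by (auto simp: extends_def Ass_set_simps Ass_incl_def elems_Set_obj)

end

section \<open>Linear maps and linear spans\<close>

lemma K_linearI: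
  assumes "\<And>x. x \<in> carrier V \<Longrightarrow> f x \<in> carrier W"
    and "\<And>x y. \<lbrakk>x \<in> carrier V; y \<in> carrier V\<rbrakk> \<Longrightarrow> f (x \<oplus>\<^bsub>V\<^esub> y) = f x \<oplus>\<^bsub>W\<^esub> f y"
    and "\<And>r x. \<lbrakk>r \<in> carrier K; x \<in> carrier V\<rbrakk> \<Longrightarrow> f (r \<odot>\<^bsub>V\<^esub> x) = r \<odot>\<^bsub>W\<^esub> f x"
  shows "K_linear K V W f"
  using assms by (simp add: K_linear_def)

lemma K_linearD:
  assumes "K_linear K V W f"
  shows "x \<in> carrier V \<Longrightarrow> f x \<in> carrier W"
    and "\<lbrakk>x \<in> carrier V; y \<in> carrier V\<rbrakk> \<Longrightarrow> f (x \<oplus>\<^bsub>V\<^esub> y) = f x \<oplus>\<^bsub>W\<^esub> f y"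
    and "\<lbrakk>r \<in> carrier K; x \<in> carrier V\<rbrakk> \<Longrightarrow> f (r \<odot>\<^bsub>V\<^esub> x) = r \<odot>\<^bsub>W\<^esub> f x"
  using assms by (auto simp: K_linear_def)

lemma K_linear_comp:
  assumes "K_linear K U V f" "K_linear K V W g"
  shows "K_linear K U W (\<lambda>x. g (f x))"
  using assms by (intro K_linearI) (simp_all add: K_linearD)

lemma K_linear_cong:
  assumes "K_linear K V W g" "\<And>x. x \<in> carrier V \<Longrightarrow> f x = g x" "module K V"
  shows "K_linear K V W f"
proof -
  interpret V: module K V by fact
  show ?thesis using assms(1,2) by (auto simp: K_linear_def)
qed

lemma K_bilinearD:
  assumes "K_bilinear K U V W f"
  shows "x \<in> carrier U \<Longrightarrow> K_linear K V W (f x)" and "y \<in> carrier V \<Longrightarrow> K_linear K U W (\<lambda>x. f x y)"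
  using assms by (auto simp: K_bilinear_def)

lemma K_linear_zero:
  assumes "K_linear K V W f" "module K V" "module K W"
  shows "f \<zero>\<^bsub>V\<^esub> = \<zero>\<^bsub>W\<^esub>"
proof -
  interpret V: module K V by fact
  interpret W: module K W by fact
  have "f (\<zero>\<^bsub>K\<^esub> \<odot>\<^bsub>V\<^esub> \<zero>\<^bsub>V\<^esub>) = \<zero>\<^bsub>K\<^esub> \<odot>\<^bsub>W\<^esub> f \<zero>\<^bsub>V\<^esub>"
    by (rule K_linearD(3)[OF assms(1)]) simp_all
  then show ?thesis using K_linearD(1)[OF assms(1)] by simp
qed

lemma K_linear_zero_map:
  assumes "module K W"
  shows "K_linear K V W (\<lambda>x. \<zero>\<^bsub>W\<^esub>)"
proof -
  interpret W: module K W by fact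
  show ?thesis by (rule K_linearI) simp_all
qed

locale coefficient_field = field K for K :: "'k ring" (structure)
begin

definition basis_vector :: "'s \<Rightarrow> 's \<Rightarrow> 'k" where
  "basis_vector s = (\<lambda>t. if t = s then \<one> else \<zero>)"

lemma linear_span_simps [simp]:
  "\<zero>\<^bsub>linear_span K S\<^esub> = (\<lambda>s. \<zero>)"
  "u \<oplus>\<^bsub>linear_span K S\<^esub> v = (\<lambda>s. u s \<oplus> v s)"
  "r \<odot>\<^bsub>linear_span K S\<^esub> u = (\<lambda>s. r \<otimes> u s)"
  by (simp_all add: linear_span_def)

lemma linear_span_carrier:
  "u \<in> carrier (linear_span K S) \<longleftrightarrow>
     (\<forall>s. u s \<in> carrier K) \<and> finite {s. u s \<noteq> \<zero>} \<and> {s. u s \<noteq> \<zero>} \<subseteq> S"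
  by (auto simp: linear_span_def)

lemma linear_span_carrierI:
  assumes "\<And>s. u s \<in> carrier K" "finite A" "A \<subseteq> S" "\<And>s. s \<notin> A \<Longrightarrow> u s = \<zero>"
  shows "u \<in> carrier (linear_span K S)"
proof -
  have "{s. u s \<noteq> \<zero>} \<subseteq> A" using assms(4) by auto
  then show ?thesis using assms(1-3) finite_subset[of _ A] by (auto simp: linear_span_carrier)
qed

lemma linear_span_support:
  assumes "u \<in> carrier (linear_span K S)"
  obtains A where "finite A" "A \<subseteq> S" "\<And>s. s \<notin> A \<Longrightarrow> u s = \<zero>"
  by (rule that[of "{s. u s \<noteq> \<zero>}"]) (use assms in \<open>auto simp: linear_span_carrier\<close>)

lemma linear_span_closed: "u \<in> carrier (linear_span K S) \<Longrightarrow> u s \<in> carrier K"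
  by (simp add: linear_span_carrier)

lemma basis_vector_mem: "s \<in> S \<Longrightarrow> basis_vector s \<in> carrier (linear_span K S)"
  by (rule linear_span_carrierI[of _ "{s}"]) (auto simp: basis_vector_def)

lemma linear_span_empty: "u \<in> carrier (linear_span K {}) \<longleftrightarrow> u = (\<lambda>s. \<zero>)"
  by (auto simp: linear_span_carrier)

lemma module_linear_span: "module K (linear_span K S)"
proof (rule moduleI)
  show "cring K" ..
  have add: "(\<lambda>s. u s \<oplus> v s) \<in> carrier (linear_span K S)"
    if u: "u \<in> carrier (linear_span K S)" and v: "v \<in> carrier (linear_span K S)" for u v
  proof -
    obtain A where A: "finite A" "A \<subseteq> S" "\<And>s. s \<notin> A \<Longrightarrow> u s = \<zero>" using u by (rule linear_span_support) blast
    obtain B where B: "finite B" "B \<subseteq> S" "\<And>s. s \<notin> B \<Longrightarrow> v s = \<zero>" using v by (rule linear_span_support) blast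
    show ?thesis
      by (rule linear_span_carrierI[of _ "A \<union> B"]) (use A B that in \<open>auto simp: linear_span_closed\<close>)
  qed
  have smult: "(\<lambda>s. r \<otimes> u s) \<in> carrier (linear_span K S)"
    if "r \<in> carrier K" and u: "u \<in> carrier (linear_span K S)" for r u
  proof -
    obtain A where A: "finite A" "A \<subseteq> S" "\<And>s. s \<notin> A \<Longrightarrow> u s = \<zero>" using u by (rule linear_span_support) blast
    show ?thesis
      by (rule linear_span_carrierI[of _ A]) (use A that in \<open>auto simp: linear_span_closed\<close>)
  qed
  show "abelian_group (linear_span K S)"
  proof (rule abelian_groupI)
    fix u assume u: "u \<in> carrier (linear_span K S)"
    have "(\<lambda>s. (\<ominus> \<one>) \<otimes> u s) \<in> carrier (linear_span K S)" by (rule smult) (use u in auto)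
    moreover have "(\<lambda>s. (\<ominus> \<one>) \<otimes> u s \<oplus> u s) = (\<lambda>s. \<zero>)"
      using linear_span_closed[OF u] by (auto simp: l_minus l_neg)
    ultimately show "\<exists>v\<in>carrier (linear_span K S). v \<oplus>\<^bsub>linear_span K S\<^esub> u = \<zero>\<^bsub>linear_span K S\<^esub>"
      unfolding linear_span_simps by (intro bexI[of _ "\<lambda>s. (\<ominus> \<one>) \<otimes> u s"])
  next
    show "\<zero>\<^bsub>linear_span K S\<^esub> \<in> carrier (linear_span K S)" by (simp add: linear_span_carrier)
  qed (simp_all add: add linear_span_closed a_ac)
  show "\<And>a x. \<lbrakk>a \<in> carrier K; x \<in> carrier (linear_span K S)\<rbrakk>
      \<Longrightarrow> a \<odot>\<^bsub>linear_span K S\<^esub> x \<in> carrier (linear_span K S)" using smult by simp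
qed (auto simp: linear_span_closed l_distr r_distr m_assoc)

text \<open>
  Linear maps out of a span are determined by their values at the basis vectors.  All identities
  between operations on linear combinations of symbols are reduced to symbols in this way.
\<close>

lemma K_linear_eqI:
  assumes f: "K_linear K (linear_span K S) V f" and g: "K_linear K (linear_span K S) V g"
    and V: "module K V" and eq: "\<And>s. s \<in> S \<Longrightarrow> f (basis_vector s) = g (basis_vector s)"
    and u: "u \<in> carrier (linear_span K S)"
  shows "f u = g u"
proof -
  obtain A where A: "finite A" "A \<subseteq> S" "\<And>s. s \<notin> A \<Longrightarrow> u s = \<zero>" using u by (rule linear_span_support) blast
  from A u show ?thesis
  proof (induction A arbitrary: u rule: finite_induct)
    case empty
    then have "u = \<zero>\<^bsub>linear_span K S\<^esub>" by auto
    then show ?case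
      using K_linear_zero[OF f module_linear_span V] K_linear_zero[OF g module_linear_span V] by simp
  next
    case (insert a A)
    let ?v = "u(a := \<zero>)"
    have v: "?v \<in> carrier (linear_span K S)"
      by (rule linear_span_carrierI[of _ A]) (use insert in \<open>auto simp: linear_span_closed\<close>)
    have b: "basis_vector a \<in> carrier (linear_span K S)" using insert.prems by (intro basis_vector_mem) auto
    have c: "u a \<in> carrier K" using insert.prems by (simp add: linear_span_closed)
    have ab: "u a \<odot>\<^bsub>linear_span K S\<^esub> basis_vector a \<in> carrier (linear_span K S)"
      using module.smult_closed[OF module_linear_span c b] .
    have "f ?v = g ?v" by (rule insert.IH[OF _ _ v]) (use insert.prems in auto)
    moreover have "u = (u a \<odot>\<^bsub>linear_span K S\<^esub> basis_vector a) \<oplus>\<^bsub>linear_span K S\<^esub> ?v"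
      using linear_span_closed[OF insert.prems(3)] by (auto simp: basis_vector_def)
    ultimately show ?case
      using K_linearD(2)[OF f ab v] K_linearD(2)[OF g ab v] K_linearD(3)[OF f c b] K_linearD(3)[OF g c b]
        eq insert.prems(1) by (metis insert_subset)
  qed
qed

lemma K_bilinear_eqI:
  assumes f: "K_bilinear K (linear_span K S) (linear_span K T) V f"
    and g: "K_bilinear K (linear_span K S) (linear_span K T) V g"
    and V: "module K V"
    and eq: "\<And>s t. \<lbrakk>s \<in> S; t \<in> T\<rbrakk> \<Longrightarrow> f (basis_vector s) (basis_vector t) = g (basis_vector s) (basis_vector t)"
    and u: "u \<in> carrier (linear_span K S)" and v: "v \<in> carrier (linear_span K T)"
  shows "f u v = g u v"
proof (rule K_linear_eqI[OF K_bilinearD(2)[OF f v] K_bilinearD(2)[OF g v] V _ u])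
  fix s assume s: "s \<in> S"
  note b = basis_vector_mem[OF s]
  show "f (basis_vector s) v = g (basis_vector s) v"
    using eq s by (intro K_linear_eqI[OF K_bilinearD(1)[OF f b] K_bilinearD(1)[OF g b] V _ v])
qed

definition linear_extension :: "('k, 'v) module \<Rightarrow> ('s \<Rightarrow> 'v) \<Rightarrow> ('s \<Rightarrow> 'k) \<Rightarrow> 'v" where
  "linear_extension V c u = finsum V (\<lambda>s. u s \<odot>\<^bsub>V\<^esub> c s) {s. u s \<noteq> \<zero>}"

lemma linear_extension_eq:
  assumes V: "module K V" and u: "u \<in> carrier (linear_span K S)" and c: "\<And>s. s \<in> S \<Longrightarrow> c s \<in> carrier V"
    and A: "finite A" "A \<subseteq> S" "\<And>s. s \<notin> A \<Longrightarrow> u s = \<zero>"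
  shows "linear_extension V c u = finsum V (\<lambda>s. u s \<odot>\<^bsub>V\<^esub> c s) A"
proof -
  interpret V: module K V by fact
  show ?thesis unfolding linear_extension_def
    by (rule V.add.finprod_mono_neutral_cong_left)
      (use A c u in \<open>auto simp: linear_span_closed subset_iff\<close>)
qed

lemma K_linear_linear_extension:
  assumes V: "module K V" and c: "\<And>s. s \<in> S \<Longrightarrow> c s \<in> carrier V"
  shows "K_linear K (linear_span K S) V (linear_extension V c)"
proof (rule K_linearI)
  interpret V: module K V by fact
  interpret S: module K "linear_span K S" by (rule module_linear_span)
  fix u assume u: "u \<in> carrier (linear_span K S)"
  obtain A where A: "finite A" "A \<subseteq> S" "\<And>s. s \<notin> A \<Longrightarrow> u s = \<zero>" using u by (rule linear_span_support) blast
  have eu: "linear_extension V c u = finsum V (\<lambda>s. u s \<odot>\<^bsub>V\<^esub> c s) A"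
    by (rule linear_extension_eq[OF V u c A])
  have cA: "(\<lambda>s. w s \<odot>\<^bsub>V\<^esub> c s) \<in> B \<rightarrow> carrier V" if "w \<in> carrier (linear_span K S)" "B \<subseteq> S" for w B
    using that c by (auto simp: linear_span_closed)
  show "linear_extension V c u \<in> carrier V" unfolding eu using cA[OF u A(2)] by (rule V.finsum_closed)
  {
    fix v assume v: "v \<in> carrier (linear_span K S)"
    obtain B where B: "finite B" "B \<subseteq> S" "\<And>s. s \<notin> B \<Longrightarrow> v s = \<zero>" using v by (rule linear_span_support) blast
    have AB: "finite (A \<union> B)" "A \<union> B \<subseteq> S" using A B by auto
    have "linear_extension V c (u \<oplus>\<^bsub>linear_span K S\<^esub> v) =
        finsum V (\<lambda>s. (u \<oplus>\<^bsub>linear_span K S\<^esub> v) s \<odot>\<^bsub>V\<^esub> c s) (A \<union> B)"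
      using A B by (intro linear_extension_eq[OF V _ c AB] S.a_closed u v) auto
    also have "\<dots> = finsum V (\<lambda>s. u s \<odot>\<^bsub>V\<^esub> c s \<oplus>\<^bsub>V\<^esub> v s \<odot>\<^bsub>V\<^esub> c s) (A \<union> B)"
      using cA[OF u AB(2)] cA[OF v AB(2)] AB c u v
      by (intro V.finsum_cong') (auto simp: linear_span_closed V.smult_l_distr subset_iff)
    also have "\<dots> = finsum V (\<lambda>s. u s \<odot>\<^bsub>V\<^esub> c s) (A \<union> B) \<oplus>\<^bsub>V\<^esub> finsum V (\<lambda>s. v s \<odot>\<^bsub>V\<^esub> c s) (A \<union> B)"
      by (rule V.finsum_addf[OF cA[OF u AB(2)] cA[OF v AB(2)]])
    also have "\<dots> = linear_extension V c u \<oplus>\<^bsub>V\<^esub> linear_extension V c v"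
      using linear_extension_eq[OF V u c AB] linear_extension_eq[OF V v c AB] A B by simp
    finally show "linear_extension V c (u \<oplus>\<^bsub>linear_span K S\<^esub> v) =
      linear_extension V c u \<oplus>\<^bsub>V\<^esub> linear_extension V c v" .
  next
    fix r assume r: "r \<in> carrier K"
    have ru: "r \<odot>\<^bsub>linear_span K S\<^esub> u \<in> carrier (linear_span K S)" using S.smult_closed[OF r u] .
    have "linear_extension V c (r \<odot>\<^bsub>linear_span K S\<^esub> u) = finsum V (\<lambda>s. (r \<odot>\<^bsub>linear_span K S\<^esub> u) s \<odot>\<^bsub>V\<^esub> c s) A"
      using A r by (intro linear_extension_eq[OF V ru c A(1,2)]) auto
    also have "\<dots> = finsum V (\<lambda>s. r \<odot>\<^bsub>V\<^esub> (u s \<odot>\<^bsub>V\<^esub> c s)) A"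
      using A c u r by (intro V.finsum_cong') (auto simp: linear_span_closed V.smult_assoc1 subset_iff)
    also have "\<dots> = r \<odot>\<^bsub>V\<^esub> linear_extension V c u"
      unfolding eu using V.finsum_smult_ldistr[OF A(1) r cA[OF u A(2)]] by simp
    finally show "linear_extension V c (r \<odot>\<^bsub>linear_span K S\<^esub> u) = r \<odot>\<^bsub>V\<^esub> linear_extension V c u" .
  }
qed

lemma linear_extension_basis:
  assumes V: "module K V" and c: "c s \<in> carrier V"
  shows "linear_extension V c (basis_vector s) = c s"
proof -
  interpret V: module K V by fact
  have "linear_extension V c (basis_vector s) = finsum V (\<lambda>t. basis_vector s t \<odot>\<^bsub>V\<^esub> c t) {s}"
    using c by (intro linear_extension_eq[OF V basis_vector_mem[of s "{s}"]]) (auto simp: basis_vector_def)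
  also have "\<dots> = c s" using c by (simp add: basis_vector_def)
  finally show ?thesis .
qed

lemma lin_ext_eq:
  assumes u: "u \<in> carrier (linear_span K S)"
    and A: "finite A" "\<And>s. s \<notin> A \<Longrightarrow> u s = \<zero>"
  shows "lin_ext K \<phi> u t = finsum K u {s \<in> A. \<phi> s = t}"
  unfolding lin_ext_def
  by (rule add.finprod_mono_neutral_cong_left) (use A u in \<open>auto simp: linear_span_closed\<close>)

lemma K_linear_lin_ext:
  assumes \<phi>: "\<And>s. s \<in> S \<Longrightarrow> \<phi> s \<in> T"
  shows "K_linear K (linear_span K S) (linear_span K T) (lin_ext K \<phi>)"
proof (rule K_linearI)
  interpret S: module K "linear_span K S" by (rule module_linear_span)
  fix u assume u: "u \<in> carrier (linear_span K S)"
  obtain A where A: "finite A" "A \<subseteq> S" "\<And>s. s \<notin> A \<Longrightarrow> u s = \<zero>" using u by (rule linear_span_support) blast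
  have Pi: "w \<in> B \<rightarrow> carrier K" if "w \<in> carrier (linear_span K S)" for w B
    using that by (auto simp: linear_span_closed)
  have eu: "lin_ext K \<phi> u t = finsum K u {s \<in> A. \<phi> s = t}" for t
    by (rule lin_ext_eq[OF u A(1,3)])
  have empty: "{s \<in> A. \<phi> s = t} = {}" if "t \<notin> \<phi> ` A" for t using that by auto
  have "lin_ext K \<phi> u t = \<zero>" if "t \<notin> \<phi> ` A" for t
    unfolding eu empty[OF that] by simp
  then show "lin_ext K \<phi> u \<in> carrier (linear_span K T)"
    using \<phi> A by (intro linear_span_carrierI[of _ "\<phi> ` A"]) (auto simp: eu intro!: finsum_closed Pi[OF u])
  {
    fix v assume v: "v \<in> carrier (linear_span K S)"
    obtain B where B: "finite B" "B \<subseteq> S" "\<And>s. s \<notin> B \<Longrightarrow> v s = \<zero>" using v by (rule linear_span_support) blast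
    have uv: "(\<lambda>s. u s \<oplus> v s) \<in> carrier (linear_span K S)" using S.a_closed[OF u v] by simp
    have "lin_ext K \<phi> (\<lambda>s. u s \<oplus> v s) t = lin_ext K \<phi> u t \<oplus> lin_ext K \<phi> v t" for t
    proof -
      have "lin_ext K \<phi> (\<lambda>s. u s \<oplus> v s) t = finsum K (\<lambda>s. u s \<oplus> v s) {s \<in> A \<union> B. \<phi> s = t}"
        using A B by (intro lin_ext_eq[OF uv]) auto
      also have "\<dots> = finsum K u {s \<in> A \<union> B. \<phi> s = t} \<oplus> finsum K v {s \<in> A \<union> B. \<phi> s = t}"
        by (rule finsum_addf[OF Pi[OF u] Pi[OF v]])
      also have "finsum K u {s \<in> A \<union> B. \<phi> s = t} = lin_ext K \<phi> u t"
        using A B by (intro lin_ext_eq[OF u, symmetric]) auto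
      also have "finsum K v {s \<in> A \<union> B. \<phi> s = t} = lin_ext K \<phi> v t"
        using A B by (intro lin_ext_eq[OF v, symmetric]) auto
      finally show ?thesis .
    qed
    then show "lin_ext K \<phi> (u \<oplus>\<^bsub>linear_span K S\<^esub> v) = lin_ext K \<phi> u \<oplus>\<^bsub>linear_span K T\<^esub> lin_ext K \<phi> v"
      by (simp add: fun_eq_iff)
  next
    fix r assume r: "r \<in> carrier K"
    have ru: "(\<lambda>s. r \<otimes> u s) \<in> carrier (linear_span K S)" using S.smult_closed[OF r u] by simp
    have "lin_ext K \<phi> (\<lambda>s. r \<otimes> u s) t = r \<otimes> lin_ext K \<phi> u t" for t
    proof -
      have "lin_ext K \<phi> (\<lambda>s. r \<otimes> u s) t = finsum K (\<lambda>s. r \<otimes> u s) {s \<in> A. \<phi> s = t}"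
        using A r by (intro lin_ext_eq[OF ru A(1)]) auto
      also have "\<dots> = r \<otimes> finsum K u {s \<in> A. \<phi> s = t}"
        using A r by (intro finsum_rdistr[symmetric] Pi[OF u]) auto
      finally show ?thesis unfolding eu .
    qed
    then show "lin_ext K \<phi> (r \<odot>\<^bsub>linear_span K S\<^esub> u) = r \<odot>\<^bsub>linear_span K T\<^esub> lin_ext K \<phi> u"
      by (simp add: fun_eq_iff)
  }
qed

lemma lin_ext_basis [simp]: "lin_ext K \<phi> (basis_vector s) = basis_vector (\<phi> s)"
proof
  fix t
  have "lin_ext K \<phi> (basis_vector s) t = finsum K (basis_vector s) {s' \<in> {s}. \<phi> s' = t}"
    by (rule lin_ext_eq[OF basis_vector_mem[of s UNIV]]) (auto simp: basis_vector_def)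
  also have "{s' \<in> {s}. \<phi> s' = t} = (if \<phi> s = t then {s} else {})" by auto
  finally show "lin_ext K \<phi> (basis_vector s) t = basis_vector (\<phi> s) t"
    by (auto simp: basis_vector_def)
qed

abbreviation tensor :: "('r \<Rightarrow> 'k) \<Rightarrow> ('s \<Rightarrow> 'k) \<Rightarrow> 'r \<times> 's \<Rightarrow> 'k" where
  "tensor u v \<equiv> \<lambda>(r, s). u r \<otimes> v s"

text \<open>
  The sum defining a bilinear extension runs over pairs with nonzero coefficients; as K has no zero
  divisors, these are the pairs at which the product of the coefficients is nonzero.
\<close>

lemma bilin_ext_tensor:
  assumes "u \<in> carrier (linear_span K S)" "v \<in> carrier (linear_span K T)"
  shows "bilin_ext K \<phi> u v = lin_ext K (\<lambda>(r, s). \<phi> r s) (tensor u v)"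
proof -
  have "{(r, s). u r \<noteq> \<zero> \<and> v s \<noteq> \<zero> \<and> \<phi> r s = t} =
      {x. tensor u v x \<noteq> \<zero> \<and> (case x of (r, s) \<Rightarrow> \<phi> r s) = t}" for t
    using assms by (auto simp: linear_span_closed integral_iff)
  then show ?thesis by (simp add: bilin_ext_def lin_ext_def)
qed

lemma K_bilinear_tensor:
  "K_bilinear K (linear_span K S) (linear_span K T) (linear_span K (S \<times> T)) tensor"
proof -
  have mem: "tensor u v \<in> carrier (linear_span K (S \<times> T))"
    if u: "u \<in> carrier (linear_span K S)" and v: "v \<in> carrier (linear_span K T)" for u v
  proof -
    obtain A where A: "finite A" "A \<subseteq> S" "\<And>s. s \<notin> A \<Longrightarrow> u s = \<zero>" using u by (rule linear_span_support) blast
    obtain B where B: "finite B" "B \<subseteq> T" "\<And>s. s \<notin> B \<Longrightarrow> v s = \<zero>" using v by (rule linear_span_support) blast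
    have "tensor u v x = \<zero>" if "x \<notin> A \<times> B" for x
    proof -
      obtain r s where x: "x = (r, s)" by (cases x)
      with that consider "u r = \<zero>" | "v s = \<zero>" using A(3) B(3) by auto
      then show ?thesis using linear_span_closed[OF u] linear_span_closed[OF v] by cases (simp_all add: x)
    qed
    then show ?thesis
      using A B linear_span_closed[OF u] linear_span_closed[OF v]
      by (intro linear_span_carrierI[of _ "A \<times> B"]) auto
  qed
  show ?thesis
    unfolding K_bilinear_def
    by (intro conjI ballI K_linearI)
      (auto simp: mem linear_span_closed r_distr l_distr m_lcomm m_assoc fun_eq_iff)
qed

lemma K_bilinear_bilin_ext:
  assumes "\<And>s t. \<lbrakk>s \<in> S; t \<in> T\<rbrakk> \<Longrightarrow> \<phi> s t \<in> U"
  shows "K_bilinear K (linear_span K S) (linear_span K T) (linear_span K U) (bilin_ext K \<phi>)"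
proof -
  have L: "K_linear K (linear_span K (S \<times> T)) (linear_span K U) (lin_ext K (\<lambda>(r, s). \<phi> r s))"
    using assms by (intro K_linear_lin_ext) auto
  show ?thesis
    unfolding K_bilinear_def
  proof (intro conjI ballI)
    fix u assume u: "u \<in> carrier (linear_span K S)"
    have "K_linear K (linear_span K T) (linear_span K U) (\<lambda>v. lin_ext K (\<lambda>(r, s). \<phi> r s) (tensor u v))"
      by (rule K_linear_comp[OF K_bilinearD(1)[OF K_bilinear_tensor u] L])
    then show "K_linear K (linear_span K T) (linear_span K U) (bilin_ext K \<phi> u)"
      by (rule K_linear_cong[OF _ _ module_linear_span]) (use bilin_ext_tensor[OF u] in auto)
  next
    fix v assume v: "v \<in> carrier (linear_span K T)"
    have "K_linear K (linear_span K S) (linear_span K U) (\<lambda>u. lin_ext K (\<lambda>(r, s). \<phi> r s) (tensor u v))"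
      by (rule K_linear_comp[OF K_bilinearD(2)[OF K_bilinear_tensor v] L])
    then show "K_linear K (linear_span K S) (linear_span K U) (\<lambda>u. bilin_ext K \<phi> u v)"
      by (rule K_linear_cong[OF _ _ module_linear_span]) (use bilin_ext_tensor[OF _ v] in auto)
  qed
qed

lemma bilin_ext_basis [simp]:
  "bilin_ext K \<phi> (basis_vector r) (basis_vector s) = basis_vector (\<phi> r s)"
proof -
  have "tensor (basis_vector r) (basis_vector s) = basis_vector (r, s)"
    by (auto simp: basis_vector_def fun_eq_iff)
  then show ?thesis
    using bilin_ext_tensor[OF basis_vector_mem[of r UNIV] basis_vector_mem[of s UNIV], of \<phi>] by simp
qed

end

section \<open>The modular operad of linear combinations of symbols\<close>

lemma K_bilinear_comp_left:
  assumes "K_linear K U' U g" "K_bilinear K U V W f"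
  shows "K_bilinear K U' V W (\<lambda>x y. f (g x) y)"
  unfolding K_bilinear_def
proof (intro conjI ballI)
  fix x assume "x \<in> carrier U'"
  then show "K_linear K V W (f (g x))" using K_bilinearD(1)[OF assms(2)] K_linearD(1)[OF assms(1)] by blast
next
  fix y assume "y \<in> carrier V"
  then show "K_linear K U' W (\<lambda>x. f (g x) y)"
    using K_linear_comp[OF assms(1) K_bilinearD(2)[OF assms(2)]] by blast
qed

lemma K_bilinear_swap:
  assumes "K_bilinear K U V W f"
  shows "K_bilinear K V U W (\<lambda>x y. f y x)"
  using assms by (simp add: K_bilinear_def)

lemma K_bilinear_comp_right:
  assumes "K_linear K V' V g" "K_bilinear K U V W f"
  shows "K_bilinear K U V' W (\<lambda>x y. f x (g y))"
  using K_bilinear_swap[OF K_bilinear_comp_left[OF assms(1) K_bilinear_swap[OF assms(2)]]] .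

lemma K_bilinear_comp_post:
  assumes "K_bilinear K U V W f" "K_linear K W X g"
  shows "K_bilinear K U V X (\<lambda>x y. g (f x y))"
  unfolding K_bilinear_def
proof (intro conjI ballI)
  fix x assume "x \<in> carrier U"
  then show "K_linear K V X (\<lambda>y. g (f x y))"
    using K_linear_comp[OF K_bilinearD(1)[OF assms(1)] assms(2)] by blast
next
  fix y assume "y \<in> carrier V"
  then show "K_linear K U X (\<lambda>x. g (f x y))"
    using K_linear_comp[OF K_bilinearD(2)[OF assms(1)] assms(2)] by blast
qed

context coefficient_field
begin

abbreviation graded_span :: "'s set \<Rightarrow> int \<Rightarrow> ('k, 's \<Rightarrow> 'k) module" where
  "graded_span S i \<equiv> linear_span K (if i = 0 then S else {})"

lemma QO_lin_simps:
  "mob (QO_lin K) C G = Cx_obj (graded_span (QO_symbols C G)) (\<lambda>i u s. \<zero>)"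
  "mact (QO_lin K) C G \<rho> i = lin_ext K (relabel \<rho>)"
  "mcomp (QO_lin K) a b C1 G1 C2 G2 i j = bilin_ext K (symbol_comp a b)"
  "mcontr (QO_lin K) a b C G i = lin_ext K (symbol_contr a b)"
  by (simp_all add: QO_lin_def)

lemma lin_ext_zero [simp]: "lin_ext K \<phi> (\<lambda>s. \<zero>) = (\<lambda>t. \<zero>)"
  by (simp add: lin_ext_def)

lemma bilin_ext_zero [simp]:
  "bilin_ext K \<phi> (\<lambda>s. \<zero>) v = (\<lambda>t. \<zero>)" "bilin_ext K \<phi> u (\<lambda>s. \<zero>) = (\<lambda>t. \<zero>)"
  by (simp_all add: bilin_ext_def)

lemma minus_zero_linear_span: "\<ominus>\<^bsub>linear_span K S\<^esub> (\<lambda>s. \<zero>) = (\<lambda>s. \<zero>)"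
proof -
  interpret S: module K "linear_span K S" by (rule module_linear_span)
  show ?thesis using S.minus_equality[of "\<lambda>s. \<zero>" "\<lambda>s. \<zero>"] S.zero_closed by simp
qed

lemma K_linear_act:
  assumes "inj_on \<rho> C" "D = \<rho> ` C"
  shows "K_linear K (graded_span (QO_symbols C G) i) (graded_span (QO_symbols D G) i) (lin_ext K (relabel \<rho>))"
  using assms relabel_mem[of _ C G \<rho>] by (intro K_linear_lin_ext) (auto split: if_splits)

lemma K_linear_contr:
  assumes "contr_ok a b C" "D = C \<union> {a, b}" "H = G + 1"
  shows "K_linear K (graded_span (QO_symbols D G) i) (graded_span (QO_symbols C H) i) (lin_ext K (symbol_contr a b))"
  using symbol_contr_glue(1)[OF _ assms(1), of _ G] unfolding assms(2,3)
  by (intro K_linear_lin_ext) (simp split: if_splits)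

lemma K_bilinear_comp:
  assumes "comp_ok a b C1 C2" "D1 = C1 \<union> {a}" "D2 = C2 \<union> {b}" "D = C1 \<union> C2" "H = G1 + G2" "k = i + j"
  shows "K_bilinear K (graded_span (QO_symbols D1 G1) i) (graded_span (QO_symbols D2 G2) j)
    (graded_span (QO_symbols D H) k) (bilin_ext K (symbol_comp a b))"
  using symbol_comp_glue(1)[OF _ _ assms(1), of _ G1 _ G2] unfolding assms(2-)
  by (intro K_bilinear_bilin_ext) (simp split: if_splits)

lemma is_obj_QO_lin:
  fixes S :: "'a set"
  assumes "M \<in> {Vect, GrVect, Chain}"
  shows "is_obj M K (Cx_obj (graded_span S) (\<lambda>i u s. \<zero>))"
proof -
  have "K_linear K (linear_span K A) (linear_span K B) (\<lambda>u s. \<zero>)" for A B :: "'a set"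
    using K_linear_zero_map[OF module_linear_span, of "linear_span K A" B] by simp
  then have "chain_complex K (graded_span S) (\<lambda>i u s. \<zero>)"
    by (simp add: chain_complex_def module_linear_span)
  then show ?thesis
    using assms by (auto simp: zero_differential_def linear_span_empty)
qed

text \<open>
  Every axiom compares two multilinear maps, which agree because they agree at basis vectors, where the
  axiom is the one for symbols.  In nonzero degrees there are no basis vectors; in particular the
  Koszul signs only affect zero.
\<close>

theorem modular_operad_QO_lin:
  assumes M: "M \<in> {Vect, GrVect, Chain}" and inf: "infinite (UNIV :: 'c set)"
  shows "modular_operad M K (QO_lin K :: ('c, 'k, 'c symbol \<Rightarrow> 'k) modop)"
proof (unfold_locales, unfold QO_lin_simps elems.simps, goal_cases)
  case 1 show ?case by (rule is_obj_QO_lin[OF M])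
next
  case (2 C \<rho> \<sigma> x G i)
  have im: "\<rho> ` C = \<sigma> ` C" using 2(3) by auto
  have inj: "inj_on \<sigma> C" using 2(2,3) inj_on_cong[of C \<rho> \<sigma>] by simp
  show ?case
    by (rule K_linear_eqI[OF K_linear_act[OF 2(2) refl] K_linear_act[OF inj im] module_linear_span _ 2(4)])
      (use relabel_cong[OF _ 2(3)] in \<open>simp split: if_splits\<close>)
next
  case 3 show ?case using K_linear_act[OF 3(2) refl] by simp
next
  case 4 show ?case using K_bilinear_comp[OF 4 refl refl refl refl refl]
    by (simp add: minus_zero_linear_span)
next
  case 5 show ?case using K_linear_contr[OF 5 refl refl] by simp
next
  case (6 a b C x G i)
  have ok: "contr_ok b a C" "C \<union> {a, b} = C \<union> {b, a}" using 6(1) by (auto simp: contr_ok_def)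
  show ?case
    by (rule K_linear_eqI[OF K_linear_contr[OF 6(1) refl refl] K_linear_contr[OF ok refl] module_linear_span _ 6(2)])
      (use symbol_contr_sym[OF 6(1)] in \<open>simp split: if_splits\<close>)
next
  case (7 a b C1 C2 x G1 i y G2 j)
  have ok: "comp_ok b a C2 C1" using 7(1) by (auto simp: comp_ok_def)
  show ?case
  proof (cases "odd i \<and> odd j")
    case True
    then have "i \<noteq> 0" by auto
    then have "x = (\<lambda>s. \<zero>)" using 7(2) by (simp add: linear_span_empty)
    then show ?thesis using True by (simp add: minus_zero_linear_span)
  next
    case False
    have "bilin_ext K (symbol_comp a b) x y = bilin_ext K (symbol_comp b a) y x"
    proof (rule K_bilinear_eqI[OF K_bilinear_comp[OF 7(1) refl refl refl refl refl]
          K_bilinear_swap[OF K_bilinear_comp[OF ok refl refl _ _ _]] module_linear_span _ 7(2,3)])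
    qed (use symbol_comp_sym[OF 7(1)] in \<open>auto split: if_splits\<close>)
    then show ?thesis using False by auto
  qed
next
  case (8 C x G i)
  have id: "K_linear K (graded_span (QO_symbols C G) i) (graded_span (QO_symbols C G) i) (\<lambda>x. x)"
    by (simp add: K_linear_def)
  show ?case
    by (rule K_linear_eqI[OF K_linear_act[of id C C] id module_linear_span _ 8(2)]) simp_all
next
  case (9 C \<sigma> \<rho> x G i)
  have inj: "inj_on (\<rho> \<circ> \<sigma>) C" "(\<rho> \<circ> \<sigma>) ` C = \<rho> ` \<sigma> ` C" using comp_inj_on[OF 9(2,3)] by auto
  show ?case
    by (rule K_linear_eqI[OF K_linear_act[OF inj(1) inj(2)[symmetric]]
        K_linear_comp[OF K_linear_act[OF 9(2) refl] K_linear_act[OF 9(3) refl]] module_linear_span _ 9(4)])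
      (simp add: relabel_comp)
next
  case (10 a b C1 C2 \<rho> \<sigma> x G1 i y G2 j)
  note ok = comp_ok_image[OF 10(1-4)]
  have inj: "inj_on (join_bij C1 \<rho> \<sigma>) (C1 \<union> C2)" "\<rho> ` C1 \<union> \<sigma> ` C2 = join_bij C1 \<rho> \<sigma> ` (C1 \<union> C2)"
    using inj_on_join_bij[OF 10(1-4)] by simp_all
  show ?case
    by (rule K_bilinear_eqI[OF
        K_bilinear_comp_post[OF K_bilinear_comp[OF 10(1) refl refl refl refl refl] K_linear_act[OF inj]]
        K_bilinear_comp_left[OF K_linear_act[OF 10(2)]
          K_bilinear_comp_right[OF K_linear_act[OF 10(3)] K_bilinear_comp[OF ok refl refl refl refl refl]]]
        module_linear_span _ 10(5,6)])
      (use relabel_symbol_comp[OF 10(1-4)] in \<open>auto split: if_splits\<close>)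
next
  case (11 a b C \<rho> x G i)
  show ?case
    by (rule K_linear_eqI[OF
        K_linear_comp[OF K_linear_contr[OF 11(1) refl refl] K_linear_act[OF inj_on_subset[OF 11(2), of C] refl]]
        K_linear_comp[OF K_linear_act[OF 11(2) refl] K_linear_contr[OF contr_ok_image[OF 11(1,2)] _ refl]]
        module_linear_span _ 11(3)])
      (use relabel_contr[OF 11(1,2)] in \<open>auto split: if_splits\<close>)
next
  case (12 c d C a b x G i)
  show ?case
    by (rule K_linear_eqI[OF
        K_linear_comp[OF K_linear_contr[OF 12(1) _ refl] K_linear_contr[OF 12(2) refl refl]]
        K_linear_comp[OF K_linear_contr[OF 12(3) _ refl] K_linear_contr[OF 12(4) refl refl]]
        module_linear_span _ 12(5)])
      (use symbol_contr_contr[OF 12(1-4)] in \<open>auto split: if_splits\<close>)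
next
  case (13 c d C1 a C2 b x G1 i y G2 j)
  show ?case
    by (rule K_bilinear_eqI[OF
        K_bilinear_comp_post[OF K_bilinear_comp[OF 13(1) _ _ _ refl refl] K_linear_contr[OF 13(2) refl refl]]
        K_bilinear_comp_post[OF K_bilinear_comp[OF 13(3) _ _ _ refl refl] K_linear_contr[OF 13(4) refl refl]]
        module_linear_span _ 13(5,6)])
      (use symbol_contr_comp_exchange[OF inf 13(1-4)] in \<open>auto split: if_splits\<close>)
next
  case (14 c d C1 a b C2 x G1 i y G2 j)
  show ?case
    by (rule K_bilinear_eqI[OF
        K_bilinear_comp_left[OF K_linear_contr[OF 14(1) _ refl] K_bilinear_comp[OF 14(2) refl refl refl _ refl]]
        K_bilinear_comp_post[OF K_bilinear_comp[OF 14(3) _ refl _ refl refl] K_linear_contr[OF 14(4) refl]]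
        module_linear_span _ 14(5,6)])
      (use symbol_comp_contr[OF inf 14(1-4)] in \<open>auto split: if_splits\<close>)
next
  case (15 c d C2 b C3 a C1 x G1 i y G2 j z G3 k)
  let ?S = "\<lambda>C G. graded_span (QO_symbols C G)"
  let ?ab = "bilin_ext K (symbol_comp a b)" and ?cd = "bilin_ext K (symbol_comp c d)"
  have yz: "K_bilinear K (?S (C2 \<union> {b, c}) G2 j) (?S (C3 \<union> {d}) G3 k)
      (?S (C2 \<union> C3 \<union> {b}) (G2 + G3) (j + k)) ?cd"
    by (rule K_bilinear_comp[OF 15(1)]) auto
  have xy: "K_bilinear K (?S (C1 \<union> {a}) G1 i) (?S (C2 \<union> {b, c}) G2 j)
      (?S (C1 \<union> C2 \<union> {c}) (G1 + G2) (i + j)) ?ab"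
    by (rule K_bilinear_comp[OF 15(3)]) auto
  have x_yz: "K_bilinear K (?S (C1 \<union> {a}) G1 i) (?S (C2 \<union> C3 \<union> {b}) (G2 + G3) (j + k))
      (?S (C1 \<union> C2 \<union> C3) (G1 + G2 + G3) (i + j + k)) ?ab"
    by (rule K_bilinear_comp[OF 15(2)]) auto
  have xy_z: "K_bilinear K (?S (C1 \<union> C2 \<union> {c}) (G1 + G2) (i + j)) (?S (C3 \<union> {d}) G3 k)
      (?S (C1 \<union> C2 \<union> C3) (G1 + G2 + G3) (i + j + k)) ?cd"
    by (rule K_bilinear_comp[OF 15(4)]) auto
  show ?case
  proof (rule K_bilinear_eqI[OF K_bilinear_comp_right[OF K_bilinearD(2)[OF yz 15(7)] x_yz]
        K_bilinear_comp_post[OF xy K_bilinearD(2)[OF xy_z 15(7)]] module_linear_span _ 15(5,6)])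
    fix s t
    assume s: "s \<in> (if i = 0 then QO_symbols (C1 \<union> {a}) G1 else {})"
      and t: "t \<in> (if j = 0 then QO_symbols (C2 \<union> {b, c}) G2 else {})"
    note s' = basis_vector_mem[OF s] and t' = basis_vector_mem[OF t]
    note st' = K_linearD(1)[OF K_bilinearD(1)[OF xy s'] t']
    show "?ab (basis_vector s) (?cd (basis_vector t) z) =
        ?cd (?ab (basis_vector s) (basis_vector t)) z"
      by (rule K_linear_eqI[OF K_linear_comp[OF K_bilinearD(1)[OF yz t'] K_bilinearD(1)[OF x_yz s']]
          K_bilinearD(1)[OF xy_z st'] module_linear_span _ 15(7)])
        (use symbol_comp_assoc[OF 15(1-4)] s t in \<open>auto split: if_splits\<close>)
  qed
qed

end

section \<open>Uniqueness of modular envelopes\<close>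

lemma base_hom_id: "base_hom K X X (\<lambda>i x. x)"
  by (cases X) (simp_all add: K_linear_def)

lemma base_hom_comp:
  assumes f: "base_hom K X Y f" and g: "base_hom K Y Z g"
  shows "base_hom K X Z (\<lambda>i x. g i (f i x))"
proof (cases X)
  case X: (Set_obj A)
  with f obtain B where Y: "Y = Set_obj B" by (cases Y) simp_all
  with g obtain D where "Z = Set_obj D" by (cases Z) simp_all
  with X Y f g show ?thesis by auto
next
  case X: (Cx_obj U c)
  with f obtain V d where Y: "Y = Cx_obj V d" by (cases Y) simp_all
  with g obtain W e where Z: "Z = Cx_obj W e" by (cases Z) simp_all
  have L: "K_linear K (U i) (V i) (f i)" "K_linear K (V i) (W i) (g i)" for i
    using f g by (simp_all add: X Y Z)
  show ?thesis using f g by (auto simp: X Y Z K_linear_comp[OF L] K_linearD(1)[OF L(1)])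
qed

lemma cyclic_morphism_id: "cyclic_morphism K A A (\<lambda>C i x. x)"
  by (simp add: cyclic_morphism_def base_hom_id)

lemma modular_morphism_id: "modular_morphism K P P (\<lambda>C G i x. x)"
  by (simp add: modular_morphism_def base_hom_id)

lemma modular_morphism_comp:
  fixes P :: "('c, 'k, 'u) modop"
  assumes f: "modular_morphism K P Q f" and g: "modular_morphism K Q R g"
  shows "modular_morphism K P R (\<lambda>C G i x. g C G i (f C G i x))"
  unfolding modular_morphism_def
proof (intro conjI allI ballI impI)
  fix C :: "'c set" and G assume "finite C"
  then show "base_hom K (mob P C G) (mob R C G) (\<lambda>i x. g C G i (f C G i x))"
    using base_hom_comp[OF modular_morphismD(1)[OF f] modular_morphismD(1)[OF g]] by blast
next
  fix C G i x and \<rho> :: "'c \<Rightarrow> 'c" assume "x \<in> elems (mob P C G) i" "finite C" "inj_on \<rho> C"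
  then show "g (\<rho> ` C) G i (f (\<rho> ` C) G i (mact P C G \<rho> i x)) = mact R C G \<rho> i (g C G i (f C G i x))"
    using base_hom_elems[OF modular_morphismD(1)[OF f]]
    by (simp add: modular_morphismD(2)[OF f] modular_morphismD(2)[OF g])
next
  fix a b C1 G1 C2 G2 i j x y
  assume ok: "comp_ok a b C1 C2" and x: "x \<in> elems (mob P (C1 \<union> {a}) G1) i"
    and y: "y \<in> elems (mob P (C2 \<union> {b}) G2) j"
  have fin: "finite (C1 \<union> {a})" "finite (C2 \<union> {b})" using ok by (simp_all add: comp_ok_def)
  note x' = base_hom_elems[OF modular_morphismD(1)[OF f fin(1)] x]
    and y' = base_hom_elems[OF modular_morphismD(1)[OF f fin(2)] y]
  show "g (C1 \<union> C2) (G1 + G2) (i + j) (f (C1 \<union> C2) (G1 + G2) (i + j) (mcomp P a b C1 G1 C2 G2 i j x y)) =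
      mcomp R a b C1 G1 C2 G2 i j (g (C1 \<union> {a}) G1 i (f (C1 \<union> {a}) G1 i x))
        (g (C2 \<union> {b}) G2 j (f (C2 \<union> {b}) G2 j y))"
    unfolding modular_morphismD(3)[OF f ok x y] modular_morphismD(3)[OF g ok x' y'] ..
next
  fix a b C G i x
  assume ok: "contr_ok a b C" and x: "x \<in> elems (mob P (C \<union> {a, b}) G) i"
  have fin: "finite (C \<union> {a, b})" using ok by (simp add: contr_ok_def)
  note x' = base_hom_elems[OF modular_morphismD(1)[OF f fin] x]
  show "g C (G + 1) i (f C (G + 1) i (mcontr P a b C G i x)) =
      mcontr R a b C G i (g (C \<union> {a, b}) G i (f (C \<union> {a, b}) G i x))"
    unfolding modular_morphismD(4)[OF f ok x] modular_morphismD(4)[OF g ok x'] ..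
qed

lemma extends_comp:
  assumes f: "extends K A \<eta> Q P \<theta> f" and g: "extends K A \<theta> P R \<zeta> g"
  shows "extends K A \<eta> Q R \<zeta> (\<lambda>C G i x. g C G i (f C G i x))"
  using modular_morphism_comp[of K Q P f R g] f g by (simp add: extends_def)

lemma extends_id:
  "extends K A \<eta> Q Q \<eta> (\<lambda>C G i x. x)"
  by (simp add: extends_def modular_morphism_id)

lemma unique_extensionD:
  assumes "unique_extension K A \<eta> Q P f" "extends K A \<eta> Q P f g" "extends K A \<eta> Q P f h"
    and "finite C" "x \<in> elems (mob Q C G) i"
  shows "g C G i x = h C G i x"
proof -
  obtain k where k: "\<And>h. extends K A \<eta> Q P f h \<Longrightarrow>
      \<forall>C G i. finite C \<longrightarrow> (\<forall>x\<in>elems (mob Q C G) i. h C G i x = k C G i x)"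
    using assms(1) unfolding unique_extension_def by blast
  show ?thesis using k[OF assms(2)] k[OF assms(3)] assms(4,5) by simp
qed

text \<open>
  Universal arrows from A are unique up to isomorphism.  The universal property of Q is needed for
  targets over two types of elements, those of E and those of Q itself.
\<close>

theorem modular_envelope_unique:
  fixes Q :: "('c, 'k, 'q) modop" and E :: "('c, 'k, 'e) modop"
  assumes Q: "modular_operad M K Q" "cyclic_morphism K A (cyclic_part Q) \<eta>"
    and QE: "\<And>(P :: ('c, 'k, 'e) modop) f. \<lbrakk>modular_operad M K P; cyclic_morphism K A (cyclic_part P) f\<rbrakk>
      \<Longrightarrow> unique_extension K A \<eta> Q P f"
    and QQ: "unique_extension K A \<eta> Q Q \<eta>"
    and EE: "modular_envelope_for TYPE('e) M K A E \<theta>"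
    and EQ: "modular_envelope_for TYPE('q) M K A E \<theta>"
  shows "modular_isomorphic K Q E"
proof -
  have E: "modular_operad M K E" "cyclic_morphism K A (cyclic_part E) \<theta>"
    using EE by (simp_all add: modular_envelope_for_def)
  obtain \<phi> where \<phi>: "extends K A \<eta> Q E \<theta> \<phi>" using QE[OF E] by (auto simp: unique_extension_def)
  have "unique_extension K A \<theta> E Q \<eta>" using EQ Q by (simp add: modular_envelope_for_def)
  then obtain \<psi> where \<psi>: "extends K A \<theta> E Q \<eta> \<psi>" by (auto simp: unique_extension_def)
  have uE: "unique_extension K A \<theta> E E \<theta>" using EE E by (simp add: modular_envelope_for_def)
  show ?thesis
    unfolding modular_isomorphic_def
  proof (intro exI conjI allI ballI impI)
    show "modular_morphism K Q E \<phi>" "modular_morphism K E Q \<psi>"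
      using \<phi> \<psi> by (simp_all add: extends_def)
    show "\<psi> C G i (\<phi> C G i x) = x" if "finite C" "x \<in> elems (mob Q C G) i" for C G i x
      by (rule unique_extensionD[OF QQ extends_comp[OF \<phi> \<psi>] extends_id that])
    show "\<phi> C G i (\<psi> C G i x) = x" if "finite C" "x \<in> elems (mob E C G) i" for C G i x
      by (rule unique_extensionD[OF uE extends_comp[OF \<psi> \<phi>] extends_id that])
  qed
qed

section \<open>The modular operad of degree 0 cycles\<close>

text \<open>
  The cycles of degree 0, that is, the morphisms into X from the unit of the monoidal structure.
\<close>

fun zero_cycles :: "('k, 'v) obj \<Rightarrow> 'v set" where
  "zero_cycles (Set_obj A) = A"
| "zero_cycles (Cx_obj V d) = {x \<in> carrier (V 0). d 0 x = \<zero>\<^bsub>V (- 1)\<^esub>}"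

lemma zero_cycles_elems: "x \<in> zero_cycles X \<Longrightarrow> x \<in> elems X 0"
  by (cases X) simp_all

lemma is_obj_Cx: "is_obj M K (Cx_obj V d) \<Longrightarrow> chain_complex K V d"
  by (cases M) simp_all

lemma base_hom_zero_cycles:
  assumes f: "base_hom K X Y f" and X: "is_obj M K X" and Y: "is_obj M K Y" and x: "x \<in> zero_cycles X"
  shows "f 0 x \<in> zero_cycles Y"
proof (cases X)
  case (Set_obj A)
  then obtain B where "Y = Set_obj B" using f by (cases Y) simp_all
  then show ?thesis using f x Set_obj by auto
next
  case XU: (Cx_obj U c)
  then obtain V d where YV: "Y = Cx_obj V d" using f by (cases Y) simp_all
  have mod: "module K (U i)" "module K (V i)" for i
    using is_obj_Cx X Y unfolding XU YV chain_complex_def by blast+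
  have L: "K_linear K (U i) (V i) (f i)" "\<And>x. x \<in> carrier (U i) \<Longrightarrow> f (i - 1) (c i x) = d i (f i x)" for i
    using f by (simp_all add: XU YV)
  have "d 0 (f 0 x) = f (- 1) \<zero>\<^bsub>U (- 1)\<^esub>" using L(2)[of x 0] x by (simp add: XU)
  also have "\<dots> = \<zero>\<^bsub>V (- 1)\<^esub>" using K_linear_zero[OF L(1) mod] .
  finally show ?thesis using K_linearD(1)[OF L(1)[of 0]] x by (simp add: XU YV)
qed

lemma base_bihom_zero_cycles:
  assumes f: "base_bihom K X Y Z f" and X: "is_obj M K X" and Y: "is_obj M K Y" and Z: "is_obj M K Z"
    and x: "x \<in> zero_cycles X" and y: "y \<in> zero_cycles Y"
  shows "f 0 0 x y \<in> zero_cycles Z"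
proof (cases X)
  case (Set_obj A)
  then obtain B D where "Y = Set_obj B" "Z = Set_obj D" using f by (cases Y; cases Z) simp_all
  then show ?thesis using f x y Set_obj by auto
next
  case XU: (Cx_obj U c)
  then obtain V d W e where YZ: "Y = Cx_obj V d" "Z = Cx_obj W e" using f by (cases Y; cases Z) simp_all
  have mod: "module K (U i)" "module K (V i)" "module K (W i)" for i
    using is_obj_Cx X Y Z unfolding XU YZ chain_complex_def by blast+
  interpret W: module K "W (- 1)" by (rule mod)
  have xy: "x \<in> carrier (U 0)" "y \<in> carrier (V 0)" "c 0 x = \<zero>\<^bsub>U (- 1)\<^esub>" "d 0 y = \<zero>\<^bsub>V (- 1)\<^esub>"
    using x y by (simp_all add: XU YZ)
  have B: "K_bilinear K (U i) (V j) (W (i + j)) (f i j)" for i j using f by (simp add: XU YZ)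
  have "\<forall>x\<in>carrier (U 0). \<forall>y\<in>carrier (V 0). e (0 + 0) (f 0 0 x y) =
      f (0 - 1) 0 (c 0 x) y \<oplus>\<^bsub>W (0 + 0 - 1)\<^esub>
      (if even (0 :: int) then f 0 (0 - 1) x (d 0 y) else \<ominus>\<^bsub>W (0 + 0 - 1)\<^esub> f 0 (0 - 1) x (d 0 y))"
    using f unfolding XU YZ base_bihom.simps by blast
  then have "e 0 (f 0 0 x y) = f (- 1) 0 (c 0 x) y \<oplus>\<^bsub>W (- 1)\<^esub> f 0 (- 1) x (d 0 y)"
    using xy(1,2) by simp
  also have "f (- 1) 0 (c 0 x) y = \<zero>\<^bsub>W (- 1)\<^esub>"
    using K_linear_zero[OF K_bilinearD(2)[OF B[of "- 1" 0] xy(2)] mod(1) mod(3)] xy(3) by simp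
  also have "f 0 (- 1) x (d 0 y) = \<zero>\<^bsub>W (- 1)\<^esub>"
    using K_linear_zero[OF K_bilinearD(1)[OF B[of 0 "- 1"] xy(1)] mod(2) mod(3)] xy(4) by simp
  finally have "e 0 (f 0 0 x y) = \<zero>\<^bsub>W (- 1)\<^esub>" by simp
  moreover have "f 0 0 x y \<in> carrier (W 0)"
    using K_linearD(1)[OF K_bilinearD(1)[OF B[of 0 0] xy(1)] xy(2)] by simp
  ultimately show ?thesis by (simp add: YZ)
qed

text \<open>
  The modular operad in sets formed by the degree 0 cycles of P, with the structure maps of P in
  degree 0.  Taking cycles only, rather than all elements of degree 0, is what makes linear extensions
  of maps into it chain maps, as symbols have zero differential.
\<close>

definition underlying :: "('c, 'k, 'v) modop \<Rightarrow> ('c, 'k, 'v) modop" where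
  "underlying P = P\<lparr>mob := \<lambda>C G. Set_obj (zero_cycles (mob P C G))\<rparr>"

lemma underlying_simps:
  "mob (underlying P) C G = Set_obj (zero_cycles (mob P C G))"
  "mact (underlying P) = mact P"
  "mcomp (underlying P) = mcomp P"
  "mcontr (underlying P) = mcontr P"
  by (simp_all add: underlying_def)

text \<open>
  Chain maps preserve cycles and, by the Leibniz rule, so do the compositions.  The axioms are
  those of P in degree 0, where the Koszul sign is trivial.
\<close>

lemma modular_operad_underlying:
  assumes "modular_operad M K P"
  shows "modular_operad Sets K (underlying P)"
proof -
  interpret modular_operad M K P by fact
  note z = zero_cycles_elems
  show ?thesis
  proof (unfold_locales, unfold underlying_simps elems_Set_obj, goal_cases)
    case 1 show ?case by simp
  next
    case (2 C \<rho> \<sigma> x G i)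
    then have x: "i = 0" "x \<in> elems (mob P C G) 0" by (auto intro: z)
    show ?case using act_cong[OF 2(1-3) x(2)] x(1) by simp
  next
    case (3 C \<rho> G)
    have "finite (\<rho> ` C)" using 3 by simp
    then show ?case using base_hom_zero_cycles[OF act_hom[OF 3] obj[OF 3(1)] obj] by simp
  next
    case (4 a b C1 C2 G1 G2)
    then have fin: "finite (C1 \<union> {a})" "finite (C2 \<union> {b})" "finite (C1 \<union> C2)" by (simp_all add: comp_ok_def)
    show ?case using base_bihom_zero_cycles[OF comp_hom[OF 4] obj[OF fin(1)] obj[OF fin(2)] obj[OF fin(3)]] by simp
  next
    case (5 a b C G)
    then have fin: "finite (C \<union> {a, b})" "finite C" by (simp_all add: contr_ok_def)
    show ?case using base_hom_zero_cycles[OF contr_hom[OF 5] obj[OF fin(1)] obj[OF fin(2)]] by simp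
  next
    case (6 a b C x G i)
    then show ?case using contr_sym[OF 6(1) z, of x G] by blast
  next
    case (7 a b C1 C2 x G1 i y G2 j)
    then show ?case using comp_sym[OF 7(1) z z, of x G1 y G2] by simp
  next
    case (8 C x G i)
    then show ?case using act_id[OF 8(1) z, of x G] by blast
  next
    case (9 C \<sigma> \<rho> x G i)
    then show ?case using act_comp[OF 9(1-3) z, of x G] by blast
  next
    case (10 a b C1 C2 \<rho> \<sigma> x G1 i y G2 j)
    then show ?case using comp_act[OF 10(1-4) z z, of x G1 y G2] by simp
  next
    case (11 a b C \<rho> x G i)
    then show ?case using contr_act[OF 11(1,2) z, of x G] by blast
  next
    case (12 c d C a b x G i)
    then show ?case using contr_contr[OF 12(1-4) z, of x G] by blast
  next
    case (13 c d C1 a C2 b x G1 i y G2 j)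
    then show ?case using contr_comp_exchange[OF 13(1-4) z z, of x G1 y G2] by simp
  next
    case (14 c d C1 a b C2 x G1 i y G2 j)
    then show ?case using comp_contr[OF 14(1-4) z z, of x G1 y G2] by simp
  next
    case (15 c d C2 b C3 a C1 x G1 i y G2 j w G3 k)
    then show ?case using comp_assoc[OF 15(1-4) z z z, of x G1 y G2 w G3] by simp
  qed
qed

section \<open>The universal property\<close>

theorem unique_extension_QO_set:
  fixes P :: "('c, 'k, 'v) modop"
  assumes "infinite (UNIV :: 'c set)" "modular_operad Sets K P" "cyclic_morphism K Ass_set (cyclic_part P) f"
  shows "unique_extension K Ass_set Ass_incl QO_set P f"
proof -
  interpret ass_morphism K P f
    using assms by (simp add: ass_morphism_def ass_morphism_axioms_def)
  show ?thesis
    unfolding unique_extension_def QO_set_simps elems_Set_obj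
    using extends_extension extends_unique by (intro exI[of _ "\<lambda>C G i. extension G C"]) auto
qed

context coefficient_field
begin

lemma basis_vector_zero_cycle:
  "s \<in> QO_symbols C G \<Longrightarrow> basis_vector s \<in> zero_cycles (mob (QO_lin K) C G)"
  using basis_vector_mem[of s "QO_symbols C G"] by (simp add: QO_lin_simps)

lemma Ass_lin_simps:
  "cob (Ass_lin K) C = mob (QO_lin K) C 0"
  "cact (Ass_lin K) C = mact (QO_lin K) C 0"
  "ccomp (Ass_lin K) a b C1 C2 = mcomp (QO_lin K) a b C1 0 C2 0"
  by (simp_all add: Ass_lin_def cyclic_part_def)

lemma QO_lin_elems: "x \<in> elems (mob (QO_lin K) C G) i \<longleftrightarrow> x \<in> carrier (graded_span (QO_symbols C G) i)"
  by (simp add: QO_lin_simps)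

lemma basis_vector_elems: "s \<in> QO_symbols C G \<Longrightarrow> basis_vector s \<in> elems (mob (QO_lin K) C G) 0"
  by (rule zero_cycles_elems[OF basis_vector_zero_cycle])

text \<open>
  Restricting a linear morphism to basis vectors gives a morphism in sets; this brings the linear
  problem down to the one already solved.
\<close>

lemma cyclic_morphism_on_basis:
  fixes P :: "('c, 'k, 'v) modop"
  assumes M: "M \<in> {Vect, GrVect, Chain}" and inf: "infinite (UNIV :: 'c set)"
    and P: "modular_operad M K P" and f: "cyclic_morphism K (Ass_lin K) (cyclic_part P) f"
  shows "cyclic_morphism K Ass_set (cyclic_part (underlying P)) (\<lambda>C i s. f C 0 (basis_vector s))"
proof -
  interpret Q: modular_operad M K "QO_lin K :: ('c, 'k, 'c symbol \<Rightarrow> 'k) modop"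
    by (rule modular_operad_QO_lin[OF M inf])
  interpret P: modular_operad M K P by fact
  note b = basis_vector_elems
  note s = cyclic_part_simps Ass_lin_simps
  show ?thesis
    unfolding cyclic_morphism_def Ass_set_simps cyclic_part_simps underlying_simps elems_Set_obj
  proof (intro conjI allI ballI impI)
    fix C :: "'c set" assume fin: "finite C"
    show "base_hom K (Set_obj (QO_symbols C 0)) (Set_obj (zero_cycles (mob P C 0))) (\<lambda>i s. f C 0 (basis_vector s))"
      using base_hom_zero_cycles[OF cyclic_morphismD(1)[OF f fin, unfolded s] Q.obj[OF fin] P.obj[OF fin]
          basis_vector_zero_cycle] by simp
  next
    fix C i x and \<rho> :: "'c \<Rightarrow> 'c" assume x: "x \<in> elems (Set_obj (QO_symbols C 0) :: ('k, 'c symbol) obj) i"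
      and *: "finite C" "inj_on \<rho> C"
    then have "x \<in> QO_symbols C 0" by (simp split: if_splits)
    from cyclic_morphismD(2)[OF f *, unfolded s, OF b[OF this]]
    show "f (\<rho> ` C) 0 (basis_vector (relabel \<rho> x)) = mact P C 0 \<rho> i (f C 0 (basis_vector x))"
      using x by (simp add: QO_lin_simps split: if_splits)
  next
    fix a b :: 'c and C1 C2 i j x y
    assume ok: "comp_ok a b C1 C2" and x: "x \<in> elems (Set_obj (QO_symbols (C1 \<union> {a}) 0) :: ('k, 'c symbol) obj) i"
      and y: "y \<in> elems (Set_obj (QO_symbols (C2 \<union> {b}) 0) :: ('k, 'c symbol) obj) j"
    have xy: "x \<in> QO_symbols (C1 \<union> {a}) 0" "y \<in> QO_symbols (C2 \<union> {b}) 0" "i = 0" "j = 0"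
      using x y by (simp_all split: if_splits)
    from cyclic_morphismD(3)[OF f ok, unfolded s, OF b[OF xy(1)] b[OF xy(2)]]
    show "f (C1 \<union> C2) 0 (basis_vector (symbol_comp a b x y)) =
        mcomp P a b C1 0 C2 0 i j (f (C1 \<union> {a}) 0 (basis_vector x)) (f (C2 \<union> {b}) 0 (basis_vector y))"
      by (simp add: QO_lin_simps xy(3,4))
  qed
qed

lemma modular_morphism_on_basis:
  fixes P :: "('c, 'k, 'v) modop"
  assumes M: "M \<in> {Vect, GrVect, Chain}" and inf: "infinite (UNIV :: 'c set)"
    and P: "modular_operad M K P" and h: "modular_morphism K (QO_lin K) P h"
  shows "modular_morphism K QO_set (underlying P) (\<lambda>C G i s. h C G 0 (basis_vector s))"
proof -
  interpret Q: modular_operad M K "QO_lin K :: ('c, 'k, 'c symbol \<Rightarrow> 'k) modop"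
    by (rule modular_operad_QO_lin[OF M inf])
  interpret P: modular_operad M K P by fact
  note b = basis_vector_elems
  show ?thesis
    unfolding modular_morphism_def QO_set_simps underlying_simps
  proof (intro conjI allI ballI impI)
    fix C :: "'c set" and G assume fin: "finite C"
    show "base_hom K (Set_obj (QO_symbols C G)) (Set_obj (zero_cycles (mob P C G))) (\<lambda>i s. h C G 0 (basis_vector s))"
      using base_hom_zero_cycles[OF modular_morphismD(1)[OF h fin] Q.obj[OF fin] P.obj[OF fin]
          basis_vector_zero_cycle] by simp
  next
    fix C G i x and \<rho> :: "'c \<Rightarrow> 'c" assume x: "x \<in> elems (Set_obj (QO_symbols C G) :: ('k, 'c symbol) obj) i"
      and *: "finite C" "inj_on \<rho> C"
    then have "x \<in> QO_symbols C G" by (simp split: if_splits)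
    from modular_morphismD(2)[OF h * b[OF this]]
    show "h (\<rho> ` C) G 0 (basis_vector (relabel \<rho> x)) = mact P C G \<rho> i (h C G 0 (basis_vector x))"
      using x by (simp add: QO_lin_simps split: if_splits)
  next
    fix a b :: 'c and C1 C2 G1 G2 i j x y
    assume ok: "comp_ok a b C1 C2" and x: "x \<in> elems (Set_obj (QO_symbols (C1 \<union> {a}) G1) :: ('k, 'c symbol) obj) i"
      and y: "y \<in> elems (Set_obj (QO_symbols (C2 \<union> {b}) G2) :: ('k, 'c symbol) obj) j"
    have xy: "x \<in> QO_symbols (C1 \<union> {a}) G1" "y \<in> QO_symbols (C2 \<union> {b}) G2" "i = 0" "j = 0"
      using x y by (simp_all split: if_splits)
    from modular_morphismD(3)[OF h ok b[OF xy(1)] b[OF xy(2)]]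
    show "h (C1 \<union> C2) (G1 + G2) 0 (basis_vector (symbol_comp a b x y)) =
        mcomp P a b C1 G1 C2 G2 i j (h (C1 \<union> {a}) G1 0 (basis_vector x)) (h (C2 \<union> {b}) G2 0 (basis_vector y))"
      by (simp add: QO_lin_simps xy(3,4))
  next
    fix a b :: 'c and C G i x
    assume ok: "contr_ok a b C" and x: "x \<in> elems (Set_obj (QO_symbols (C \<union> {a, b}) G) :: ('k, 'c symbol) obj) i"
    have x': "x \<in> QO_symbols (C \<union> {a, b}) G" "i = 0" using x by (simp_all split: if_splits)
    from modular_morphismD(4)[OF h ok b[OF x'(1)]]
    show "h C (G + 1) 0 (basis_vector (symbol_contr a b x)) = mcontr P a b C G i (h (C \<union> {a, b}) G 0 (basis_vector x))"
      by (simp add: QO_lin_simps x'(2))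
  qed
qed

lemma extends_on_basis:
  fixes P :: "('c, 'k, 'v) modop"
  assumes M: "M \<in> {Vect, GrVect, Chain}" and inf: "infinite (UNIV :: 'c set)"
    and P: "modular_operad M K P" and h: "extends K (Ass_lin K) Ass_incl (QO_lin K) P f h"
  shows "extends K Ass_set Ass_incl QO_set (underlying P)
    (\<lambda>C i s. f C 0 (basis_vector s)) (\<lambda>C G i s. h C G 0 (basis_vector s))"
proof -
  have "modular_morphism K (QO_lin K) P h" using h by (simp add: extends_def)
  note m = modular_morphism_on_basis[OF M inf P this]
  have "h C 0 0 (basis_vector s) = f C 0 (basis_vector s)" if "finite C" "s \<in> QO_symbols C 0" for C s
    using h that basis_vector_elems[OF that(2)] by (simp add: extends_def Ass_lin_simps Ass_incl_def)
  then show ?thesis using m by (simp add: extends_def Ass_set_simps Ass_incl_def)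
qed

text \<open>
  The restriction of f to basis vectors extends uniquely to a morphism from symbols to the degree 0
  cycles of P.  Its linear extension is the required morphism, and conversely any extension of f is
  determined by its restriction to basis vectors.
\<close>

theorem unique_extension_QO_lin:
  fixes P :: "('c, 'k, 'v) modop"
  assumes M: "M \<in> {Vect, GrVect, Chain}" and inf: "infinite (UNIV :: 'c set)"
    and P: "modular_operad M K P" and f: "cyclic_morphism K (Ass_lin K) (cyclic_part P) f"
  shows "unique_extension K (Ass_lin K) Ass_incl (QO_lin K) P f"
proof -
  interpret P: modular_operad M K P by fact
  interpret U: ass_morphism K "underlying P" "\<lambda>C i s. f C 0 (basis_vector s)"
    using inf modular_operad_underlying[OF P] cyclic_morphism_on_basis[OF M inf P f]
    by (simp add: ass_morphism_def ass_morphism_axioms_def)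
  define V where "V C G = (case mob P C G of Cx_obj V d \<Rightarrow> V)" for C G
  define d where "d C G = (case mob P C G of Cx_obj V d \<Rightarrow> d)" for C G
  have mob: "mob P C G = Cx_obj (V C G) (d C G)" if "finite C" for C G
    using P.obj[OF that, of G] M by (cases "mob P C G") (auto simp: V_def d_def)
  have chain: "chain_complex K (V C G) (d C G)" if "finite C" for C G
    using is_obj_Cx[of M K "V C G" "d C G"] P.obj[OF that, of G] mob[OF that] by simp
  have mod: "module K (V C G i)" if "finite C" for C G i
    using chain[OF that] by (simp add: chain_complex_def)
  have d_lin: "K_linear K (V C G i) (V C G (i - 1)) (d C G i)" if "finite C" for C G i
    using chain[OF that] by (simp add: chain_complex_def)
  have act_lin: "K_linear K (V C G i) (V (\<rho> ` C) G i) (mact P C G \<rho> i)" if "finite C" "inj_on \<rho> C" for C G i \<rho>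
    using P.act_hom[OF that, of G] mob that by simp
  have contr_lin: "K_linear K (V (C \<union> {a, b}) G i) (V C (G + 1) i) (mcontr P a b C G i)"
    if "contr_ok a b C" for a b C G i
  proof -
    have "finite C" "finite (C \<union> {a, b})" using that by (simp_all add: contr_ok_def)
    then show ?thesis using P.contr_hom[OF that, of G] unfolding mob[OF \<open>finite C\<close>] mob[OF \<open>finite (C \<union> {a, b})\<close>] by simp
  qed
  have comp_bilin: "K_bilinear K (V (C1 \<union> {a}) G1 i) (V (C2 \<union> {b}) G2 j) (V (C1 \<union> C2) (G1 + G2) (i + j))
      (mcomp P a b C1 G1 C2 G2 i j)" if "comp_ok a b C1 C2" for a b C1 C2 G1 G2 i j
  proof -
    have fin: "finite (C1 \<union> {a})" "finite (C2 \<union> {b})" "finite (C1 \<union> C2)" using that by (simp_all add: comp_ok_def)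
    show ?thesis using P.comp_hom[OF that, of G1 G2] unfolding mob[OF fin(1)] mob[OF fin(2)] mob[OF fin(3)] by simp
  qed

  define E where "E C G = U.extension G C" for C G
  have E_cycle: "E C G s \<in> carrier (V C G 0)" "d C G 0 (E C G s) = \<zero>\<^bsub>V C G (- 1)\<^esub>"
    if "s \<in> QO_symbols C G" for C G s
    using U.extension_mem[OF that] QO_symbols_finite[OF that] mob
    by (auto simp: E_def underlying_simps)
  define g where "g C G i = linear_extension (V C G i) (E C G)" for C G and i :: int
  have g_lin: "K_linear K (graded_span (QO_symbols C G) i) (V C G i) (g C G i)" if "finite C" for C G i
    unfolding g_def using E_cycle(1) by (intro K_linear_linear_extension[OF mod[OF that]]) (simp split: if_splits)
  have g_basis: "g C G 0 (basis_vector s) = E C G s" if "s \<in> QO_symbols C G" for C G s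
    unfolding g_def
    by (rule linear_extension_basis[OF mod[OF QO_symbols_finite[OF that]], where c = "E C G", OF E_cycle(1)[OF that]])

  have "modular_morphism K (QO_lin K) P g"
    unfolding modular_morphism_def QO_lin_simps elems.simps
  proof (intro conjI allI ballI impI)
    fix C :: "'c set" and G assume fin: "finite C"
    have "g C G (i - 1) (\<lambda>s. \<zero>) = d C G i (g C G i x)" if x: "x \<in> carrier (graded_span (QO_symbols C G) i)" for i x
    proof -
      have "d C G i (g C G i x) = \<zero>\<^bsub>V C G (i - 1)\<^esub>"
        by (rule K_linear_eqI[OF K_linear_comp[OF g_lin[OF fin] d_lin[OF fin]]
            K_linear_zero_map[OF mod[OF fin]] mod[OF fin] _ x])
          (use g_basis E_cycle(2) in \<open>simp split: if_splits\<close>)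
      moreover have "g C G (i - 1) (\<lambda>s. \<zero>) = \<zero>\<^bsub>V C G (i - 1)\<^esub>"
        using K_linear_zero[OF g_lin[OF fin] module_linear_span mod[OF fin]] by simp
      ultimately show ?thesis by simp
    qed
    then show "base_hom K (Cx_obj (graded_span (QO_symbols C G)) (\<lambda>i u s. \<zero>)) (mob P C G) (g C G)"
      unfolding mob[OF fin] using g_lin[OF fin] by simp
  next
    fix C G i x and \<rho> :: "'c \<Rightarrow> 'c"
    assume x: "x \<in> carrier (graded_span (QO_symbols C G) i)" and fin: "finite C" and inj: "inj_on \<rho> C"
    have fin': "finite (\<rho> ` C)" using fin by simp
    show "g (\<rho> ` C) G i (lin_ext K (relabel \<rho>) x) = mact P C G \<rho> i (g C G i x)"
      by (rule K_linear_eqI[OF K_linear_comp[OF K_linear_act[OF inj refl] g_lin[OF fin']]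
          K_linear_comp[OF g_lin[OF fin] act_lin[OF fin inj]] mod[OF fin'] _ x])
        (use inj U.extension_act in \<open>auto simp: g_basis relabel_mem E_def underlying_simps split: if_splits\<close>)
  next
    fix a b :: 'c and C1 C2 G1 G2 i j x y
    assume ok: "comp_ok a b C1 C2" and x: "x \<in> carrier (graded_span (QO_symbols (C1 \<union> {a}) G1) i)"
      and y: "y \<in> carrier (graded_span (QO_symbols (C2 \<union> {b}) G2) j)"
    have fin: "finite (C1 \<union> {a})" "finite (C2 \<union> {b})" "finite (C1 \<union> C2)" using ok by (simp_all add: comp_ok_def)
    show "g (C1 \<union> C2) (G1 + G2) (i + j) (bilin_ext K (symbol_comp a b) x y) =
        mcomp P a b C1 G1 C2 G2 i j (g (C1 \<union> {a}) G1 i x) (g (C2 \<union> {b}) G2 j y)"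
    proof (rule K_bilinear_eqI[OF
          K_bilinear_comp_post[OF K_bilinear_comp[OF ok refl refl refl refl refl] g_lin[OF fin(3)]]
          K_bilinear_comp_left[OF g_lin[OF fin(1)] K_bilinear_comp_right[OF g_lin[OF fin(2)] comp_bilin[OF ok]]]
          mod[OF fin(3)] _ x y])
      fix s t assume "s \<in> (if i = 0 then QO_symbols (C1 \<union> {a}) G1 else {})"
        and "t \<in> (if j = 0 then QO_symbols (C2 \<union> {b}) G2 else {})"
      then have st: "s \<in> QO_symbols (C1 \<union> {a}) G1" "t \<in> QO_symbols (C2 \<union> {b}) G2" "i = 0" "j = 0"
        by (simp_all split: if_splits)
      have "E (C1 \<union> C2) (G1 + G2) (symbol_comp a b s t) =
          mcomp P a b C1 G1 C2 G2 0 0 (E (C1 \<union> {a}) G1 s) (E (C2 \<union> {b}) G2 t)"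
        using U.respects_comp[of G1 G2] ok st(1,2) unfolding U.respects_comp_def E_def underlying_simps by blast
      then show "g (C1 \<union> C2) (G1 + G2) (i + j) (bilin_ext K (symbol_comp a b) (basis_vector s) (basis_vector t)) =
          mcomp P a b C1 G1 C2 G2 i j (g (C1 \<union> {a}) G1 i (basis_vector s)) (g (C2 \<union> {b}) G2 j (basis_vector t))"
        using g_basis[OF st(1)] g_basis[OF st(2)] g_basis[OF symbol_comp_glue(1)[OF st(1,2) ok]]
        by (simp add: st(3,4))
    qed
  next
    fix a b :: 'c and C G i x
    assume ok: "contr_ok a b C" and x: "x \<in> carrier (graded_span (QO_symbols (C \<union> {a, b}) G) i)"
    have fin: "finite C" "finite (C \<union> {a, b})" using ok by (simp_all add: contr_ok_def)
    show "g C (G + 1) i (lin_ext K (symbol_contr a b) x) = mcontr P a b C G i (g (C \<union> {a, b}) G i x)"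
    proof (rule K_linear_eqI[OF K_linear_comp[OF K_linear_contr[OF ok refl refl] g_lin[OF fin(1)]]
          K_linear_comp[OF g_lin[OF fin(2)] contr_lin[OF ok]] mod[OF fin(1)] _ x])
      fix s assume "s \<in> (if i = 0 then QO_symbols (C \<union> {a, b}) G else {})"
      then have s: "s \<in> QO_symbols (C \<union> {a, b}) G" "i = 0" by (simp_all split: if_splits)
      have "E C (G + 1) (symbol_contr a b s) = mcontr P a b C G 0 (E (C \<union> {a, b}) G s)"
        using U.extension_symbol_contr[OF ok s(1)] unfolding E_def underlying_simps Suc_eq_plus1 .
      then show "g C (G + 1) i (lin_ext K (symbol_contr a b) (basis_vector s)) =
          mcontr P a b C G i (g (C \<union> {a, b}) G i (basis_vector s))"
        using g_basis[OF s(1)] g_basis[OF symbol_contr_glue(1)[OF s(1) ok]] by (simp add: s(2))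
    qed
  qed
  moreover have "g C 0 i (Ass_incl C i x) = f C i x" if "finite C" "x \<in> elems (cob (Ass_lin K) C) i" for C i x
  proof -
    have x: "x \<in> carrier (graded_span (QO_symbols C 0) i)" using that(2) by (simp add: Ass_lin_simps QO_lin_elems)
    have "K_linear K (graded_span (QO_symbols C 0) i) (V C 0 i) (f C i)"
      using cyclic_morphismD(1)[OF f that(1)] mob[OF that(1)]
      by (simp add: Ass_lin_simps cyclic_part_simps QO_lin_simps)
    then show ?thesis unfolding Ass_incl_def
      by (rule K_linear_eqI[OF g_lin[OF that(1)] _ mod[OF that(1)] _ x])
        (use g_basis in \<open>simp add: E_def split: if_splits\<close>)
  qed
  ultimately have "extends K (Ass_lin K) Ass_incl (QO_lin K) P f g" by (simp add: extends_def)
  moreover have "h C G i x = g C G i x"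
    if h: "extends K (Ass_lin K) Ass_incl (QO_lin K) P f h" and fin: "finite C"
      and x: "x \<in> elems (mob (QO_lin K) C G) i" for h C G i x
  proof -
    have x': "x \<in> carrier (graded_span (QO_symbols C G) i)" using x by (simp add: QO_lin_elems)
    have "modular_morphism K (QO_lin K) P h" using h by (simp add: extends_def)
    from modular_morphismD(1)[OF this fin, of G]
    have "K_linear K (graded_span (QO_symbols C G) i) (V C G i) (h C G i)"
      using mob[OF fin] by (simp add: QO_lin_simps)
    then show ?thesis
      by (rule K_linear_eqI[OF _ g_lin[OF fin] mod[OF fin] _ x'])
        (use g_basis U.extends_unique[OF extends_on_basis[OF M inf P h]] in \<open>simp add: E_def split: if_splits\<close>)
  qed
  ultimately show ?thesis unfolding unique_extension_def by blast
qed

end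

theorem theorem3p1:
  fixes K :: "'k ring"
  assumes "field K"
    and "infinite (UNIV :: 'c set)"
  shows
    "(modular_operad Sets K (QO_set :: ('c, 'k, 'c symbol) modop) \<and>
      cyclic_morphism K Ass_set (cyclic_part (QO_set :: ('c, 'k, 'c symbol) modop)) Ass_incl \<and>
      (\<forall>(P :: ('c, 'k, 'v) modop) f.
         modular_operad Sets K P \<longrightarrow> cyclic_morphism K Ass_set (cyclic_part P) f \<longrightarrow>
         unique_extension K Ass_set Ass_incl QO_set P f) \<and>
      (\<forall>(E :: ('c, 'k, 'e) modop) \<eta>.
         modular_envelope_for TYPE('e) Sets K Ass_set E \<eta> \<longrightarrow>
         modular_envelope_for TYPE('c symbol) Sets K Ass_set E \<eta> \<longrightarrow>
         modular_isomorphic K QO_set E)) \<and>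
     (\<forall>M \<in> {Vect, GrVect, Chain}.
      modular_operad M K (QO_lin K :: ('c, 'k, 'c symbol \<Rightarrow> 'k) modop) \<and>
      cyclic_morphism K (Ass_lin K)
        (cyclic_part (QO_lin K :: ('c, 'k, 'c symbol \<Rightarrow> 'k) modop)) Ass_incl \<and>
      (\<forall>(P :: ('c, 'k, 'v) modop) f.
         modular_operad M K P \<longrightarrow> cyclic_morphism K (Ass_lin K) (cyclic_part P) f \<longrightarrow>
         unique_extension K (Ass_lin K) Ass_incl (QO_lin K) P f) \<and>
      (\<forall>(E :: ('c, 'k, 'e) modop) \<eta>.
         modular_envelope_for TYPE('e) M K (Ass_lin K) E \<eta> \<longrightarrow>
         modular_envelope_for TYPE('c symbol \<Rightarrow> 'k) M K (Ass_lin K) E \<eta> \<longrightarrow>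
         modular_isomorphic K (QO_lin K) E))"
proof (intro conjI ballI allI impI)
  interpret coefficient_field K using assms(1) by (simp add: coefficient_field_def)
  note inf = assms(2)
  have incl: "Ass_incl = (\<lambda>C i x. x)" by (simp add: Ass_incl_def fun_eq_iff)
  note set_operad = modular_operad_QO_set[OF inf, where K = K] and set_unique = unique_extension_QO_set[OF inf]
  show "modular_operad Sets K (QO_set :: ('c, 'k, 'c symbol) modop)" by (rule set_operad)
  show set_incl: "cyclic_morphism K Ass_set (cyclic_part (QO_set :: ('c, 'k, 'c symbol) modop)) Ass_incl"
    unfolding Ass_set_def incl by (rule cyclic_morphism_id)
  show "unique_extension K Ass_set Ass_incl QO_set P f"
    if "modular_operad Sets K P" "cyclic_morphism K Ass_set (cyclic_part P) f" for P :: "('c, 'k, 'v) modop" and f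
    using that by (rule set_unique)
  show "modular_isomorphic K QO_set E"
    if "modular_envelope_for TYPE('e) Sets K Ass_set E \<eta>" "modular_envelope_for TYPE('c symbol) Sets K Ass_set E \<eta>"
    for E :: "('c, 'k, 'e) modop" and \<eta>
    by (rule modular_envelope_unique[OF set_operad set_incl set_unique set_unique[OF set_operad set_incl] that])
  fix M assume M: "M \<in> {Vect, GrVect, Chain}"
  note lin_operad = modular_operad_QO_lin[OF M inf] and lin_unique = unique_extension_QO_lin[OF M inf]
  show "modular_operad M K (QO_lin K :: ('c, 'k, 'c symbol \<Rightarrow> 'k) modop)" by (rule lin_operad)
  show lin_incl: "cyclic_morphism K (Ass_lin K)
      (cyclic_part (QO_lin K :: ('c, 'k, 'c symbol \<Rightarrow> 'k) modop)) Ass_incl"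
    unfolding Ass_lin_def incl by (rule cyclic_morphism_id)
  show "unique_extension K (Ass_lin K) Ass_incl (QO_lin K) P f"
    if "modular_operad M K P" "cyclic_morphism K (Ass_lin K) (cyclic_part P) f" for P :: "('c, 'k, 'v) modop" and f
    using that by (rule lin_unique)
  show "modular_isomorphic K (QO_lin K) E"
    if "modular_envelope_for TYPE('e) M K (Ass_lin K) E \<eta>"
      "modular_envelope_for TYPE('c symbol \<Rightarrow> 'k) M K (Ass_lin K) E \<eta>"
    for E :: "('c, 'k, 'e) modop" and \<eta>
    by (rule modular_envelope_unique[OF lin_operad lin_incl lin_unique lin_unique[OF lin_operad lin_incl] that])
qed

end
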